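(* Let $d\ge3$, $\mu>-1$, $\lambda>0$, $\delta=\frac{d-2}2$ and $n\ge0$. Write $x=r\xi$, $y=s\varrho$ with $r=\|x\|$, $s=\|y\|$, $\xi,\varrho\in\mathbb S^{d-1}$. Then $$\tilde{\mathbb L}_n(x,y)=\mathbb L_n(x,y)-\frac{A_0}\lambda\sum_{k=0}^n\mathbf K^{\mu,k+\delta}_{[\frac{n-k}2]}(2r^2-1,1)^t\,\Lambda^{(\mu,k+\delta;M_k)}_{[\frac{n-k}2]}\,\mathbf K^{\mu,k+\delta}_{[\frac{n-k}2]}(2s^2-1,1)\;2^k(rs)^k\,\frac{k+\delta}\delta\,C_k^\delta(\langle\xi,\varrho\rangle),$$ where $C_k^\delta$ denotes the ultraspherical (Gegenbauer) polynomial of degree $k$ and $[\cdot]$ the integer part.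
   Context: Ball kernels: $\mathbb B^d$ is the closed unit ball, $\mathbb S^{d-1}$ the unit sphere with surface measure $d\sigma$ and area $\sigma_d=2\pi^{d/2}/\Gamma(d/2)$; $W_\mu(x)=(1-\|x\|^2)^\mu$, $\omega_\mu=\int_{\mathbb B^d}W_\mu\,dx=\pi^{d/2}\Gamma(\mu+1)/\Gamma(\mu+d/2+1)$; $$\langle f,g\rangle_\mu=\frac1{\omega_\mu}\int_{\mathbb B^d}fg\,W_\mu\,dx,\qquad\langle f,g\rangle_\mu^S=\langle f,g\rangle_\mu+\frac\lambda{\sigma_d}\int_{\mathbb S^{d-1}}\frac{\partial f}{\partial\mathbf n}\frac{\partial g}{\partial\mathbf n}\,d\sigma,$$ with $\frac{\partial f}{\partial\mathbf n}=\sum_ix_i\frac{\partial f}{\partial x_i}$ on $\mathbb S^{d-1}$. $\mathbb L_n$ and $\tilde{\mathbb L}_n$ are the kernels $\sum_ip_i(x)p_i(y)/\langle p_i,p_i\rangle$ over a mutually orthogonal basis of the space of polynomials of total degree at most $n$ in $d$ variables, with respect to $\langle\cdot,\cdot\rangle_\mu$ and $\langle\cdot,\cdot\rangle_\mu^S$ respectively (independent of the basis). Univariate objects: $P_i^{(\alpha,\beta)}$ is the Jacobi polynomial with $P_i^{(\alpha,\beta)}(1)=\binom{i+\alpha}i$, $h_i^{(\alpha,\beta)}=\int_{-1}^1P_i^{(\alpha,\beta)}(t)^2(1-t)^\alpha(1+t)^\beta dt$, $K_m(t,u;\alpha,\beta)=\sum_{i=0}^mP_i^{(\alpha,\beta)}(t)P_i^{(\alpha,\beta)}(u)/h_i^{(\alpha,\beta)}$,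 $K_m^{(a,b)}=\partial_t^a\partial_u^bK_m$, $$\mathbf K_m^{\alpha,\beta}(t,1)=\begin{pmatrix} K_m(t,1;\alpha,\beta) \\ K_m^{(0,1)}(t,1;\alpha,\beta)\end{pmatrix},\qquad\mathcal K_m^{(\alpha,\beta)}=\begin{pmatrix} K_m(1,1)&K_m^{(1,0)}(1,1) \\ K_m^{(0,1)}(1,1)&K_m^{(1,1)}(1,1)\end{pmatrix},$$ $\Lambda_m^{(\alpha,\beta;M)}=(I+M\mathcal K_m^{(\alpha,\beta)})^{-1}M$, and $$A_0=\lambda2^{\delta+\mu+2}\frac{\omega_\mu}{\sigma_d},\qquad M_k=2^kA_0\begin{pmatrix}k^2&4k \\ 4k&16\end{pmatrix}.$$ *)

theory Defs
  imports "HOL-Analysis.Analysis"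
begin

section \<open>Polynomials in d variables and kernels of bilinear forms\<close>

text \<open>Polynomials in d variables are identified with the functions on \<open>real ^ 'n\<close> they induce,
  where \<open>d = CARD('n)\<close>.\<close>

definition polys_upto :: "nat \<Rightarrow> (real ^ 'n \<Rightarrow> real) set" where
  "polys_upto n =
    {p. \<exists>c. p = (\<lambda>x. \<Sum>a | (\<Sum>i\<in>UNIV. a i) \<le> n. c a * (\<Prod>i\<in>UNIV. (x $ i) ^ a i))}"

definition orthogonal_poly_basis ::
  "((real ^ 'n \<Rightarrow> real) \<Rightarrow> (real ^ 'n \<Rightarrow> real) \<Rightarrow> real) \<Rightarrow> nat \<Rightarrow> (real ^ 'n \<Rightarrow> real) set \<Rightarrow> bool"
  where
  "orthogonal_poly_basis ip n B \<longleftrightarrow>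
    finite B \<and> B \<subseteq> polys_upto n \<and>
    (\<forall>f\<in>polys_upto n. \<exists>c. \<forall>x. f x = (\<Sum>p\<in>B. c p * p x)) \<and>
    (\<forall>c. (\<forall>x. (\<Sum>p\<in>B. c p * p x) = 0) \<longrightarrow> (\<forall>p\<in>B. c p = 0)) \<and>
    (\<forall>p\<in>B. \<forall>q\<in>B. p \<noteq> q \<longrightarrow> ip p q = 0)"

definition basis_kernel ::
  "((real ^ 'n \<Rightarrow> real) \<Rightarrow> (real ^ 'n \<Rightarrow> real) \<Rightarrow> real) \<Rightarrow> (real ^ 'n \<Rightarrow> real) set \<Rightarrow>
    real ^ 'n \<Rightarrow> real ^ 'n \<Rightarrow> real" where
  "basis_kernel ip B x y = (\<Sum>p\<in>B. p x * p y / ip p p)"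

section \<open>The inner products on the ball\<close>

definition ball_weight :: "real \<Rightarrow> real ^ 'n \<Rightarrow> real" where
  "ball_weight \<mu> x = (1 - (norm x)\<^sup>2) powr \<mu>"

definition ball_mass :: "'n::finite itself \<Rightarrow> real \<Rightarrow> real" where
  "ball_mass _ \<mu> = (LINT x:cball (0 :: real ^ 'n) 1|lborel. ball_weight \<mu> x)"

definition ball_inner :: "real \<Rightarrow> (real ^ 'n \<Rightarrow> real) \<Rightarrow> (real ^ 'n \<Rightarrow> real) \<Rightarrow> real" where
  "ball_inner \<mu> f g =
    (LINT x:cball 0 1|lborel. f x * g x * ball_weight \<mu> x) / ball_mass TYPE('n) \<mu>"

text \<open>Surface measure on the unit sphere, as a Borel measure on the ambient space: the measure of
  a part \<open>A\<close> of the sphere is \<open>d\<close> times the volume of the cone \<open>{t *\<^sub>R \<xi> | 0 < t < 1, \<xi> \<in> A}\<close>.\<close>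

definition sphere_measure :: "'a::euclidean_space measure" where
  "sphere_measure =
    distr (density lborel (\<lambda>x. ennreal (real DIM('a)) * indicator (ball 0 1) x)) borel
      (\<lambda>x. x /\<^sub>R norm x)"

definition sphere_area :: "'n::finite itself \<Rightarrow> real" where
  "sphere_area _ = measure sphere_measure (sphere (0 :: real ^ 'n) 1)"

lemma sphere_area_eq:
  "sphere_area TYPE('n::finite) = 2 * pi powr (real CARD('n) / 2) / Gamma (real CARD('n) / 2)"
proof -
  let ?d = "real CARD('n)"
  let ?g = "\<lambda>x :: real ^ 'n. x /\<^sub>R norm x"
  have d: "?d > 0" by simp
  have g: "?g \<in> borel_measurable borel" by measurable
  have S: "?g -` sphere 0 1 \<in> sets borel"
    using measurable_sets_borel[OF g, of "sphere 0 1"] by simp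
  have W: "(\<lambda>x :: real ^ 'n. ennreal ?d * indicator (ball 0 1) x) \<in> borel_measurable borel"
    by (intro borel_measurable_times_ennreal borel_measurable_const borel_measurable_indicator)
      simp
  have *: "emeasure sphere_measure (sphere (0 :: real ^ 'n) 1) = ennreal (?d * unit_ball_vol ?d)"
  proof -
    have "emeasure sphere_measure (sphere (0 :: real ^ 'n) 1)
      = (\<integral>\<^sup>+x. ennreal ?d * indicator (ball 0 1) x * indicator (?g -` sphere 0 1) x \<partial>lborel)"
      unfolding sphere_measure_def using g
      by (subst emeasure_distr) (use S W in \<open>auto intro!: emeasure_density\<close>)
    also have "\<dots> = (\<integral>\<^sup>+x. ennreal ?d * indicator (ball (0 :: real ^ 'n) 1) x \<partial>lborel)"
    proof (rule nn_integral_cong_AE)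
      have "AE x :: real ^ 'n in lborel. x \<noteq> 0" by (rule AE_lborel_singleton)
      then show "AE x :: real ^ 'n in lborel.
        ennreal ?d * indicator (ball 0 1) x * indicator (?g -` sphere 0 1) x
          = ennreal ?d * indicator (ball 0 1) x"
        by (rule AE_mp) (auto simp: indicator_def)
    qed
    also have "\<dots> = ennreal ?d * emeasure lborel (ball (0 :: real ^ 'n) 1)"
      by (rule nn_integral_cmult_indicator) auto
    also have "\<dots> = ennreal (?d * unit_ball_vol ?d)"
      by (simp add: emeasure_ball ennreal_mult)
    finally show ?thesis .
  qed
  have "sphere_area TYPE('n) = ?d * unit_ball_vol ?d"
    using * by (simp add: sphere_area_def measure_def)
  also have "?d * unit_ball_vol ?d = 2 * pi powr (?d / 2) / Gamma (?d / 2)"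
  proof -
    have G: "Gamma (?d / 2 + 1) = ?d / 2 * Gamma (?d / 2)"
      by (rule Gamma_plus1) (use d nonpos_Ints_nonpos[of "?d / 2"] in linarith)
    show ?thesis
      unfolding unit_ball_vol_def G using d by (simp add: divide_simps)
  qed
  finally show ?thesis .
qed

definition partial_deriv :: "'n \<Rightarrow> (real ^ 'n \<Rightarrow> real) \<Rightarrow> real ^ 'n \<Rightarrow> real" where
  "partial_deriv i f x = deriv (\<lambda>t. f (x + t *\<^sub>R axis i 1)) 0"

definition normal_deriv :: "(real ^ 'n \<Rightarrow> real) \<Rightarrow> real ^ 'n \<Rightarrow> real" where
  "normal_deriv f x = (\<Sum>i\<in>UNIV. x $ i * partial_deriv i f x)"

definition ball_sobolev_inner ::
  "real \<Rightarrow> real \<Rightarrow> (real ^ 'n \<Rightarrow> real) \<Rightarrow> (real ^ 'n \<Rightarrow> real) \<Rightarrow> real" where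
  "ball_sobolev_inner \<mu> lam f g =
    ball_inner \<mu> f g + lam / sphere_area TYPE('n) *
      (LINT x:sphere 0 1|sphere_measure. normal_deriv f x * normal_deriv g x)"

section \<open>Jacobi and Gegenbauer polynomials\<close>

text \<open>Szego, Orthogonal Polynomials, (4.3.2). At \<open>t = 1\<close> only the summand \<open>s = 0\<close> survives.\<close>

definition jacobi :: "nat \<Rightarrow> real \<Rightarrow> real \<Rightarrow> real \<Rightarrow> real" where
  "jacobi i \<alpha> \<beta> t =
    (\<Sum>s\<le>i. ((real i + \<alpha>) gchoose (i - s)) * ((real i + \<beta>) gchoose s) *
      ((t - 1) / 2) ^ s * ((t + 1) / 2) ^ (i - s))"

lemma jacobi_at_1: "jacobi i \<alpha> \<beta> 1 = (real i + \<alpha>) gchoose i"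
proof -
  have "jacobi i \<alpha> \<beta> 1 =
    (\<Sum>s\<le>i. if s = 0 then ((real i + \<alpha>) gchoose i) else 0)"
    unfolding jacobi_def by (rule sum.cong) auto
  then show ?thesis by simp
qed

definition jacobi_norm2 :: "nat \<Rightarrow> real \<Rightarrow> real \<Rightarrow> real" where
  "jacobi_norm2 i \<alpha> \<beta> =
    (LINT t:{-1..1}|lborel. (jacobi i \<alpha> \<beta> t)\<^sup>2 * (1 - t) powr \<alpha> * (1 + t) powr \<beta>)"

definition jacobi_kernel :: "nat \<Rightarrow> real \<Rightarrow> real \<Rightarrow> real \<Rightarrow> real \<Rightarrow> real" where
  "jacobi_kernel m \<alpha> \<beta> t u =
    (\<Sum>i\<le>m. jacobi i \<alpha> \<beta> t * jacobi i \<alpha> \<beta> u / jacobi_norm2 i \<alpha> \<beta>)"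

text \<open>\<open>a\<close> derivatives in the first and \<open>b\<close> derivatives in the second variable.\<close>

definition jacobi_kernel_deriv ::
  "nat \<Rightarrow> nat \<Rightarrow> nat \<Rightarrow> real \<Rightarrow> real \<Rightarrow> real \<Rightarrow> real \<Rightarrow> real" where
  "jacobi_kernel_deriv a b m \<alpha> \<beta> t u =
    (deriv ^^ a) (\<lambda>t'. (deriv ^^ b) (\<lambda>u'. jacobi_kernel m \<alpha> \<beta> t' u') u) t"

definition kernel_vec :: "nat \<Rightarrow> real \<Rightarrow> real \<Rightarrow> real \<Rightarrow> real ^ 2" where
  "kernel_vec m \<alpha> \<beta> t =
    vector [jacobi_kernel m \<alpha> \<beta> t 1, jacobi_kernel_deriv 0 1 m \<alpha> \<beta> t 1]"

definition kernel_mat :: "nat \<Rightarrow> real \<Rightarrow> real \<Rightarrow> real ^ 2 ^ 2" where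
  "kernel_mat m \<alpha> \<beta> = vector
    [vector [jacobi_kernel m \<alpha> \<beta> 1 1, jacobi_kernel_deriv 1 0 m \<alpha> \<beta> 1 1],
     vector [jacobi_kernel_deriv 0 1 m \<alpha> \<beta> 1 1, jacobi_kernel_deriv 1 1 m \<alpha> \<beta> 1 1]]"

definition Lambda_mat :: "nat \<Rightarrow> real \<Rightarrow> real \<Rightarrow> real ^ 2 ^ 2 \<Rightarrow> real ^ 2 ^ 2" where
  "Lambda_mat m \<alpha> \<beta> M = matrix_inv (mat 1 + M ** kernel_mat m \<alpha> \<beta>) ** M"

definition gegenbauer :: "nat \<Rightarrow> real \<Rightarrow> real \<Rightarrow> real" where
  "gegenbauer k \<delta> t =
    (\<Sum>j\<le>k div 2. (- 1) ^ j * pochhammer \<delta> (k - j) / (fact j * fact (k - 2 * j)) *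
      (2 * t) ^ (k - 2 * j))"

section \<open>The mass matrices\<close>

definition A0_const :: "'n::finite itself \<Rightarrow> real \<Rightarrow> real \<Rightarrow> real" where
  "A0_const T \<mu> lam =
    lam * 2 powr ((real CARD('n) - 2) / 2 + \<mu> + 2) * ball_mass T \<mu> / sphere_area T"

definition mass_mat :: "real \<Rightarrow> nat \<Rightarrow> real ^ 2 ^ 2" where
  "mass_mat A0 k = (2 ^ k * A0) *\<^sub>R vector
    [vector [(real k)\<^sup>2, 4 * real k],
     vector [4 * real k, 16]]"

end

theory Submission
  imports Defs "HOL-Probability.Distributions"
begin

text \<open>
  Both inner products decouple on products \<open>q (2 |y|\<^sup>2 - 1) Y y\<close> with \<open>Y\<close> a solid harmonic of degree
  \<open>k\<close>: on the sphere the normal derivative of such a product is \<open>(k q 1 + 4 q' 1) Y\<close>, so the Sobolev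
  product is a multiple of the Jacobi product of the radial factors plus the rank one form
  \<open>2 ^ k A0 (k q 1 + 4 q' 1) (k p 1 + 4 p' 1)\<close>. The reproducing kernel of a rank one perturbation is
  given by the Sherman-Morrison formula, and \<open>\<lambda> = 0\<close> is the unperturbed case.

  The kernel of any orthogonal basis is the only one that reproduces all polynomials of degree at
  most \<open>n\<close>. By polarization it suffices to reproduce powers of linear forms, which are combinations
      of
  \<open>|y|\<^sup>2\<^sup>j\<close> times zonal harmonics. The reproducing property of the latter on the sphere follows by
  replacing the surface measure with the Gaussian measure (homogeneity, polar coordinates),
      for which
  integration by parts is elementary.
\<close>

section \<open>Polynomial functions\<close>

text \<open>The given bases are arbitrary, so neither they nor a basis of spherical harmonics is
  ever written down: zonal functions with varying pole take the place of the harmonics, and a closed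
  formula for the kernel is checked rather than derived. The constant C = A0 / \<lambda> is a ratio
  of normalizations: in degree k the ball integral is the Jacobi product of the radial factors
  divided by 2^k C, whereas the boundary term carries \<lambda> for every k. Multiplying by 2^k C
  leaves the Jacobi product plus the mass 2^k A0 on the boundary functional, which explains both M_k
  and the factor A0 / \<lambda> in front of the sum. As M_k = 2^k A0 w w^t with w = (k, 4), the
  matrix correction is a scalar one in disguise, and invertibility of I + M_k K reduces to
  positivity of one number. Since d >= 3 gives \<delta> > 0, the leading zonal coefficient is
  nonzero, so powers of linear forms can be recovered from zonal functions.\<close>

definition monomial :: "('n \<Rightarrow> nat) \<Rightarrow> real ^ 'n \<Rightarrow> real" where
  "monomial a x = (\<Prod>i\<in>UNIV. (x $ i) ^ a i)"

text \<open>A sum over an infinite index set is 0 by convention, so finiteness is what gives the sum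
  in \<open>polys_upto\<close> its intended meaning.\<close>

lemma finite_multiindices: "finite {a :: 'n::finite \<Rightarrow> nat. (\<Sum>i\<in>UNIV. a i) \<le> n}"
proof (rule finite_subset)
  show "{a :: 'n \<Rightarrow> nat. (\<Sum>i\<in>UNIV. a i) \<le> n} \<subseteq> UNIV \<rightarrow>\<^sub>E {..n}"
  proof
    fix a :: "'n \<Rightarrow> nat"
    assume "a \<in> {a. (\<Sum>i\<in>UNIV. a i) \<le> n}"
    then have "a i \<le> n" for i
      using member_le_sum[of i UNIV a] by auto
    then show "a \<in> UNIV \<rightarrow>\<^sub>E {..n}" by auto
  qed
  show "finite (UNIV \<rightarrow>\<^sub>E {..n} :: ('n \<Rightarrow> nat) set)"
    by (intro finite_PiE) auto
qed

lemma polys_uptoE: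
  assumes "f \<in> polys_upto n"
  obtains c where "f = (\<lambda>x. \<Sum>a | (\<Sum>i\<in>UNIV. a i) \<le> n. c a * monomial a x)"
  using assms unfolding polys_upto_def monomial_def by auto

lemma polys_upto_add:
  assumes "f \<in> polys_upto n" "g \<in> polys_upto n"
  shows "(\<lambda>x. f x + g x) \<in> polys_upto n"
proof -
  obtain c d where "f = (\<lambda>x. \<Sum>a | (\<Sum>i\<in>UNIV. a i) \<le> n. c a * monomial a x)"
    "g = (\<lambda>x. \<Sum>a | (\<Sum>i\<in>UNIV. a i) \<le> n. d a * monomial a x)"
    using assms by (elim polys_uptoE)
  then have "(\<lambda>x. f x + g x) = (\<lambda>x. \<Sum>a | (\<Sum>i\<in>UNIV. a i) \<le> n. (c a + d a) * monomial a x)"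
    by (simp add: sum.distrib algebra_simps)
  then show ?thesis unfolding polys_upto_def monomial_def
      by (auto intro!: exI[of _ "\<lambda>a. c a + d a"])
qed

lemma polys_upto_cmult:
  assumes "f \<in> polys_upto n"
  shows "(\<lambda>x. c * f x) \<in> polys_upto n"
proof -
  obtain d where "f = (\<lambda>x. \<Sum>a | (\<Sum>i\<in>UNIV. a i) \<le> n. d a * monomial a x)"
    using assms by (elim polys_uptoE)
  then have "(\<lambda>x. c * f x) = (\<lambda>x. \<Sum>a | (\<Sum>i\<in>UNIV. a i) \<le> n. (c * d a) * monomial a x)"
    by (simp add: sum_distrib_left mult.assoc)
  then show ?thesis unfolding polys_upto_def monomial_def by (auto intro!: exI[of _ "\<lambda>a. c * d a"])
qed

lemma polys_upto_monomial:
  assumes "(\<Sum>i\<in>UNIV. a i) \<le> n"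
  shows "monomial a \<in> polys_upto n"
proof -
  have "monomial a x = (\<Sum>b | (\<Sum>i\<in>UNIV. b i) \<le> n. (if b = a then 1 else 0) * monomial b x)" for x
  proof -
    have "(\<Sum>b | (\<Sum>i\<in>UNIV. b i) \<le> n. (if b = a then 1 else 0) * monomial b x) =
        (\<Sum>b\<in>{a}. monomial b x)"
      using assms finite_multiindices[of n] by (intro sum.mono_neutral_cong_right) auto
    then show ?thesis by simp
  qed
  then show ?thesis
    unfolding polys_upto_def monomial_def
    by (auto intro!: exI[of _ "\<lambda>b. if b = a then 1 else 0"] ext)
qed

text \<open>Reduces additive statements to single monomials. The \<open>add\<close> case keeps the
  membership of both summands, because the rules for derivatives and integrals of sums ask for
  polynomials.\<close>

lemma polys_upto_induct [consumes 1, case_names zero add monomial]: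
  fixes f :: "real ^ 'n \<Rightarrow> real"
  assumes "f \<in> polys_upto n"
    and "P (\<lambda>x. 0)"
    and "\<And>f g. \<lbrakk>f \<in> polys_upto n; g \<in> polys_upto n; P f; P g\<rbrakk> \<Longrightarrow> P (\<lambda>x. f x + g x)"
    and "\<And>c a. (\<Sum>i\<in>UNIV. a i) \<le> n \<Longrightarrow> P (\<lambda>x. c * monomial a x)"
  shows "P f"
proof -
  obtain c where f: "f = (\<lambda>x. \<Sum>a | (\<Sum>i\<in>UNIV. a i) \<le> n. c a * monomial a x)"
    using assms(1) by (elim polys_uptoE)
  have z: "(\<lambda>x :: real ^ 'n. 0) \<in> polys_upto n"
    using polys_upto_cmult[OF assms(1), of 0] by simp
  have "P (\<lambda>x. \<Sum>a\<in>A. c a * monomial a x) \<and> (\<lambda>x. \<Sum>a\<in>A. c a * monomial a x) \<in> polys_upto n"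
    if "finite A" "A \<subseteq> {a. (\<Sum>i\<in>UNIV. a i) \<le> n}" for A
    using that
  proof (induction A rule: finite_induct)
    case empty
    then show ?case using assms(2) z by simp
  next
    case (insert b A)
    have "(\<lambda>x. c b * monomial b x) \<in> polys_upto n"
      using insert by (intro polys_upto_cmult polys_upto_monomial) auto
    then show ?case
      using insert assms(3)[of "\<lambda>x. c b * monomial b x" "\<lambda>x. \<Sum>a\<in>A. c a * monomial a x"]
        assms(4)[of b "c b"] polys_upto_add[of "\<lambda>x. c b * monomial b x" n "\<lambda>x. \<Sum>a\<in>A. c a *
            monomial a x"]
      by simp
  qed
  then show ?thesis unfolding f using finite_multiindices by blast
qed

lemma polys_upto_const: "(\<lambda>x. c) \<in> polys_upto n"
  using polys_upto_cmult[OF polys_upto_monomial[of "\<lambda>_. 0" n], of c] by (simp add: monomial_def)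

lemma polys_upto_mono:
  assumes "f \<in> polys_upto m" "m \<le> n"
  shows "f \<in> polys_upto n"
  using assms(1)
proof (induction rule: polys_upto_induct)
  case (monomial c a)
  then show ?case using assms(2) by (intro polys_upto_cmult polys_upto_monomial) auto
qed (auto intro: polys_upto_const polys_upto_add)

lemma polys_upto_sum:
  assumes "\<And>i. i \<in> A \<Longrightarrow> f i \<in> polys_upto n"
  shows "(\<lambda>x. \<Sum>i\<in>A. f i x) \<in> polys_upto n"
  using assms
  by (induction A rule: infinite_finite_induct) (auto intro: polys_upto_const polys_upto_add)

lemma monomial_mult: "monomial a x * monomial b x = monomial (\<lambda>i. a i + b i) x"
  by (simp add: monomial_def power_add prod.distrib)

lemma polys_upto_mult:
  assumes "f \<in> polys_upto m" "g \<in> polys_upto n"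
  shows "(\<lambda>x. f x * g x) \<in> polys_upto (m + n)"
  using assms(1)
proof (induction rule: polys_upto_induct)
  case (monomial c a)
  show ?case
    using assms(2)
  proof (induction rule: polys_upto_induct)
    case (monomial d b)
    have "(\<lambda>x. (c * d) * monomial (\<lambda>i. a i + b i) x) \<in> polys_upto (m + n)"
      using monomial \<open>(\<Sum>i\<in>UNIV. a i) \<le> m\<close>
      by (intro polys_upto_cmult polys_upto_monomial) (auto simp: sum.distrib)
    then show ?case by (simp add: monomial_mult[symmetric] mult_ac)
  qed (auto simp: distrib_left intro: polys_upto_const polys_upto_add)
qed (auto simp: distrib_right intro: polys_upto_const polys_upto_add)

lemma polys_upto_power:
  assumes "f \<in> polys_upto m"
  shows "(\<lambda>x. f x ^ k) \<in> polys_upto (k * m)"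
  by (induction k) (use assms polys_upto_mult[of f m] in \<open>auto intro: polys_upto_const\<close>)

lemma polys_upto_component: "(\<lambda>x. x $ i) \<in> polys_upto 1"
proof -
  have "(\<Prod>j\<in>UNIV. (x $ j) ^ (if j = i then 1 else 0)) = (\<Prod>j\<in>{i}. x $ j)" for x :: "real ^ 'a"
    by (rule prod.mono_neutral_cong_right) auto
  then have *: "monomial (\<lambda>j. if j = i then 1 else 0) = (\<lambda>x. x $ i)"
    by (simp add: monomial_def fun_eq_iff)
  then show ?thesis using polys_upto_monomial[of "\<lambda>j. if j = i then 1 else 0" 1] unfolding * by simp
qed

lemma polys_upto_inner: "(\<lambda>x. v \<bullet> x) \<in> polys_upto 1"
  unfolding inner_vec_def inner_real_def
  by (intro polys_upto_sum polys_upto_cmult polys_upto_component)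

lemma polys_upto_norm2: "(\<lambda>x. x \<bullet> x) \<in> polys_upto 2"
  unfolding inner_vec_def inner_real_def
  by (intro polys_upto_sum) (use polys_upto_mult[OF polys_upto_component polys_upto_component]
      in \<open>simp add: numeral_2_eq_2\<close>)

section \<open>Comparison with the inductive notion of polynomial function\<close>

lemma real_polynomial_function_component: "real_polynomial_function (\<lambda>x :: real ^ 'n. x $ i)"
  by (rule real_polynomial_function.intros(1)) (rule bounded_linear_vec_nth)

lemma real_polynomial_function_inner: "real_polynomial_function (\<lambda>x :: 'a::real_inner. v \<bullet> x)"
  by (rule real_polynomial_function.intros(1)) (rule bounded_linear_inner_right)

lemma real_polynomial_function_norm2: "real_polynomial_function (\<lambda>x :: real ^ 'n. x \<bullet> x)"
  unfolding inner_vec_def inner_real_def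
  by (rule real_polynomial_function_sum)
    (simp, rule real_polynomial_function.intros(4)[OF real_polynomial_function_component
      real_polynomial_function_component])

lemma real_polynomial_function_monomial: "real_polynomial_function (monomial a)"
  unfolding monomial_def[abs_def]
  by (rule real_polynomial_function_prod)
    (simp, rule real_polynomial_function_power[OF real_polynomial_function_component])

lemma real_polynomial_function_cmult:
  "real_polynomial_function f \<Longrightarrow> real_polynomial_function (\<lambda>x. c * f x)"
  by (rule real_polynomial_function.intros(4)[OF real_polynomial_function.intros(2)])

lemma polys_upto_imp_real_polynomial_function:
  assumes "f \<in> polys_upto n"
  shows "real_polynomial_function f"
  using assms
proof (induction rule: polys_upto_induct)
  case (monomial c a)
  then show ?case by (intro real_polynomial_function_cmult real_polynomial_function_monomial)
qed (rule real_polynomial_function.intros(2), rule real_polynomial_function.intros(3))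

text \<open>The inductive notion is convenient for calculus, the expansion into monomials for
  Gaussian moments; this direction carries the moment computations back to all polynomial
  functions.\<close>

lemma real_polynomial_function_imp_polys_upto:
  fixes f :: "real ^ 'n \<Rightarrow> real"
  assumes "real_polynomial_function f"
  shows "\<exists>n. f \<in> polys_upto n"
  using assms
proof (induction rule: real_polynomial_function.induct)
  case (linear f)
  then have l: "linear f" by (rule bounded_linear.linear)
  have eq: "f x = (\<Sum>i\<in>UNIV. f (axis i 1) * x $ i)" for x
  proof -
    have "(\<Sum>i\<in>UNIV. x $ i *\<^sub>R axis i 1) = x"
      using basis_expansion[of x] by (simp add: scalar_mult_eq_scaleR)
    then have "f x = f (\<Sum>i\<in>UNIV. x $ i *\<^sub>R axis i 1)" by simp
    also have "\<dots> = (\<Sum>i\<in>UNIV. f (axis i 1) * x $ i)"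
      by (simp only: linear_sum[OF l] linear_cmul[OF l] real_scaleR_def mult.commute)
    finally show ?thesis .
  qed
  have "(\<lambda>x. \<Sum>i\<in>UNIV. f (axis i 1) * x $ i) \<in> polys_upto 1"
    by (intro polys_upto_sum polys_upto_cmult polys_upto_component)
  then have "f \<in> polys_upto 1" unfolding eq[symmetric] .
  then show ?case ..
next
  case (const c)
  then show ?case using polys_upto_const by blast
next
  case (add f g)
  then obtain m n where "f \<in> polys_upto m" "g \<in> polys_upto n" by blast
  then have "f \<in> polys_upto (max m n)" "g \<in> polys_upto (max m n)"
    by (auto elim: polys_upto_mono)
  then show ?case by (blast intro: polys_upto_add)
next
  case (mult f g)
  then show ?case using polys_upto_mult by blast
qed

section \<open>Directional derivatives and solid harmonics\<close>

text \<open>The Frechet derivative is linear in the direction and comes with sum, product and chain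
  rules. \<open>partial_deriv_eq_pd\<close> and \<open>normal_deriv_eq_pd\<close> translate the
  derivatives of the statement into it.\<close>

definition pd :: "'a::real_normed_vector \<Rightarrow> ('a \<Rightarrow> real) \<Rightarrow> 'a \<Rightarrow> real" where
  "pd v f x = frechet_derivative f (at x) v"

lemma pd_eqI: "(f has_derivative f') (at x) \<Longrightarrow> pd v f x = f' v"
  unfolding pd_def by (metis frechet_derivative_at)

lemma real_polynomial_function_differentiable:
  "real_polynomial_function f \<Longrightarrow> f differentiable (at x)"
proof (induction rule: real_polynomial_function.induct)
  case (linear f)
  then show ?case by (rule bounded_linear_imp_differentiable)
qed auto

lemma has_derivative_pd:
  "real_polynomial_function f \<Longrightarrow> (f has_derivative (\<lambda>v. pd v f x)) (at x)"
  unfolding pd_def using real_polynomial_function_differentiable frechet_derivative_works by metis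

lemma pd_const [simp]: "pd v (\<lambda>x. c) = (\<lambda>x. 0)"
  by (rule ext) (rule pd_eqI, rule has_derivative_const)

lemma pd_bounded_linear: "bounded_linear f \<Longrightarrow> pd v f = (\<lambda>x. f v)"
  by (rule ext) (rule pd_eqI, rule bounded_linear_imp_has_derivative)

lemma pd_add:
  "\<lbrakk>real_polynomial_function f; real_polynomial_function g\<rbrakk> \<Longrightarrow>
    pd v (\<lambda>x. f x + g x) = (\<lambda>x. pd v f x + pd v g x)"
  by (rule ext) (rule pd_eqI[OF has_derivative_add[OF has_derivative_pd has_derivative_pd]])

lemma pd_mult:
  "\<lbrakk>real_polynomial_function f; real_polynomial_function g\<rbrakk> \<Longrightarrow>
    pd v (\<lambda>x. f x * g x) = (\<lambda>x. f x * pd v g x + pd v f x * g x)"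
  by (rule ext) (rule pd_eqI[OF has_derivative_mult[OF has_derivative_pd has_derivative_pd]])

lemma pd_cmult:
  "real_polynomial_function f \<Longrightarrow> pd v (\<lambda>x. c * f x) = (\<lambda>x. c * pd v f x)"
  by (subst pd_mult) auto

lemma pd_sum:
  assumes "finite A" "\<And>i. i \<in> A \<Longrightarrow> real_polynomial_function (f i)"
  shows "pd v (\<lambda>x. \<Sum>i\<in>A. f i x) = (\<lambda>x. \<Sum>i\<in>A. pd v (f i) x)"
  using assms
proof (induction A rule: finite_induct)
  case (insert a A)
  then have "real_polynomial_function (\<lambda>x. \<Sum>i\<in>A. f i x)"
    by (intro real_polynomial_function_sum) auto
  then show ?case using insert by (simp add: pd_add)
qed simp

lemma real_polynomial_function_pd:
  assumes "real_polynomial_function f"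
  shows "real_polynomial_function (pd v f)"
  using assms
  by (induction rule: real_polynomial_function.induct)
    (auto simp: pd_bounded_linear pd_add pd_mult)

lemma linear_pd:
  "real_polynomial_function f \<Longrightarrow> linear (\<lambda>v. pd v f x)"
  using has_derivative_pd has_derivative_linear by blast

text \<open>Symmetry of second derivatives follows along the construction of the polynomial: linear
  functions have vanishing second derivatives, and the product rule applied twice is symmetric in
  the two directions.\<close>

lemma pd_commute:
  assumes "real_polynomial_function f"
  shows "pd u (pd v f) = pd v (pd u f)"
  using assms
  by (induction rule: real_polynomial_function.induct)
    (auto simp: pd_bounded_linear pd_add pd_mult real_polynomial_function_pd
      real_polynomial_function.intros(4))

lemma pd_power:
  assumes "real_polynomial_function f"
  shows "pd v (\<lambda>x. f x ^ m) = (\<lambda>x. real m * f x ^ (m - 1) * pd v f x)"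
  by (rule ext, rule pd_eqI[THEN trans, OF has_derivative_power[OF has_derivative_pd[OF assms]]])
      (simp add: mult_ac)

lemma pd_inner: "pd v (\<lambda>x :: 'a::real_inner. a \<bullet> x) = (\<lambda>x. a \<bullet> v)"
  by (rule pd_bounded_linear) (rule bounded_linear_inner_right)

lemma pd_inner_self: "pd v (\<lambda>x :: 'a::real_inner. x \<bullet> x) = (\<lambda>x. 2 * (x \<bullet> v))"
  by (rule ext, rule pd_eqI[THEN trans, OF has_derivative_inner[OF has_derivative_ident
      has_derivative_ident]])
    (simp add: inner_commute)

lemma pd_components:
  fixes f :: "real ^ 'n \<Rightarrow> real"
  assumes "real_polynomial_function f"
  shows "pd v f x = (\<Sum>i\<in>UNIV. v $ i * pd (axis i 1) f x)"
proof -
  have "pd v f x = pd (\<Sum>i\<in>UNIV. v $ i *\<^sub>R axis i 1) f x"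
    by (subst basis_expansion[of v, symmetric]) (simp add: scalar_mult_eq_scaleR)
  also have "\<dots> = (\<Sum>i\<in>UNIV. v $ i * pd (axis i 1) f x)"
    by (simp only: linear_sum[OF linear_pd[OF assms]] linear_cmul[OF linear_pd[OF assms]]
        real_scaleR_def)
  finally show ?thesis .
qed

lemma has_real_derivative_line:
  assumes "real_polynomial_function f"
  shows "((\<lambda>t. f (x + t *\<^sub>R v)) has_real_derivative pd v f (x + t *\<^sub>R v)) (at t)"
proof -
  have "((\<lambda>t. x + t *\<^sub>R v) has_derivative (\<lambda>t. t *\<^sub>R v)) (at t)"
    by (auto intro!: derivative_eq_intros)
  from has_derivative_compose[OF this has_derivative_pd[OF assms]]
  have "((\<lambda>t. f (x + t *\<^sub>R v)) has_derivative (\<lambda>s. pd (s *\<^sub>R v) f (x + t *\<^sub>R v))) (at t)" .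
  then show ?thesis
    unfolding has_field_derivative_def
    by (rule has_derivative_eq_rhs) (simp add: linear_cmul[OF linear_pd[OF assms]] fun_eq_iff
        mult.commute)
qed

lemma partial_deriv_eq_pd:
  assumes "real_polynomial_function f"
  shows "partial_deriv i f x = pd (axis i 1) f x"
  unfolding partial_deriv_def
  using has_real_derivative_line[OF assms, where t = 0] by (auto intro: DERIV_imp_deriv)

lemma normal_deriv_eq_pd:
  assumes "real_polynomial_function f"
  shows "normal_deriv f x = pd x f x"
  unfolding normal_deriv_def partial_deriv_eq_pd[OF assms]
  by (rule pd_components[OF assms, symmetric])

definition laplacian :: "(real ^ 'n \<Rightarrow> real) \<Rightarrow> real ^ 'n \<Rightarrow> real" where
  "laplacian f x = (\<Sum>i\<in>UNIV. pd (axis i 1) (pd (axis i 1) f) x)"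

lemma laplacian_cmult:
  "real_polynomial_function f \<Longrightarrow> laplacian (\<lambda>x. c * f x) x = c * laplacian f x"
  by (simp add: laplacian_def pd_cmult real_polynomial_function_pd sum_distrib_left)

lemma laplacian_sum:
  assumes "finite A" "\<And>i. i \<in> A \<Longrightarrow> real_polynomial_function (f i)"
  shows "laplacian (\<lambda>x. \<Sum>i\<in>A. f i x) x = (\<Sum>i\<in>A. laplacian (f i) x)"
  unfolding laplacian_def
  by (subst sum.swap) (simp add: pd_sum assms real_polynomial_function_pd)

lemma laplacian_mult:
  assumes "real_polynomial_function f" "real_polynomial_function g"
  shows "laplacian (\<lambda>x. f x * g x) x = f x * laplacian g x + laplacian f x * g x +
    2 * (\<Sum>i\<in>UNIV. pd (axis i 1) f x * pd (axis i 1) g x)"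
proof -
  have *: "pd v (pd v (\<lambda>x. f x * g x)) x = f x * pd v (pd v g) x + pd v (pd v f) x * g x + 2 *
      (pd v f x * pd v g x)" for v
    using assms by (simp add: pd_mult pd_add real_polynomial_function_pd
        real_polynomial_function.intros(4))
  show ?thesis unfolding laplacian_def *
      by (simp add: sum.distrib sum_distrib_left sum_distrib_right)
qed

text \<open>Homogeneity of degree \<open>k\<close> is expressed through Euler's identity.\<close>

definition solid_harmonic :: "nat \<Rightarrow> (real ^ 'n \<Rightarrow> real) \<Rightarrow> bool" where
  "solid_harmonic k f \<longleftrightarrow> real_polynomial_function f \<and> (\<forall>x. laplacian f x = 0) \<and>
    (\<forall>x. pd x f x = real k * f x)"

text \<open>Directional derivatives commute with the Laplacian, and differentiating Euler's identity
  in direction \<open>v\<close> produces one extra copy of \<open>pd v f\<close>, which lowers the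
  degree by one.\<close>

lemma solid_harmonic_pd:
  assumes "solid_harmonic (Suc k) f"
  shows "solid_harmonic k (pd v f)"
proof -
  have f: "real_polynomial_function f" and L: "\<And>x. laplacian f x = 0"
    and E: "\<And>x. pd x f x = real (Suc k) * f x"
    using assms by (auto simp: solid_harmonic_def)
  note pf = real_polynomial_function_pd
  have "laplacian (pd v f) x = 0" for x
  proof -
    have "laplacian (pd v f) x = (\<Sum>i\<in>UNIV. pd v (pd (axis i 1) (pd (axis i 1) f)) x)"
      unfolding laplacian_def
          by (simp add: pd_commute[OF f, of _ v] pd_commute[OF pf[OF f], of _ v])
    also have "\<dots> = pd v (laplacian f) x"
      unfolding laplacian_def by (subst pd_sum) (auto intro: pf f)
    also have "laplacian f = (\<lambda>x. 0)" using L by auto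
    finally show ?thesis by simp
  qed
  moreover have "pd x (pd v f) x = real k * pd v f x" for x
  proof -
    \<comment> \<open>In \<open>pd x f x\<close> the point is also the direction. Written in
      coordinates, the dependence through the direction becomes the factor \<open>x $ i\<close>, to
      which the product rule applies.\<close>
    have "(\<lambda>x. \<Sum>i\<in>UNIV. x $ i * pd (axis i 1) f x) = (\<lambda>x. real (Suc k) * f x)"
      by (rule ext) (metis E pd_components[OF f])
    then have "pd v (\<lambda>x. \<Sum>i\<in>UNIV. x $ i * pd (axis i 1) f x) x = pd v (\<lambda>x. real (Suc k) * f x) x"
      by simp
    moreover have "pd v (\<lambda>x. \<Sum>i\<in>UNIV. x $ i * pd (axis i 1) f x) x = pd x (pd v f) x + pd v f x"
    proof -
      have c: "real_polynomial_function (\<lambda>x :: real ^ 'n. x $ i)" for i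
        by (intro real_polynomial_function.intros(1) bounded_linear_vec_nth)
      have "pd v (\<lambda>x. \<Sum>i\<in>UNIV. x $ i * pd (axis i 1) f x) x =
          (\<Sum>i\<in>UNIV. x $ i * pd v (pd (axis i 1) f) x + v $ i * pd (axis i 1) f x)"
        by (subst pd_sum) (auto simp: pd_mult c pf f pd_bounded_linear bounded_linear_vec_nth
            intro!: real_polynomial_function.intros(4))
      also have "\<dots> = pd x (pd v f) x + pd v f x"
        by (simp add: sum.distrib pd_components[OF pf[OF f], of x] pd_components[OF f, of v]
            pd_commute[OF f, of v])
      finally show ?thesis .
    qed
    moreover have "pd v (\<lambda>x. real (Suc k) * f x) x = real (Suc k) * pd v f x"
      by (simp only: pd_cmult[OF f])
    ultimately show ?thesis by (simp add: algebra_simps)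
  qed
  ultimately show ?thesis unfolding solid_harmonic_def using pf[OF f] by simp
qed

section \<open>Polar coordinates\<close>

lemma emeasure_lborel_homothety:
  fixes A :: "'a::euclidean_space set"
  assumes "A \<in> sets borel" "c > 0"
  shows "emeasure lborel {y. y /\<^sub>R c \<in> A} = ennreal (c ^ DIM('a)) * emeasure lborel A"
proof -
  have [measurable]: "A \<in> sets borel" by fact
  have m: "{y. y /\<^sub>R c \<in> A} \<in> sets borel" by measurable
  have "emeasure lborel {y. y /\<^sub>R c \<in> A} =
    emeasure (density (distr lborel borel (\<lambda>x :: 'a. 0 + c *\<^sub>R x)) (\<lambda>_. \<bar>c\<bar> ^ DIM('a)))
        {y. y /\<^sub>R c \<in> A}"
    using lborel_affine[of c "0 :: 'a"] assms(2) by simp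
  also have "\<dots> = ennreal (c ^ DIM('a)) * emeasure lborel A"
    using assms m
    by (simp add: emeasure_density_const emeasure_distr vimage_def)
  finally show ?thesis .
qed

lemma emeasure_sphere_measure:
  fixes B :: "'a::euclidean_space set"
  assumes "B \<in> sets borel"
  shows "emeasure sphere_measure B =
    ennreal (real DIM('a)) * emeasure lborel {y :: 'a. norm y < 1 \<and> y /\<^sub>R norm y \<in> B}"
proof -
  have [measurable]: "B \<in> sets borel" by fact
  have "(\<lambda>y::'a. y /\<^sub>R norm y) \<in> borel_measurable borel" by measurable
  from measurable_sets_borel[OF this assms]
  have *: "(\<lambda>y::'a. y /\<^sub>R norm y) -` B \<in> sets borel" .
  have "emeasure sphere_measure B =
    (\<integral>\<^sup>+x. ennreal (real DIM('a)) * indicator (ball 0 1) x * indicator ((\<lambda>y::'a. y /\<^sub>R norm y) -` B)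
      x \<partial>lborel)"
    unfolding sphere_measure_def
    by (subst emeasure_distr, measurable, subst emeasure_density)
      (auto intro!: borel_measurable_times_ennreal borel_measurable_indicator *)
  also have "\<dots> = (\<integral>\<^sup>+x. ennreal (real DIM('a)) * indicator {y :: 'a. norm y < 1 \<and> y /\<^sub>R norm y \<in> B}
      x \<partial>lborel)"
    by (intro nn_integral_cong) (auto simp: indicator_def)
  also have "\<dots> = ennreal (real DIM('a)) * emeasure lborel {y :: 'a. norm y < 1 \<and> y /\<^sub>R norm y \<in> B}"
    by (intro nn_integral_cmult_indicator) measurable
  finally show ?thesis .
qed

lemma sets_sphere_measure [simp, measurable_cong]: "sets sphere_measure = sets borel"
  by (simp add: sphere_measure_def)

lemma space_sphere_measure [simp]: "space sphere_measure = UNIV"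
  by (simp add: sphere_measure_def)

lemma finite_measure_sphere_measure: "finite_measure (sphere_measure :: 'a::euclidean_space
    measure)"
proof
  have "emeasure lborel {y :: 'a. norm y < 1} \<le> emeasure lborel (cball (0::'a) 1)"
    by (intro emeasure_mono) auto
  also have "\<dots> < \<infinity>" by (simp add: emeasure_cball)
  finally show "emeasure sphere_measure (space (sphere_measure :: 'a measure)) \<noteq> \<infinity>"
    by (simp add: emeasure_sphere_measure ennreal_mult_eq_top_iff)
qed

text \<open>Radial projection sends every nonzero point to the unit sphere, and the origin is a null
  set. This lets identities that hold only on the sphere be used under integrals over the ambient
  space.\<close>

lemma AE_sphere_measure: "AE x in (sphere_measure :: 'a::euclidean_space measure). x \<in> sphere 0 1"
proof -
  have "AE x :: 'a in lborel. x \<noteq> 0" by (rule AE_lborel_singleton)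
  then have "AE x :: 'a in lborel. x /\<^sub>R norm x \<in> sphere 0 1"
    by eventually_elim auto
  then have "AE x in density lborel (\<lambda>x :: 'a. ennreal (real DIM('a)) * indicator (ball 0 1) x).
      x /\<^sub>R norm x \<in> sphere 0 1"
    by (subst AE_density) (auto intro!: borel_measurable_times_ennreal borel_measurable_indicator)
  then show ?thesis
    unfolding sphere_measure_def by (subst AE_distr_iff) (measurable, auto)
qed

text \<open>The measure r^(N-1) dr transported by s = -r^2: from |ds| = 2 r dr one gets half of
  (-s)^(N/2-1) ds.\<close>

definition radial_measure :: "nat \<Rightarrow> real measure" where
  "radial_measure N = density lborel (\<lambda>s. ennreal ((- s) powr (real N / 2 - 1) / 2 *
      indicator {..0} s))"

lemma emeasure_radial_measure:
  assumes "N > 0" "x \<le> 0"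
  shows "emeasure (radial_measure N) {x<..} = ennreal ((- x) powr (real N / 2) / real N)"
proof -
  have "emeasure (radial_measure N) {x<..} =
    (\<integral>\<^sup>+s. ennreal ((- s) powr (real N / 2 - 1) / 2 * indicator {..0} s) *
      indicator {x<..} s \<partial>lborel)"
    unfolding radial_measure_def by (subst emeasure_density) auto
  also have "\<dots> = ennreal \<bar>-1\<bar> * (\<integral>\<^sup>+s. ennreal ((- (0 + (-1) * s)) powr (real N / 2 - 1) / 2 *
      indicator {..0} (0 + (-1) * s))
      * indicator {x<..} (0 + (-1) * s) \<partial>lborel)"
    by (rule nn_integral_real_affine) auto
  also have "\<dots> = (\<integral>\<^sup>+s. ennreal (s powr (real N / 2 - 1) / 2 * indicator {0..-x} s) \<partial>lborel)"
  proof -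
    \<comment> \<open>The reflected half line is open at \<open>- x\<close> while the integral is
      taken over a closed interval; the end point is a null set.\<close>
    have "AE s in lborel. s \<noteq> - x" by (rule AE_lborel_singleton)
    then show ?thesis
      by (auto intro!: nn_integral_cong_AE simp: indicator_def elim!: AE_mp)
  qed
  also have "\<dots> = ennreal ((- x) powr (real N / 2) / real N)"
  proof -
    have "((\<lambda>s. s powr (real N / 2 - 1)) has_integral ((- x) powr (real N / 2 - 1 +
        1) / (real N / 2 - 1 + 1))) {0..-x}"
      by (rule has_integral_powr_from_0) (use assms in auto)
    then have "((\<lambda>s. s powr (real N / 2 - 1) / 2) has_integral ((- x) powr (real N / 2) / real N))
        {0..-x}"
      by (drule_tac has_integral_divide[where c = 2]) simp
    from nn_integral_has_integral_lebesgue[OF _ this] show ?thesis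
      by (simp add: mult_ac)
  qed
  finally show ?thesis .
qed

lemma sigma_finite_radial_measure: "sigma_finite_measure (radial_measure N)"
  unfolding radial_measure_def
  by (subst sigma_finite_measure.sigma_finite_iff_density_finite)
      (auto intro: lborel.sigma_finite_measure_axioms)

lemma sets_radial_measure [simp, measurable_cong]: "sets (radial_measure N) = sets borel"
  by (simp add: radial_measure_def)

text \<open>The squared radius enters with a minus sign because the uniqueness theorem for measures on the
  line that is available requires the upper half lines to have finite measure.\<close>

theorem polar_coordinates:
  "distr lborel (borel \<Otimes>\<^sub>M borel) (\<lambda>y :: 'a::euclidean_space. (- (norm y)\<^sup>2, y /\<^sub>R norm y)) =
    radial_measure DIM('a) \<Otimes>\<^sub>M sphere_measure"
proof (rule pair_measure_eqI[symmetric])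
  show "sigma_finite_measure (sphere_measure :: 'a measure)"
    using finite_measure_sphere_measure finite_measure.axioms(1) by blast
  fix A :: "real set" and B :: "'a set"
  assume "A \<in> sets (radial_measure DIM('a))" "B \<in> sets sphere_measure"
  then have [measurable]: "A \<in> sets borel" "B \<in> sets borel" by auto
  define N where "N = DIM('a)"
  have N: "N > 0" unfolding N_def by simp
  define C where "C = {y :: 'a. y /\<^sub>R norm y \<in> B}"
  have [measurable]: "C \<in> sets borel" unfolding C_def by measurable
  \<comment> \<open>With the angular set \<open>B\<close> fixed, both sides become measures in the
    radial variable alone, so it suffices to compare them on half lines.\<close>
  define M1 where "M1 = distr (density lborel (indicator C)) borel (\<lambda>y :: 'a. - (norm y)\<^sup>2)"
  define M2 where "M2 = density (radial_measure N) (\<lambda>_. emeasure sphere_measure B)"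
  have fin: "emeasure sphere_measure B \<noteq> \<infinity>"
    by (simp add: finite_measure.emeasure_finite[OF finite_measure_sphere_measure])
  have M1: "emeasure M1 X = emeasure lborel {y. - (norm y)\<^sup>2 \<in> X \<and> y \<in> C}"
      if [measurable]: "X \<in> sets borel" for X
  proof -
    have "(\<lambda>y :: 'a. - (norm y)\<^sup>2) \<in> borel_measurable borel" by measurable
    from measurable_sets_borel[OF this that]
    have *: "(\<lambda>y :: 'a. - (norm y)\<^sup>2) -` X \<in> sets borel" .
    have "emeasure M1 X = (\<integral>\<^sup>+y. indicator C y * indicator ((\<lambda>y :: 'a. - (norm y)\<^sup>2) -` X) y
        \<partial>lborel)"
      unfolding M1_def
      by (subst emeasure_distr, measurable, subst emeasure_density) (auto intro: *)
    also have "\<dots> = (\<integral>\<^sup>+y. indicator {y. - (norm y)\<^sup>2 \<in> X \<and> y \<in> C} y \<partial>lborel)"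
      by (intro nn_integral_cong) (auto simp: indicator_def)
    also have "\<dots> = emeasure lborel {y. - (norm y)\<^sup>2 \<in> X \<and> y \<in> C}"
      by (intro nn_integral_indicator) measurable
    finally show ?thesis .
  qed
  have M2: "emeasure M2 X = emeasure sphere_measure B * emeasure (radial_measure N) X"
      if "X \<in> sets borel" for X
    unfolding M2_def using that by (simp add: emeasure_density_const)
  have pos: "emeasure M1 {x<..} = emeasure M2 {x<..} \<and> emeasure M1 {x<..} < \<infinity>" for x
  proof (cases "x < 0")
    case True
    define c where "c = sqrt (- x)"
    have c: "c > 0" "c\<^sup>2 = - x" using True by (auto simp: c_def)
    \<comment> \<open>The half line above \<open>x\<close> describes the ball of radius
      \<open>c\<close>, so this set is the unit cone over \<open>B\<close> dilated by
      \<open>c\<close>, and its volume scales by \<open>c ^ N\<close>.\<close>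
    have e1: "{y. - (norm y)\<^sup>2 \<in> {x<..} \<and> y \<in> C} =
        {y. y /\<^sub>R c \<in> {y. norm y < 1 \<and> y /\<^sub>R norm y \<in> B}}"
    proof -
      have "- (norm y)\<^sup>2 \<in> {x<..} \<longleftrightarrow> norm y < c" for y :: 'a
      proof -
        have "norm y < c \<Longrightarrow> (norm y)\<^sup>2 < c\<^sup>2" by (intro power_strict_mono) auto
        moreover have "(norm y)\<^sup>2 < c\<^sup>2 \<Longrightarrow> norm y < c"
          using c(1) by (auto dest: power2_less_imp_less)
        ultimately show ?thesis using c(2) by auto
      qed
      moreover have "norm (y /\<^sub>R c) < 1 \<longleftrightarrow> norm y < c" for y :: 'a
        using c(1) by (simp add: field_simps)
      moreover have "(y /\<^sub>R c) /\<^sub>R norm (y /\<^sub>R c) = y /\<^sub>R norm y" for y :: 'a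
        using c(1) by simp
      ultimately show ?thesis unfolding C_def by (simp only: mem_Collect_eq)
    qed
    have e2: "emeasure lborel {y. y /\<^sub>R c \<in> {y :: 'a. norm y < 1 \<and> y /\<^sub>R norm y \<in> B}} =
        ennreal (c ^ N) * emeasure lborel {y :: 'a. norm y < 1 \<and> y /\<^sub>R norm y \<in> B}"
      unfolding N_def by (rule emeasure_lborel_homothety) (measurable, rule c(1))
    have "emeasure M1 {x<..} =
        ennreal (c ^ N) * emeasure lborel {y :: 'a. norm y < 1 \<and> y /\<^sub>R norm y \<in> B}"
      using M1[OF greaterThan_borel, of x] unfolding e1 e2 .
    moreover have "emeasure M2 {x<..} =
        ennreal (c ^ N) * emeasure lborel {y. norm y < 1 \<and> y /\<^sub>R norm y \<in> B}"
    proof -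
      have "(- x) powr (real N / 2) = c ^ N"
        using powr_powr[of c 2 "real N / 2"] powr_realpow[OF c(1), of N] c
        by (simp add: powr_numeral)
      then have "emeasure M2 {x<..} = ennreal (real N) * ennreal (c ^ N / real N)
          * emeasure lborel {y. norm y < 1 \<and> y /\<^sub>R norm y \<in> B}"
        using True N M2[OF greaterThan_borel, of x]
        by (simp add: emeasure_sphere_measure emeasure_radial_measure N_def mult_ac)
      also have "ennreal (real N) * ennreal (c ^ N / real N) = ennreal (c ^ N)"
        using N c by (simp flip: ennreal_mult)
      finally show ?thesis .
    qed
    moreover have "emeasure M2 {x<..} < \<infinity>"
    proof -
      have "emeasure (radial_measure N) {x<..} < \<infinity>"
        using True N by (simp add: emeasure_radial_measure)
      moreover have "emeasure sphere_measure B < \<infinity>"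
        using fin by (simp only: less_top infinity_ennreal_def)
      ultimately show ?thesis
        unfolding M2[OF greaterThan_borel, of x] infinity_ennreal_def
            by (rule ennreal_mult_less_top[THEN iffD2, OF disjI2, OF disjI2, OF conjI, rotated])
    qed
    ultimately show ?thesis by (simp only: simp_thms)
  next
    case False
    have "{y. - (norm y)\<^sup>2 \<in> {x<..} \<and> y \<in> C} = {}"
      using False by auto (smt (verit) zero_le_power2)
    then have "emeasure M1 {x<..} = 0"
      using M1[OF greaterThan_borel, of x] by (simp only: emeasure_empty)
    moreover have "emeasure (radial_measure N) {x<..} \<le> emeasure (radial_measure N) {0<..}"
      using False by (intro emeasure_mono) auto
    then have "emeasure M2 {x<..} = 0" using N M2[OF greaterThan_borel, of x]
        by (simp add: emeasure_radial_measure)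
    ultimately show ?thesis by simp
  qed
  have "sets M1 = sets borel" "sets M2 = sets borel" by (simp_all add: M1_def M2_def)
  then have "M1 = M2"
    by (rule measure_eqI_lessThan) (rule pos[THEN conjunct1] pos[THEN conjunct2])+
  then have "emeasure M1 A = emeasure M2 A" by simp
  then have "emeasure lborel {y. - (norm y)\<^sup>2 \<in> A \<and> y \<in> C} = emeasure sphere_measure B *
      emeasure (radial_measure N) A"
    by (simp add: M1 M2)
  moreover have "emeasure (distr lborel (borel \<Otimes>\<^sub>M borel) (\<lambda>y :: 'a. (- (norm y)\<^sup>2, y /\<^sub>R norm y)))
      (A \<times> B)
      = emeasure lborel {y. - (norm y)\<^sup>2 \<in> A \<and> y \<in> C}"
    by (subst emeasure_distr) (auto simp: C_def vimage_def)
  ultimately show "emeasure (radial_measure DIM('a)) A * emeasure sphere_measure B =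
     emeasure (distr lborel (borel \<Otimes>\<^sub>M borel) (\<lambda>y :: 'a. (- (norm y)\<^sup>2, y /\<^sub>R norm y))) (A \<times> B)"
    by (simp add: N_def mult.commute)
qed (auto intro: sigma_finite_radial_measure)

text \<open>In polar coordinates the integrand is a product on a product measure, so Fubini
  separates it. It is applied with \<open>\<phi>\<close> a Gaussian or the ball weight times a
  polynomial, in each case multiplied by the power of the radius coming from a homogeneous
  \<open>H\<close>.\<close>

lemma polar_integral:
  fixes H :: "'a::euclidean_space \<Rightarrow> real"
  assumes \<phi>: "integrable lborel (\<lambda>s. indicator {0..} s * (\<phi> s * s powr (real DIM('a) / 2 - 1)))"
    and meas [measurable]: "\<phi> \<in> borel_measurable borel"
    and H: "integrable sphere_measure H"
  shows "integrable lborel (\<lambda>y. \<phi> ((norm y)\<^sup>2) * H (y /\<^sub>R norm y))"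
    and "(LINT y|lborel. \<phi> ((norm y)\<^sup>2) * H (y /\<^sub>R norm y)) =
      (LINT s|lborel. indicator {0..} s * (\<phi> s * s powr (real DIM('a) / 2 - 1))) / 2 *
      (LINT \<omega>|sphere_measure. H \<omega>)"
proof -
  interpret R: sigma_finite_measure "radial_measure DIM('a)" by (rule sigma_finite_radial_measure)
  interpret S: finite_measure "sphere_measure :: 'a measure" by (rule finite_measure_sphere_measure)
  interpret P: pair_sigma_finite "radial_measure DIM('a)" "sphere_measure :: 'a measure" ..
  have [measurable]: "H \<in> borel_measurable borel"
    using borel_measurable_integrable[OF H] by (simp cong: measurable_cong_sets)
  have "(\<lambda>s. indicator {0..} s * (\<phi> s * s powr (real DIM('a) / 2 - 1))) = 
      (\<lambda>s. 2 * (((s powr (real DIM('a) / 2 - 1) / 2 * indicator {0..} s)) * \<phi> s))"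
    by (auto simp: fun_eq_iff)
  then have a: "integrable lborel (\<lambda>s. (s powr (real DIM('a) / 2 - 1) / 2 * indicator {0..} s) *
      \<phi> s)"
    and b: "(LINT s|lborel. indicator {0..} s * (\<phi> s * s powr (real DIM('a) / 2 - 1))) / 2 =
      (LINT s|lborel. (s powr (real DIM('a) / 2 - 1) / 2 * indicator {0..} s) * \<phi> s)"
    using \<phi> by simp_all
  \<comment> \<open>\<open>radial_measure\<close> lives on the negative half line; the reflection to
    positive \<open>s\<close> is written as the affine map \<open>0 + (-1) * s\<close> to fit the
    substitution rule.\<close>
  define w where "w = (\<lambda>s :: real. (- s) powr (real DIM('a) / 2 - 1) / 2 * indicator {..0} s)"
  have w: "w (0 + (-1) * s) = s powr (real DIM('a) / 2 - 1) / 2 * indicator {0..} s" for s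
    by (auto simp: w_def indicator_def)
  have w2: "w (- s) = s powr (real DIM('a) / 2 - 1) / 2 * indicator {0..} s" for s
    using w[of s] by simp
  have wm [measurable]: "w \<in> borel_measurable borel" unfolding w_def by measurable
  have r: "radial_measure DIM('a) = density lborel (\<lambda>s. ennreal (w s))"
    unfolding radial_measure_def w_def ..
  have "integrable lborel (\<lambda>s. w (0 + (-1) * s) * \<phi> (- (0 + (-1) * s)))"
    unfolding w using a by simp
  then have "integrable lborel (\<lambda>s. w s * \<phi> (- s))"
    by (subst (asm) lborel_integrable_real_affine_iff) auto
  then have \<phi>i: "integrable (radial_measure DIM('a)) (\<lambda>s. \<phi> (- s))"
    unfolding r by (subst integrable_density) (auto simp: w_def)
  have "(LINT s|radial_measure DIM('a). \<phi> (- s)) = (LINT s|lborel. w s * \<phi> (- s))"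
    unfolding r by (subst integral_density) (auto simp: w_def)
  also have "\<dots> = (LINT s|lborel. w (0 + (-1) * s) * \<phi> (- (0 + (-1) * s)))"
    by (subst lborel_integral_real_affine[where c = "-1" and t = 0]) auto
  finally have \<phi>e: "(LINT s|radial_measure DIM('a). \<phi> (- s)) =
      (LINT s|lborel. indicator {0..} s * (\<phi> s * s powr (real DIM('a) / 2 - 1))) / 2"
    unfolding b w by simp
  have F: "integrable (radial_measure DIM('a) \<Otimes>\<^sub>M sphere_measure) (\<lambda>(s, \<omega>). \<phi> (- s) * H \<omega>)"
    by (rule P.Fubini_integrable) (use \<phi>i H in \<open>auto simp: abs_mult\<close>)
  then have F': "integrable (distr lborel (borel \<Otimes>\<^sub>M borel)
      (\<lambda>y :: 'a. (- (norm y)\<^sup>2, y /\<^sub>R norm y)))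
      (\<lambda>(s, \<omega>). \<phi> (- s) * H \<omega>)"
    by (simp add: polar_coordinates)
  from integrable_distr[OF _ this]
  show "integrable lborel (\<lambda>y. \<phi> ((norm y)\<^sup>2) * H (y /\<^sub>R norm y))" by simp
  have "(LINT y|lborel. \<phi> ((norm y)\<^sup>2) * H (y /\<^sub>R norm y)) =
      (LINT p|distr lborel (borel \<Otimes>\<^sub>M borel) (\<lambda>y :: 'a. (- (norm y)\<^sup>2, y /\<^sub>R norm y)).
        (case p of (s, \<omega>) \<Rightarrow> \<phi> (- s) * H \<omega>))"
    by (subst integral_distr) auto
  also have "\<dots> = (LINT s|radial_measure DIM('a). LINT \<omega>|sphere_measure. \<phi> (- s) * H \<omega>)"
    unfolding polar_coordinates using P.integral_fst'[OF F] by simp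
  also have "\<dots> = (LINT s|radial_measure DIM('a). \<phi> (- s)) * (LINT \<omega>|sphere_measure. H \<omega>)"
    by simp
  finally show "(LINT y|lborel. \<phi> ((norm y)\<^sup>2) * H (y /\<^sub>R norm y)) =
      (LINT s|lborel. indicator {0..} s * (\<phi> s * s powr (real DIM('a) / 2 - 1))) / 2 *
      (LINT \<omega>|sphere_measure. H \<omega>)"
    by (simp add: \<phi>e)
qed

lemma integrable_sphere_measure_continuous:
  fixes H :: "'a::euclidean_space \<Rightarrow> real"
  assumes "continuous_on UNIV H"
  shows "integrable sphere_measure H"
proof -
  have [measurable]: "H \<in> borel_measurable borel" using assms
      by (rule borel_measurable_continuous_onI)
  have "compact (H ` sphere 0 1)"
    by (intro compact_continuous_image continuous_on_subset[OF assms]) auto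
  then obtain K where K: "\<And>x. x \<in> sphere 0 1 \<Longrightarrow> norm (H x) \<le> K"
    by (meson bounded_iff compact_imp_bounded imageI)
  interpret finite_measure "sphere_measure :: 'a measure" by (rule finite_measure_sphere_measure)
  have "AE x in (sphere_measure :: 'a measure). norm (H x) \<le> K"
    using AE_sphere_measure K by (auto elim: AE_mp)
  then show ?thesis by (intro integrable_const_bound) auto
qed

section \<open>Gaussian integrals of solid harmonics\<close>

text \<open>Lebesgue measure is the image of a product measure indexed by \<open>Basis\<close>.
  Since \<open>axis\<close> enumerates \<open>Basis\<close> injectively, its inverse relabels the
  factors by coordinates.\<close>

lemma lborel_vec_prod:
  fixes f :: "'n::finite \<Rightarrow> real \<Rightarrow> real"
  assumes "\<And>i. integrable lborel (f i)"
  shows "integrable lborel (\<lambda>x :: real ^ 'n. \<Prod>i\<in>UNIV. f i (x $ i))"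
    and "(LINT x|lborel. (\<Prod>i\<in>UNIV. f i ((x :: real ^ 'n) $ i))) = (\<Prod>i\<in>UNIV. LINT t|lborel. f i t)"
proof -
  define g where "g = (\<lambda>b :: real ^ 'n. f (inv (\<lambda>i. axis i 1) b))"
  have inj: "inj (\<lambda>i :: 'n. axis i (1 :: real))" by (auto simp: inj_on_def axis_eq_axis)
  have g: "g (axis i 1) = f i" for i unfolding g_def by (simp add: inv_f_f[OF inj])
  have B: "(Basis :: (real ^ 'n) set) = range (\<lambda>i. axis i 1)" by (auto simp: Basis_vec_def)
  have P: "(\<Prod>b\<in>Basis. h b) = (\<Prod>i\<in>UNIV. h (axis i 1))" for h :: "real ^ 'n \<Rightarrow> real"
    unfolding B by (subst prod.reindex[OF inj]) simp
  interpret product_sigma_finite "\<lambda>_ :: real ^ 'n. lborel :: real measure" ..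
  have gi: "integrable lborel (g b)" if "b \<in> Basis" for b unfolding g_def using assms by simp
  have [measurable]: "f i \<in> borel_measurable borel" for i
    using borel_measurable_integrable[OF assms[of i]] by simp
  have m: "(\<lambda>x :: real ^ 'n. \<Prod>i\<in>UNIV. f i (x $ i)) \<in> borel_measurable borel"
    by (rule borel_measurable_prod) measurable
  have T: "(\<lambda>F. \<Sum>b\<in>Basis. F b *\<^sub>R b) \<in> measurable (\<Pi>\<^sub>M b\<in>Basis. lborel) (borel :: (real ^ 'n)
      measure)"
    by measurable
  have eq: "(\<Prod>i\<in>UNIV. f i ((\<Sum>b\<in>Basis. F b *\<^sub>R b) $ i)) = (\<Prod>b\<in>Basis. g b (F b))"
      for F :: "real ^ 'n \<Rightarrow> real"
  proof -
    have "(\<Sum>b\<in>Basis. F b *\<^sub>R b) $ i = F (axis i 1)" for i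
      using inner_sum_left_Basis[of "axis i 1 :: real ^ 'n" F] by (simp add: inner_axis B)
    then show ?thesis by (simp add: P g)
  qed
  show "integrable lborel (\<lambda>x :: real ^ 'n. \<Prod>i\<in>UNIV. f i (x $ i))"
    by (subst lborel_eq, subst integrable_distr_eq[OF T m], unfold eq)
      (rule product_integrable_prod[OF finite_Basis gi])
  have "(LINT x|lborel. (\<Prod>i\<in>UNIV. f i ((x :: real ^ 'n) $ i))) =
      (LINT F|(\<Pi>\<^sub>M b\<in>Basis. lborel). (\<Prod>b\<in>Basis. g b (F b)))"
    by (subst lborel_eq, subst integral_distr[OF T m], unfold eq) (rule refl)
  also have "\<dots> = (\<Prod>b\<in>Basis. LINT t|lborel. g b t)"
    by (rule product_integral_prod[OF finite_Basis gi])
  finally show "(LINT x|lborel. (\<Prod>i\<in>UNIV. f i ((x :: real ^ 'n) $ i))) =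
      (\<Prod>i\<in>UNIV. LINT t|lborel. f i t)"
    by (simp add: P g)
qed

text \<open>The product form makes the moments of monomials factor over coordinates; the radial form
  needed in polar coordinates is \<open>gaussian_eq\<close>.\<close>

definition gaussian :: "real ^ 'n \<Rightarrow> real" where
  "gaussian x = (\<Prod>i\<in>UNIV. std_normal_density (x $ i))"

definition gauss_expect :: "(real ^ 'n \<Rightarrow> real) \<Rightarrow> real" where
  "gauss_expect f = (LINT x|lborel. f x * gaussian x)"

definition normal_moment :: "nat \<Rightarrow> real" where
  "normal_moment k = (LINT t|lborel. std_normal_density t * t ^ k)"

text \<open>This is one-dimensional integration by parts against the normal density, read off from
  the closed forms of the moments by parity. At \<open>k = 0\<close> the factor
  \<open>real k\<close> hides the truncated difference \<open>k - 1\<close>.\<close>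

lemma normal_moment_Suc: "normal_moment (Suc k) = real k * normal_moment (k - 1)"
proof (cases "even k")
  case True
  then obtain j where k: "k = 2 * j" by blast
  have "normal_moment (Suc k) = 0"
    using integral_std_normal_moment_odd[of j] by (simp add: normal_moment_def k)
  moreover have "real k * normal_moment (k - 1) = 0"
  proof (cases j)
    case (Suc i)
    then show ?thesis using integral_std_normal_moment_odd[of i] by (simp add: normal_moment_def k)
  qed (simp add: k)
  ultimately show ?thesis by simp
next
  case False
  then obtain j where k: "k = 2 * j + 1" by (elim oddE)
  have "normal_moment (Suc k) = fact (2 * Suc j) / (2 ^ Suc j * fact (Suc j))"
    using integral_std_normal_moment_even[of "Suc j"] by (simp add: normal_moment_def k)
  also have "\<dots> = ((2 * (real j + 1)) * ((2 * real j + 1) * fact (2 * j))) / ((2 * (real j + 1)) *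
      (2 ^ j * fact j))"
    by (simp add: algebra_simps)
  also have "\<dots> = (2 * real j + 1) * (fact (2 * j) / (2 ^ j * fact j))"
    by (subst mult_divide_mult_cancel_left) simp_all
  finally have "normal_moment (Suc k) = (2 * real j + 1) * (fact (2 * j) / (2 ^ j * fact j))" .
  moreover have "normal_moment (k - 1) = fact (2 * j) / (2 ^ j * fact j)"
    using integral_std_normal_moment_even[of j] by (simp add: normal_moment_def k)
  ultimately show ?thesis by (simp add: k)
qed

lemma monomial_gaussian:
  "monomial a x * gaussian x = (\<Prod>i\<in>UNIV. std_normal_density (x $ i) * (x $ i) ^ a i)"
  by (simp add: monomial_def gaussian_def prod.distrib mult.commute)

lemma integrable_monomial_gaussian: "integrable lborel (\<lambda>x. monomial a x * gaussian x)"
  unfolding monomial_gaussian by (rule lborel_vec_prod) (rule integrable_std_normal_moment)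

lemma gauss_expect_monomial: "gauss_expect (monomial a) = (\<Prod>i\<in>UNIV. normal_moment (a i))"
  unfolding gauss_expect_def monomial_gaussian normal_moment_def
  by (rule lborel_vec_prod) (rule integrable_std_normal_moment)

lemma integrable_polys_upto_gaussian:
  assumes "f \<in> polys_upto n"
  shows "integrable lborel (\<lambda>x. f x * gaussian x)"
  using assms
proof (induction rule: polys_upto_induct)
  case (monomial c a)
  then show ?case using integrable_mult_right[OF integrable_monomial_gaussian[of a], of c]
      by (simp add: mult.assoc)
qed (simp_all add: distrib_right)

lemma integrable_poly_gaussian:
  fixes f :: "real ^ 'n \<Rightarrow> real"
  shows "real_polynomial_function f \<Longrightarrow> integrable lborel (\<lambda>x. f x * gaussian x)"
  using real_polynomial_function_imp_polys_upto integrable_polys_upto_gaussian by blast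

lemma gauss_expect_add:
  "\<lbrakk>real_polynomial_function f; real_polynomial_function g\<rbrakk> \<Longrightarrow>
    gauss_expect (\<lambda>x. f x + g x) = gauss_expect f + gauss_expect g"
  by (simp add: gauss_expect_def distrib_right integrable_poly_gaussian)

lemma gauss_expect_cmult: "gauss_expect (\<lambda>x. c * f x) = c * gauss_expect f"
  by (simp add: gauss_expect_def mult.assoc)

lemma gauss_expect_zero [simp]: "gauss_expect (\<lambda>x. 0) = 0"
  by (simp add: gauss_expect_def)

lemma gauss_expect_sum:
  assumes "\<And>i. i \<in> A \<Longrightarrow> real_polynomial_function (f i)"
  shows "gauss_expect (\<lambda>x. \<Sum>i\<in>A. f i x) = (\<Sum>i\<in>A. gauss_expect (f i))"
  unfolding gauss_expect_def sum_distrib_right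
  by (rule Bochner_Integration.integral_sum) (rule integrable_poly_gaussian[OF assms])

lemma gauss_expect_one: "gauss_expect (\<lambda>x :: real ^ 'n. 1) = 1"
proof -
  have "(\<lambda>x :: real ^ 'n. 1 :: real) = monomial (\<lambda>_. 0)" by (auto simp: monomial_def)
  moreover have "normal_moment 0 = 1"
    using integral_std_normal_moment_even[of 0] by (simp add: normal_moment_def)
  ultimately show ?thesis by (simp add: gauss_expect_monomial)
qed

lemma pd_monomial:
  fixes a :: "'n::finite \<Rightarrow> nat"
  shows "pd (axis i 1) (monomial a) = (\<lambda>x. real (a i) * monomial (a(i := a i - 1)) x)"
proof
  fix x :: "real ^ 'n"
  define R where "R = (\<Prod>j\<in>UNIV - {i}. (x $ j) ^ a j)"
  have "monomial a (x + t *\<^sub>R axis i 1) = (x $ i + t) ^ a i * R" for t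
  proof -
    have "(\<Prod>j\<in>UNIV - {i}. ((x + t *\<^sub>R axis i 1) $ j) ^ a j) = R"
      unfolding R_def by (rule prod.cong) (auto simp: axis_def)
    then show ?thesis
      unfolding monomial_def by (subst prod.remove[of UNIV i]) (auto simp: axis_def)
  qed
  moreover have "((\<lambda>t. (x $ i + t) ^ a i * R) has_real_derivative real (a i) * (x $ i) ^ (a i - 1) *
      R) (at 0)"
    by (auto intro!: derivative_eq_intros)
  moreover have "((\<lambda>t. monomial a (x + t *\<^sub>R axis i 1)) has_real_derivative pd (axis i 1)
      (monomial a) x) (at 0)"
    using has_real_derivative_line[OF real_polynomial_function_monomial, of a x "axis i 1" 0]
        by simp
  ultimately have "pd (axis i 1) (monomial a) x = real (a i) * (x $ i) ^ (a i - 1) * R"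
    using DERIV_unique by simp
  moreover have "(x $ i) ^ (a i - 1) * R = monomial (a(i := a i - 1)) x"
  proof -
    have "(\<Prod>j\<in>UNIV - {i}. (x $ j) ^ (a(i := a i - 1)) j) = R"
      unfolding R_def by (rule prod.cong) auto
    then show ?thesis unfolding monomial_def by (subst prod.remove[of UNIV i]) auto
  qed
  ultimately show "pd (axis i 1) (monomial a) x = real (a i) * monomial (a(i := a i - 1)) x"
    by (simp only: mult.assoc)
qed

text \<open>For a monomial both sides factor over the coordinates and differ only in the
  \<open>i\<close>-th moment, where \<open>normal_moment_Suc\<close> applies.\<close>

lemma gauss_expect_component:
  fixes f :: "real ^ 'n \<Rightarrow> real"
  assumes "f \<in> polys_upto n"
  shows "gauss_expect (\<lambda>x. x $ i * f x) = gauss_expect (pd (axis i 1) f)"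
  using assms
proof (induction rule: polys_upto_induct)
  case (add f g)
  note rpf = polys_upto_imp_real_polynomial_function
  have "gauss_expect (\<lambda>x. x $ i * (f x + g x)) = gauss_expect (\<lambda>x. x $ i * f x) +
      gauss_expect (\<lambda>x. x $ i * g x)"
    unfolding distrib_left
    by (intro gauss_expect_add real_polynomial_function.intros(4) real_polynomial_function_component
        rpf[OF add(1)] rpf[OF add(2)])
  moreover have "gauss_expect (pd (axis i 1) (\<lambda>x. f x + g x)) = gauss_expect (pd (axis i 1) f) +
      gauss_expect (pd (axis i 1) g)"
    unfolding pd_add[OF rpf[OF add(1)] rpf[OF add(2)]]
    by (intro gauss_expect_add real_polynomial_function_pd rpf[OF add(1)] rpf[OF add(2)])
  ultimately show ?case using add by simp
next
  case (monomial c a)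
  have "x $ i * monomial a x = monomial (a(i := Suc (a i))) x" for x :: "real ^ 'n"
  proof -
    have "(\<Prod>j\<in>UNIV - {i}. (x $ j) ^ (a(i := Suc (a i))) j) = (\<Prod>j\<in>UNIV - {i}. (x $ j) ^ a j)"
      by (rule prod.cong) auto
    then show ?thesis
      unfolding monomial_def by (subst (1 2) prod.remove[of UNIV i]) (auto simp: mult.assoc)
  qed
  then have l: "gauss_expect (\<lambda>x. x $ i * (c * monomial a x)) =
      c * gauss_expect (monomial (a(i := Suc (a i))))"
    using gauss_expect_cmult[of c "monomial (a(i := Suc (a i)))"] by (simp add: mult_ac)
  have r: "gauss_expect (pd (axis i 1) (\<lambda>x. c * monomial a x)) =
      c * (real (a i) * gauss_expect (monomial (a(i := a i - 1))))"
    unfolding pd_cmult[OF real_polynomial_function_monomial] pd_monomial gauss_expect_cmult ..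
  have *: "(\<Prod>j\<in>UNIV. normal_moment ((a(i := k)) j)) =
      normal_moment k * (\<Prod>j\<in>UNIV - {i}. normal_moment (a j))" for k
  proof -
    have "(\<Prod>j\<in>UNIV - {i}. normal_moment ((a(i := k)) j)) = (\<Prod>j\<in>UNIV - {i}. normal_moment (a j))"
      by (rule prod.cong) auto
    then show ?thesis by (subst prod.remove[of UNIV i]) auto
  qed
  show ?case unfolding l r gauss_expect_monomial * normal_moment_Suc by simp
qed (simp add: gauss_expect_def)

lemma gauss_expect_inner:
  fixes f :: "real ^ 'n \<Rightarrow> real"
  assumes f: "real_polynomial_function f"
  shows "gauss_expect (\<lambda>x. (v \<bullet> x) * f x) = gauss_expect (pd v f)"
proof -
  obtain n where n: "f \<in> polys_upto n" using real_polynomial_function_imp_polys_upto[OF f] by blast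
  have "gauss_expect (\<lambda>x. (v \<bullet> x) * f x) = gauss_expect (\<lambda>x. \<Sum>i\<in>UNIV. v $ i * (x $ i * f x))"
    by (simp add: inner_vec_def sum_distrib_right mult.assoc)
  also have "\<dots> = (\<Sum>i\<in>UNIV. v $ i * gauss_expect (\<lambda>x. x $ i * f x))"
    by (subst gauss_expect_sum)
      (auto simp: gauss_expect_cmult intro!: real_polynomial_function_cmult
        real_polynomial_function.intros(4) real_polynomial_function_component f)
  also have "\<dots> = (\<Sum>i\<in>UNIV. v $ i * gauss_expect (pd (axis i 1) f))"
    by (simp add: gauss_expect_component[OF n])
  also have "\<dots> = gauss_expect (\<lambda>x. \<Sum>i\<in>UNIV. v $ i * pd (axis i 1) f x)"
    by (subst gauss_expect_sum)
      (auto simp: gauss_expect_cmult intro!: real_polynomial_function_cmult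
        real_polynomial_function_pd f)
  also have "(\<lambda>x. \<Sum>i\<in>UNIV. v $ i * pd (axis i 1) f x) = pd v f"
    by (rule ext) (rule pd_components[OF f, symmetric])
  finally show ?thesis .
qed

text \<open>Euler's identity in degree 0 says that the derivative along a ray, multiplied by
  \<open>t\<close>, vanishes. For \<open>t > 0\<close> the factor can be cancelled, so
  \<open>f\<close> is constant along the ray and by continuity equals its value at the
  origin.\<close>

lemma solid_harmonic_0_const:
  assumes "solid_harmonic 0 f"
  shows "f x = f 0"
proof -
  have f: "real_polynomial_function f" and E: "\<And>x. pd x f x = 0"
    using assms by (auto simp: solid_harmonic_def)
  have D: "((\<lambda>t. f (t *\<^sub>R x)) has_real_derivative pd x f (t *\<^sub>R x)) (at t)" for t
    using has_real_derivative_line[OF f, of 0 x t] by simp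
  have "f (1 *\<^sub>R x) = f (0 *\<^sub>R x)"
  proof (rule DERIV_isconst_end[of 0 1 "\<lambda>t. f (t *\<^sub>R x)"])
    show "continuous_on {0..1} (\<lambda>t. f (t *\<^sub>R x))"
      using D by (meson DERIV_continuous continuous_at_imp_continuous_on)
    show "((\<lambda>t. f (t *\<^sub>R x)) has_real_derivative 0) (at t)" if "0 < t" "t < 1" for t
    proof -
      have "t * pd x f (t *\<^sub>R x) = pd (t *\<^sub>R x) f (t *\<^sub>R x)"
        using linear_cmul[OF linear_pd[OF f]] by simp
      then have "pd x f (t *\<^sub>R x) = 0" using E that by simp
      then show ?thesis using D[of t] by simp
    qed
  qed simp
  then show ?thesis by simp
qed

text \<open>Gaussian integration by parts trades each factor \<open>b \<bullet> x\<close> for a derivative in direction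
  \<open>b\<close>, which lowers the degree of the solid harmonic by one.\<close>

lemma gauss_expect_solid_harmonic:
  fixes f :: "real ^ 'n \<Rightarrow> real"
  assumes "solid_harmonic k f" "m \<le> k"
  shows "gauss_expect (\<lambda>x. f x * (b \<bullet> x) ^ m) = (if m = k then fact k * f b else 0)"
  using assms
proof (induction m arbitrary: k f rule: less_induct)
  case (less m)
  have f: "real_polynomial_function f" using less.prems by (simp add: solid_harmonic_def)
  show ?case
  proof (cases m)
    case 0
    show ?thesis
    proof (cases "k = 0")
      case True
      then have "f = (\<lambda>x. f b * 1)"
        using solid_harmonic_0_const[of f] less.prems by (metis mult_1_right)
      then have "gauss_expect f = gauss_expect (\<lambda>x :: real ^ 'n. f b * 1)"
          by (rule arg_cong[where f = gauss_expect])
      also have "\<dots> = f b" unfolding gauss_expect_cmult gauss_expect_one by simp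
      finally have "gauss_expect f = f b" .
      then show ?thesis using 0 True by simp
    next
      case False
      \<comment> \<open>Euler's identity writes \<open>k f\<close> as a sum of coordinates times
        partial derivatives; integrating each by parts assembles the Laplacian, which is
        zero.\<close>
      have "real k * gauss_expect f = gauss_expect (\<lambda>x. pd x f x)"
        using less.prems by (simp add: solid_harmonic_def gauss_expect_cmult)
      also have "\<dots> = gauss_expect (\<lambda>x. \<Sum>i\<in>UNIV. (axis i 1 \<bullet> x) * pd (axis i 1) f x)"
        by (subst pd_components[OF f]) (simp add: inner_axis')
      also have "\<dots> = (\<Sum>i\<in>UNIV. gauss_expect (pd (axis i 1) (pd (axis i 1) f)))"
        by (subst gauss_expect_sum)
          (auto simp: gauss_expect_inner real_polynomial_function_pd f
            intro!: real_polynomial_function.intros(4) real_polynomial_function_inner)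
      also have "\<dots> = gauss_expect (laplacian f)"
        unfolding laplacian_def[abs_def]
        by (subst gauss_expect_sum) (auto intro: real_polynomial_function_pd f)
      also have "laplacian f = (\<lambda>x. 0)" using less.prems by (auto simp: solid_harmonic_def)
      finally show ?thesis using 0 False by simp
    qed
  next
    case (Suc l)
    then obtain k' where k': "k = Suc k'" using less.prems by (cases k) auto
    have P: "real_polynomial_function (\<lambda>x. (b \<bullet> x) ^ j)" for j
      by (intro real_polynomial_function_power real_polynomial_function_inner)
    have "gauss_expect (\<lambda>x. f x * (b \<bullet> x) ^ m) = gauss_expect (\<lambda>x. (b \<bullet> x) * (f x * (b \<bullet> x) ^ l))"
      by (simp add: Suc mult_ac)
    also have "\<dots> = gauss_expect (pd b (\<lambda>x. f x * (b \<bullet> x) ^ l))"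
      by (intro gauss_expect_inner real_polynomial_function.intros(4) f P)
    also have "pd b (\<lambda>x. f x * (b \<bullet> x) ^ l) =
        (\<lambda>x. (real l * (b \<bullet> b)) * (f x * (b \<bullet> x) ^ (l - 1)) + pd b f x * (b \<bullet> x) ^ l)"
      unfolding pd_mult[OF f P] pd_power[OF real_polynomial_function_inner] pd_inner
          by (simp add: mult_ac)
    also have "gauss_expect \<dots> = (real l * (b \<bullet> b)) * gauss_expect (\<lambda>x. f x * (b \<bullet> x) ^ (l - 1))
        + gauss_expect (\<lambda>x. pd b f x * (b \<bullet> x) ^ l)"
      by (subst gauss_expect_add)
        (auto simp: gauss_expect_cmult intro!: real_polynomial_function_cmult
          real_polynomial_function.intros(4) f P real_polynomial_function_pd)
    \<comment> \<open>Differentiating the power leaves a harmonic of degree \<open>k\<close> against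
      an exponent smaller than \<open>k\<close>, which integrates to zero. Only the derivative of
      \<open>f\<close> survives, and Euler's identity at \<open>b\<close> turns
      \<open>fact k'\<close> into \<open>fact k\<close>.\<close>
    also have "gauss_expect (\<lambda>x. f x * (b \<bullet> x) ^ (l - 1)) = 0"
      using less.IH[of "l - 1" k f] less.prems Suc by simp
    also have "gauss_expect (\<lambda>x. pd b f x * (b \<bullet> x) ^ l) =
        (if l = k' then fact k' * pd b f b else 0)"
      using less.prems Suc k' by (intro less.IH solid_harmonic_pd) auto
    also have "pd b f b = real k * f b" using less.prems by (simp add: solid_harmonic_def)
    finally show ?thesis using Suc k' by simp
  qed
qed

section \<open>Jacobi polynomials and kernels\<close>

text \<open>The substitution t = 2 v - 1 leads to Euler's Beta integral. Working with the
  nonnegative integral first gives value and integrability together, although exponents in (-1, 0)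
  make the weight singular at the end points.\<close>

lemma has_bochner_integral_Beta:
  assumes "p > -1" "q > (-1 :: real)"
  shows "has_bochner_integral lborel (\<lambda>t. indicator {-1..1} t * ((1 - t) powr p * (1 + t) powr q))
    (2 powr (p + q + 1) * Beta (q + 1) (p + 1))"
proof -
  define f where "f = (\<lambda>t :: real. indicator {-1..1} t * ((1 - t) powr p * (1 + t) powr q))"
  have "has_bochner_integral lborel (\<lambda>v :: real. indicator {0..1} v * (v powr q * (1 - v) powr p))
      (Beta (q + 1) (p + 1))"
  proof (rule has_bochner_integral_nn_integral)
    show "(\<integral>\<^sup>+v. ennreal (indicator {0..1} v * (v powr q * (1 - v) powr p)) \<partial>lborel) =
        ennreal (Beta (q + 1) (p + 1))"
      using nn_integral_has_integral_lebesgue[OF _ has_integral_Beta_real[of "q + 1" "p + 1"]] assms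
          by simp
    show "0 \<le> Beta (q + 1) (p + 1)" using assms
        by (auto simp: Beta_def intro!: divide_nonneg_nonneg mult_nonneg_nonneg)
  qed auto
  then have "has_bochner_integral lborel (\<lambda>v. 2 powr (p + q) * (indicator {0..1} v *
      (v powr q * (1 - v) powr p)))
      (2 powr (p + q) * Beta (q + 1) (p + 1))"
    by (rule has_bochner_integral_mult_right)
  also have "(\<lambda>v. 2 powr (p + q) * (indicator {0..1} v * (v powr q * (1 - v) powr p))) =
      (\<lambda>v. f (-1 + 2 * v))"
  proof
    fix v :: real
    have "(2 - 2 * v) powr p = 2 powr p * (1 - v) powr p" if "v \<le> 1"
      using powr_mult[of 2 "1 - v" p] that by (simp add: algebra_simps)
    moreover have "(2 * v) powr q = 2 powr q * v powr q" if "v \<ge> 0"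
      using powr_mult[of 2 v q] that by simp
    ultimately show "2 powr (p + q) * (indicator {0..1} v * (v powr q * (1 - v) powr p)) =
        f (-1 + 2 * v)"
      by (auto simp: f_def indicator_def powr_add algebra_simps)
  qed
  also have "2 powr (p + q) * Beta (q + 1) (p + 1) =
      (2 powr (p + q + 1) * Beta (q + 1) (p + 1)) /\<^sub>R \<bar>2\<bar>"
    by (simp add: powr_add)
  finally show ?thesis
    unfolding f_def[symmetric] by (subst lborel_has_bochner_integral_real_affine_iff[where c = 2
        and t = "-1"]) simp_all
qed

definition jacobi_weight :: "real \<Rightarrow> real \<Rightarrow> real \<Rightarrow> real" where
  "jacobi_weight \<alpha> \<beta> t = indicator {-1..1} t * ((1 - t) powr \<alpha> * (1 + t) powr \<beta>)"

definition jacobi_integral :: "real \<Rightarrow> real \<Rightarrow> real poly \<Rightarrow> real" where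
  "jacobi_integral \<alpha> \<beta> p = (LINT t|lborel. poly p t * jacobi_weight \<alpha> \<beta> t)"

lemma integrable_jacobi_weight:
  assumes "\<alpha> > -1" "\<beta> > -1"
  shows "integrable lborel (\<lambda>t. poly p t * jacobi_weight \<alpha> \<beta> t)"
proof -
  have i: "integrable lborel (jacobi_weight \<alpha> \<beta>)"
    using has_bochner_integral_Beta[OF assms] unfolding jacobi_weight_def[abs_def]
    by (auto simp: has_bochner_integral_iff)
  have "continuous_on {-1..1} (poly p)" by (intro continuous_intros)
  then have "compact (poly p ` {-1..1})" by (intro compact_continuous_image) auto
  then obtain K where K: "\<And>t. t \<in> {-1..1} \<Longrightarrow> norm (poly p t) \<le> K"
    by (meson bounded_iff compact_imp_bounded imageI)
  have [measurable]: "poly p \<in> borel_measurable borel"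
    by (intro borel_measurable_continuous_onI continuous_intros)
  have m [measurable]: "jacobi_weight \<alpha> \<beta> \<in> borel_measurable borel"
    using borel_measurable_integrable[OF i] by simp
  show ?thesis
  proof (rule Bochner_Integration.integrable_bound)
    show "integrable lborel (\<lambda>t. K * jacobi_weight \<alpha> \<beta> t)" using i by simp
    show "AE t in lborel. norm (poly p t * jacobi_weight \<alpha> \<beta> t) \<le> norm (K * jacobi_weight \<alpha> \<beta> t)"
    proof (rule AE_I2)
      fix t :: real
      show "norm (poly p t * jacobi_weight \<alpha> \<beta> t) \<le> norm (K * jacobi_weight \<alpha> \<beta> t)"
      proof (cases "t \<in> {-1..1}")
        case True
        then have "\<bar>poly p t\<bar> \<le> \<bar>K\<bar>" using K[OF True] by simp
        then show ?thesis by (auto simp: abs_mult intro: mult_right_mono)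
      qed (auto simp: jacobi_weight_def)
    qed
  qed measurable
qed

text \<open>The left side is the \<open>i\<close>-th backward difference of the rising factorial.
  One such difference acts on it as differentiation acts on a power, sending (x)_j to j (x)_(j-1),
  so more than \<open>j\<close> of them give zero. Orthogonality of the Jacobi polynomials rests on
  this.\<close>

lemma alternating_choose_pochhammer:
  fixes x :: real
  shows "(\<Sum>s\<le>i. (-1) ^ s * real (i choose s) * pochhammer (x - real s) j) =
    (if j < i then 0 else fact j / fact (j - i) * pochhammer x (j - i))"
proof (induction i arbitrary: x j)
  case (Suc i)
  define g where "g = (\<lambda>s. pochhammer (x - real s) j)"
  have diff: "g s - g (Suc s) = real j * pochhammer (x - real s) (j - 1)" for s
  proof (cases j)
    case (Suc l)
    have "pochhammer (x - real s) (Suc l) = pochhammer (x - real s) l * (x - real s + real l)"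
      by (rule pochhammer_Suc)
    moreover have "pochhammer (x - real (Suc s)) (Suc l) =
        (x - real (Suc s)) * pochhammer (x - real s) l"
      using pochhammer_rec[of "x - real (Suc s)" l] by simp
    ultimately show ?thesis unfolding g_def Suc by (simp add: algebra_simps)
  qed (simp add: g_def)
  have "(\<Sum>s\<le>Suc i. (-1) ^ s * real (Suc i choose s) * g s) =
      g 0 + (\<Sum>s\<le>i. (-1) ^ Suc s * real (Suc i choose Suc s) * g (Suc s))"
    by (subst sum.atMost_Suc_shift) simp
  also have "(\<Sum>s\<le>i. (-1) ^ Suc s * real (Suc i choose Suc s) * g (Suc s)) =
      (\<Sum>s\<le>i. (-1) ^ Suc s * real (i choose Suc s) * g (Suc s)) - (\<Sum>s\<le>i. (-1) ^ s *
        real (i choose s) * g (Suc s))"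
    by (simp add: algebra_simps sum.distrib sum_subtractf sum_negf)
  also have "g 0 + ((\<Sum>s\<le>i. (-1) ^ Suc s * real (i choose Suc s) * g (Suc s)) - (\<Sum>s\<le>i. (-1) ^ s *
      real (i choose s) * g (Suc s))) =
      (\<Sum>s\<le>Suc i. (-1) ^ s * real (i choose s) * g s) - (\<Sum>s\<le>i. (-1) ^ s * real (i choose s) *
        g (Suc s))"
    by (subst sum.atMost_Suc_shift) simp
  \<comment> \<open>The sum was lengthened only to absorb \<open>g 0\<close> after Pascal's rule;
    its last term vanishes because \<open>i choose Suc i\<close> is 0.\<close>
  also have "(\<Sum>s\<le>Suc i. (-1) ^ s * real (i choose s) * g s) =
      (\<Sum>s\<le>i. (-1) ^ s * real (i choose s) * g s)"
    by simp
  also have "\<dots> - (\<Sum>s\<le>i. (-1) ^ s * real (i choose s) * g (Suc s)) =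
      (\<Sum>s\<le>i. (-1) ^ s * real (i choose s) * (g s - g (Suc s)))"
    by (simp add: sum_subtractf right_diff_distrib)
  also have "\<dots> = real j * (\<Sum>s\<le>i. (-1) ^ s * real (i choose s) * pochhammer (x - real s) (j - 1))"
    unfolding diff sum_distrib_left by (rule sum.cong) (auto simp: mult_ac)
  also have "\<dots> = (if j < Suc i then 0 else fact j / fact (j - Suc i) * pochhammer x (j - Suc i))"
    unfolding Suc.IH by (cases j) (auto simp: algebra_simps add_divide_distrib)
  finally show ?case unfolding g_def .
qed simp

text \<open>Cancel the leading term and descend. The top coefficient is recorded because the square
  norm of a Jacobi polynomial is computed from it.\<close>

lemma poly_graded_basis:
  fixes p :: "real poly" and b :: "nat \<Rightarrow> real poly"
  assumes "\<And>j. degree (b j) = j" "\<And>j. coeff (b j) j \<noteq> 0" "degree p \<le> m"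
  shows "\<exists>c. p = (\<Sum>j\<le>m. smult (c j) (b j)) \<and> c m = coeff p m / coeff (b m) m"
  using assms(3)
proof (induction m arbitrary: p)
  case 0
  then have "p = [:coeff p 0:]" "b 0 = [:coeff (b 0) 0:]"
    using assms(1)[of 0] by (auto intro!: degree_0_id[symmetric])
  then have "p = smult (coeff p 0 / coeff (b 0) 0) (b 0)"
    using assms(2)[of 0]
        by (metis nonzero_mult_div_cancel_right smult_0_right smult_pCons times_divide_eq_left)
  then show ?case by (intro exI[of _ "\<lambda>_. coeff p 0 / coeff (b 0) 0"]) simp
next
  case (Suc m)
  define a where "a = coeff p (Suc m) / coeff (b (Suc m)) (Suc m)"
  define q where "q = p - smult a (b (Suc m))"
  have "degree q \<le> Suc m"
    unfolding q_def using Suc.prems assms(1)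
        by (intro degree_diff_le) (auto intro: order.trans[OF degree_smult_le])
  moreover have "coeff q (Suc m) = 0" using assms(2) by (simp add: q_def a_def)
  ultimately have "degree q \<le> m"
    by (metis le_SucE leading_coeff_0_iff degree_0 le0)
  from Suc.IH[OF this] obtain c where c: "q = (\<Sum>j\<le>m. smult (c j) (b j))" by blast
  have "p = (\<Sum>j\<le>m. smult (c j) (b j)) + smult a (b (Suc m))" using c by (simp add: q_def)
  also have "(\<Sum>j\<le>m. smult (c j) (b j)) = (\<Sum>j\<le>m. smult ((c(Suc m := a)) j) (b j))"
    by (rule sum.cong) auto
  finally show ?case by (intro exI[of _ "c(Suc m := a)"]) (simp add: a_def)
qed

text \<open>The functional \<open>boundary k\<close> is the normal derivative on the unit sphere of
  \<open>q (2 * |x|\<^sup>2 - 1)\<close> times a solid harmonic of degree \<open>k\<close>.\<close>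

definition boundary :: "nat \<Rightarrow> real poly \<Rightarrow> real" where
  "boundary k q = real k * poly q 1 + 4 * poly (pderiv q) 1"

lemma pderiv_sum: "pderiv (\<Sum>i\<in>A. p i) = (\<Sum>i\<in>A. pderiv (p i))" for p :: "'i \<Rightarrow> real poly"
  by (induction A rule: infinite_finite_induct) (simp_all add: pderiv_add)

lemma boundary_add: "boundary k (p + q) = boundary k p + boundary k q"
  by (simp add: boundary_def pderiv_add algebra_simps)

lemma boundary_smult: "boundary k (smult c p) = c * boundary k p"
  by (simp add: boundary_def pderiv_smult algebra_simps)

lemma boundary_diff: "boundary k (p - q) = boundary k p - boundary k q"
  by (simp add: boundary_def pderiv_diff algebra_simps)

lemma boundary_sum: "boundary k (\<Sum>i\<in>A. p i) = (\<Sum>i\<in>A. boundary k (p i))"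
  by (induction A rule: infinite_finite_induct) (simp_all add: boundary_add, simp_all
      add: boundary_def)

context
  fixes \<alpha> \<beta> :: real
  assumes ab: "\<alpha> > -1" "\<beta> > -1"
begin

lemma jacobi_integral_add: "jacobi_integral \<alpha> \<beta> (p + q) =
    jacobi_integral \<alpha> \<beta> p + jacobi_integral \<alpha> \<beta> q"
  unfolding jacobi_integral_def by (simp add: distrib_right integrable_jacobi_weight ab)

lemma jacobi_integral_smult: "jacobi_integral \<alpha> \<beta> (smult c p) = c * jacobi_integral \<alpha> \<beta> p"
  unfolding jacobi_integral_def by (simp add: mult.assoc)

lemma jacobi_integral_0: "jacobi_integral \<alpha> \<beta> 0 = 0"
  by (simp add: jacobi_integral_def)

lemma jacobi_integral_sum: "jacobi_integral \<alpha> \<beta> (\<Sum>i\<in>A. p i) = (\<Sum>i\<in>A. jacobi_integral \<alpha> \<beta> (p i))"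
  by (induction A rule: infinite_finite_induct) (simp_all add: jacobi_integral_0
      jacobi_integral_add)

lemma jacobi_integral_powers:
  "jacobi_integral \<alpha> \<beta> ([:1, -1:] ^ s * [:1, 1:] ^ j) =
    2 powr (\<alpha> + \<beta> + real s + real j + 1) *
    (Gamma (\<beta> + real j + 1) * Gamma (\<alpha> + real s + 1) / Gamma (\<alpha> + \<beta> + real s + real j + 2))"
proof -
  have "poly ([:1, -1:] ^ s * [:1, 1:] ^ j) t * jacobi_weight \<alpha> \<beta> t =
      indicator {-1..1} t * ((1 - t) powr (\<alpha> + real s) * (1 + t) powr (\<beta> + real j))" for t
  proof -
    \<comment> \<open>At the end points of the interval the base is 0; both sides are then 0 by the
      convention for \<open>powr\<close>, even when \<open>n = 0\<close>.\<close>
    have "x ^ n * x powr a = x powr (a + real n)" if "x \<ge> 0" for x a :: real and n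
      using that by (cases "x = 0") (simp_all add: powr_add powr_realpow)
    from this[of "1 - t" s \<alpha>] this[of "1 + t" j \<beta>] have
      e: "t \<in> {-1..1} \<Longrightarrow> (1 - t) ^ s * (1 - t) powr \<alpha> = (1 - t) powr (\<alpha> + real s)"
         "t \<in> {-1..1} \<Longrightarrow> (1 + t) ^ j * (1 + t) powr \<beta> = (1 + t) powr (\<beta> + real j)" by simp_all
    have P: "poly ([:1, -1:] ^ s * [:1, 1:] ^ j) t = (1 - t) ^ s * (1 + t) ^ j"
        by (simp add: poly_power)
    show ?thesis
    proof (cases "t \<in> {-1..1}")
      case True
      show ?thesis
        unfolding P jacobi_weight_def e(1)[OF True, symmetric] e(2)[OF True, symmetric]
            by (simp only: mult_ac)
    qed (simp add: jacobi_weight_def)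
  qed
  then show ?thesis
    unfolding jacobi_integral_def
    using has_bochner_integral_Beta[of "\<alpha> + real s" "\<beta> + real j"] ab
    by (simp add: has_bochner_integral_iff Beta_def algebra_simps)
qed

definition jacobi_coeff :: "nat \<Rightarrow> nat \<Rightarrow> real" where
  "jacobi_coeff i s = ((real i + \<alpha>) gchoose (i - s)) * ((real i + \<beta>) gchoose s)"

definition jacobi_poly :: "nat \<Rightarrow> real poly" where
  "jacobi_poly i = (\<Sum>s\<le>i. smult (jacobi_coeff i s) ([:-1/2, 1/2:] ^ s * [:1/2, 1/2:] ^ (i - s)))"

lemma poly_jacobi_poly: "poly (jacobi_poly i) t = jacobi i \<alpha> \<beta> t"
  unfolding jacobi_poly_def jacobi_def jacobi_coeff_def
  by (simp add: poly_sum poly_power algebra_simps diff_divide_distrib add_divide_distrib)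

text \<open>In this form the Gamma factors cancel against those of the Beta integrals. All arguments
  are positive because \<open>\<alpha>\<close> and \<open>\<beta>\<close> exceed -1.\<close>

lemma jacobi_coeff_Gamma:
  assumes "s \<le> i"
  shows "jacobi_coeff i s = Gamma (\<alpha> + real i + 1) / (fact (i - s) * Gamma (\<alpha> + real s + 1)) *
    (Gamma (\<beta> + real i + 1) / (fact s * Gamma (\<beta> + real (i - s) + 1)))"
proof -
  have p: "(a + real i) gchoose k = Gamma (a + real i + 1) / (fact k * Gamma (a + real (i - k) +
      1))"
    if "a > -1" "k \<le> i" for a k
  proof -
    have "a + real (i - k) + 1 > 0" using that by linarith
    then have "a + real (i - k) + 1 \<notin> \<int>\<^sub>\<le>\<^sub>0" using nonpos_Ints_nonpos by fastforce
    from pochhammer_Gamma[OF this, of k]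
    have "pochhammer (a + real (i - k) + 1) k = Gamma (a + real i + 1) / Gamma (a + real (i - k) +
        1)"
      using that by (simp add: of_nat_diff algebra_simps)
    then show ?thesis
      using that by (simp add: gbinomial_pochhammer' of_nat_diff algebra_simps)
  qed
  show ?thesis
    unfolding jacobi_coeff_def
    using p[of \<alpha> "i - s"] p[of \<beta> s] assms ab by (simp add: add.commute)
qed

lemma jacobi_coeff_pos:
  assumes "s \<le> i"
  shows "jacobi_coeff i s > 0"
  unfolding jacobi_coeff_Gamma[OF assms]
  using ab by (intro mult_pos_pos divide_pos_pos Gamma_real_pos) auto

text \<open>All summands have exact degree \<open>i\<close> and the same leading coefficient up to
  positive weights, so nothing cancels at the top.\<close>

lemma degree_jacobi_poly: "degree (jacobi_poly i) = i"
  and coeff_jacobi_poly_pos: "coeff (jacobi_poly i) i > 0"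
proof -
  define F where "F = (\<lambda>s. [:-1/2, 1/2 :: real:] ^ s * [:1/2, 1/2:] ^ (i - s))"
  have F: "jacobi_poly i = (\<Sum>s\<le>i. smult (jacobi_coeff i s) (F s))"
    by (simp add: jacobi_poly_def F_def)
  have dF: "degree (F s) = i" if "s \<le> i" for s
    using that unfolding F_def by (subst degree_mult_eq) (auto simp: degree_power_eq)
  have lF: "coeff (F s) i = (1/2) ^ i" if "s \<le> i" for s
  proof -
    have "lead_coeff (F s) = (1/2) ^ s * (1/2) ^ (i - s)"
      unfolding F_def lead_coeff_mult lead_coeff_power by simp
    then show ?thesis using dF[OF that] that by (simp flip: power_add)
  qed
  have "coeff (jacobi_poly i) i = (\<Sum>s\<le>i. jacobi_coeff i s * (1/2) ^ i)"
    unfolding F coeff_sum coeff_smult by (rule sum.cong) (auto simp: lF)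
  also have "\<dots> > 0" by (intro sum_pos mult_pos_pos jacobi_coeff_pos) auto
  finally show pos: "coeff (jacobi_poly i) i > 0" .
  have "degree (jacobi_poly i) \<le> i"
    unfolding F
    by (intro degree_sum_le) (auto intro!: order.trans[OF degree_smult_le] simp: dF)
  moreover have "i \<le> degree (jacobi_poly i)" using pos by (intro le_degree) auto
  ultimately show "degree (jacobi_poly i) = i" by simp
qed

text \<open>Multiplying by a power of 1 + t only shifts an exponent in each Beta integral. The Gamma
  factors in \<open>\<alpha> + s\<close> cancel, and what remains is the alternating sum of rising
  factorials evaluated in \<open>alternating_choose_pochhammer\<close>. The case
  \<open>j = i\<close> supplies the norm.\<close>

lemma jacobi_integral_jacobi_poly_power:
  assumes "j \<le> i"
  shows "jacobi_integral \<alpha> \<beta> (jacobi_poly i * [:1, 1:] ^ j) = (if j < i then 0 else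
    2 powr (\<alpha> + \<beta> + real i + 1) * Gamma (\<alpha> + real i + 1) * Gamma (\<beta> + real i + 1) / Gamma (\<alpha> + \<beta> +
        2 * real i + 2))"
proof -
  define C where "C = 2 powr (\<alpha> + \<beta> + real j + 1) * Gamma (\<alpha> + real i + 1) * Gamma (\<beta> + real i +
      1) / Gamma (\<alpha> + \<beta> + real i + real j + 2)"
  have h: "[:-1/2, 1/2 :: real:] = smult (-1/2) [:1, -1:]" "[:1/2, 1/2 :: real:] =
      smult (1/2) [:1, 1:]" by simp_all
  have "jacobi_integral \<alpha> \<beta> (jacobi_poly i * [:1, 1:] ^ j) =
      (\<Sum>s\<le>i. jacobi_coeff i s * ((-1) ^ s * (1/2) ^ i) * jacobi_integral \<alpha> \<beta> ([:1, -1:] ^ s *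
        [:1, 1:] ^ (i - s + j)))"
  proof -
    have "jacobi_poly i * [:1, 1:] ^ j =
        (\<Sum>s\<le>i. smult (jacobi_coeff i s * ((-1) ^ s * (1/2) ^ i)) ([:1, -1:] ^ s *
          [:1, 1:] ^ (i - s + j)))"
      unfolding jacobi_poly_def sum_distrib_right
    proof (rule sum.cong)
      fix s assume "s \<in> {..i}"
      then have "(- (1/2)) ^ s * (1/2) ^ (i - s) = (-1) ^ s * (1/2 :: real) ^ i"
        by (simp add: power_minus[of "1/2"] flip: power_add)
      then show "smult (jacobi_coeff i s) ([:-1/2, 1/2:] ^ s * [:1/2, 1/2:] ^ (i - s)) *
          [:1, 1:] ^ j =
          smult (jacobi_coeff i s * ((-1) ^ s * (1/2) ^ i)) ([:1, -1:] ^ s * [:1, 1:] ^ (i - s +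
              j))"
        unfolding h smult_power by (simp add: power_add mult_ac)
    qed simp
    then show ?thesis by (simp only: jacobi_integral_sum jacobi_integral_smult)
  qed
  also have "\<dots> = (\<Sum>s\<le>i. C / fact i * ((-1) ^ s * real (i choose s) * pochhammer (\<beta> + real i +
      1 - real s) j))"
  proof (rule sum.cong)
    fix s assume "s \<in> {..i}"
    then have s: "s \<le> i" by simp
    have pos: "\<beta> + real (i - s) + 1 > 0" "\<alpha> + real s + 1 > 0" using ab by linarith+
    then have "\<beta> + real (i - s) + 1 \<notin> \<int>\<^sub>\<le>\<^sub>0" using nonpos_Ints_nonpos by fastforce
    from pochhammer_Gamma[OF this, of j]
    have P: "Gamma (\<beta> + real (i - s + j) + 1) = pochhammer (\<beta> + real i + 1 - real s) j *
        Gamma (\<beta> + real (i - s) + 1)"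
      using Gamma_real_pos[OF pos(1)] s by (simp add: of_nat_diff field_simps)
    have Q: "(1/2) ^ i * 2 powr (\<alpha> + \<beta> + real s + real (i - s + j) + 1) =
        2 powr (\<alpha> + \<beta> + real j + 1)"
      using s by (simp add: of_nat_diff powr_add powr_realpow[symmetric] powr_minus power_divide
          field_simps)
    have R: "\<alpha> + \<beta> + real s + real (i - s + j) + 2 = \<alpha> + \<beta> + real i + real j + 2"
      using s by (simp add: of_nat_diff)
    have B: "real (i choose s) = fact i / (fact s * fact (i - s))" by (rule binomial_fact[OF s])
    have "jacobi_coeff i s * ((-1) ^ s * (1/2) ^ i) * jacobi_integral \<alpha> \<beta> ([:1, -1:] ^ s *
        [:1, 1:] ^ (i - s + j)) =
      jacobi_coeff i s * (-1) ^ s * ((1/2) ^ i * 2 powr (\<alpha> + \<beta> + real s + real (i - s + j) + 1)) *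
        (Gamma (\<beta> + real (i - s + j) + 1) * Gamma (\<alpha> + real s + 1) / Gamma (\<alpha> + \<beta> + real i +
          real j + 2))"
      unfolding jacobi_integral_powers R by (simp only: mult_ac)
    also have "\<dots> = C / fact i * ((-1) ^ s * real (i choose s) * pochhammer (\<beta> + real i + 1 - real s)
        j)"
      unfolding Q P jacobi_coeff_Gamma[OF s] B C_def
      using Gamma_real_pos[OF pos(1)] Gamma_real_pos[OF pos(2)] by (simp add: field_simps)
    finally show "jacobi_coeff i s * ((-1) ^ s * (1/2) ^ i) * jacobi_integral \<alpha> \<beta> ([:1, -1:] ^ s *
        [:1, 1:] ^ (i - s + j)) =
      C / fact i * ((-1) ^ s * real (i choose s) * pochhammer (\<beta> + real i + 1 - real s) j)" .
  qed simp
  also have "\<dots> = C / fact i * (if j < i then 0 else fact j / fact (j - i) * pochhammer (\<beta> + real i +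
      1) (j - i))"
    unfolding sum_distrib_left[symmetric] alternating_choose_pochhammer ..
  finally show ?thesis using assms by (auto simp: C_def algebra_simps)
qed

lemma jacobi_integral_orthogonal_lower:
  assumes "degree q < i"
  shows "jacobi_integral \<alpha> \<beta> (jacobi_poly i * q) = 0"
proof -
  have d: "degree ([:1, 1 :: real:] ^ j) = j" for j by (simp add: degree_power_eq)
  have "coeff ([:1, 1 :: real:] ^ j) j \<noteq> 0" for j
    using lead_coeff_power[of "[:1, 1 :: real:]" j] d[of j] by simp
  from poly_graded_basis[of "\<lambda>j. [:1, 1:] ^ j", OF d this order_refl]
  obtain c where c: "q = (\<Sum>j\<le>degree q. smult (c j) ([:1, 1:] ^ j))" by blast
  have "jacobi_integral \<alpha> \<beta> (jacobi_poly i * (\<Sum>j\<le>degree q. smult (c j) ([:1, 1:] ^ j))) =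
      (\<Sum>j\<le>degree q. c j * jacobi_integral \<alpha> \<beta> (jacobi_poly i * [:1, 1:] ^ j))"
    by (simp add: sum_distrib_left jacobi_integral_sum jacobi_integral_smult)
  also have "\<dots> = 0"
    using assms by (intro sum.neutral) (auto simp: jacobi_integral_jacobi_poly_power)
  finally show ?thesis using c by simp
qed

lemma jacobi_integral_orthogonal:
  assumes "i \<noteq> j"
  shows "jacobi_integral \<alpha> \<beta> (jacobi_poly i * jacobi_poly j) = 0"
proof (cases "j < i")
  case True
  then show ?thesis by (simp add: jacobi_integral_orthogonal_lower degree_jacobi_poly)
next
  case False
  then have "i < j" using assms by simp
  then show ?thesis
    by (subst mult.commute) (simp add: jacobi_integral_orthogonal_lower degree_jacobi_poly)
qed

lemma jacobi_integral_self:
  "jacobi_integral \<alpha> \<beta> (jacobi_poly i * jacobi_poly i) = jacobi_norm2 i \<alpha> \<beta>"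
  unfolding jacobi_integral_def jacobi_norm2_def set_lebesgue_integral_def jacobi_weight_def
  by (rule Bochner_Integration.integral_cong) (simp_all add: poly_jacobi_poly power2_eq_square
      mult_ac)

text \<open>Expand one factor in powers of 1 + t: by orthogonality only the leading coefficient
  contributes, and the norm is an explicit product of positive numbers.\<close>

lemma jacobi_norm2_pos: "jacobi_norm2 i \<alpha> \<beta> > 0"
proof -
  have d: "degree ([:1, 1 :: real:] ^ j) = j" for j by (simp add: degree_power_eq)
  have l: "coeff ([:1, 1 :: real:] ^ j) j = 1" for j
    using lead_coeff_power[of "[:1, 1 :: real:]" j] d[of j] by simp
  have "coeff ([:1, 1 :: real:] ^ j) j \<noteq> 0" for j by (simp add: l)
  from poly_graded_basis[of "\<lambda>j. [:1, 1:] ^ j", OF d this, of "jacobi_poly i" i]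
  obtain c where c: "jacobi_poly i = (\<Sum>j\<le>i. smult (c j) ([:1, 1:] ^ j))"
      and ci: "c i = coeff (jacobi_poly i) i"
    by (auto simp: degree_jacobi_poly l)
  have "jacobi_integral \<alpha> \<beta> (jacobi_poly i * (\<Sum>j\<le>i. smult (c j) ([:1, 1:] ^ j))) =
      (\<Sum>j\<le>i. c j * jacobi_integral \<alpha> \<beta> (jacobi_poly i * [:1, 1:] ^ j))"
    by (simp add: sum_distrib_left jacobi_integral_sum jacobi_integral_smult)
  also have "\<dots> = (\<Sum>j\<in>{i}. c j * jacobi_integral \<alpha> \<beta> (jacobi_poly i * [:1, 1:] ^ j))"
    by (rule sum.mono_neutral_right) (auto simp: jacobi_integral_jacobi_poly_power)
  also have "\<dots> = coeff (jacobi_poly i) i * (2 powr (\<alpha> + \<beta> + real i + 1) * Gamma (\<alpha> + real i + 1)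
      * Gamma (\<beta> + real i + 1) / Gamma (\<alpha> + \<beta> + 2 * real i + 2))"
    by (simp add: ci jacobi_integral_jacobi_poly_power)
  also have "\<dots> > 0"
    using ab by (intro mult_pos_pos divide_pos_pos coeff_jacobi_poly_pos Gamma_real_pos) auto
  finally show ?thesis unfolding c[symmetric] jacobi_integral_self .
qed

text \<open>The Riesz representer of a linear functional for the Jacobi product on degree at most
  \<open>m\<close>. Evaluation at \<open>t\<close> yields the Jacobi kernel,
  \<open>boundary k\<close> the direction of the rank one correction.\<close>

definition representer :: "nat \<Rightarrow> (real poly \<Rightarrow> real) \<Rightarrow> real poly" where
  "representer m \<phi> = (\<Sum>i\<le>m. smult (\<phi> (jacobi_poly i) / jacobi_norm2 i \<alpha> \<beta>) (jacobi_poly i))"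

lemma degree_representer: "degree (representer m \<phi>) \<le> m"
  unfolding representer_def
  by (intro degree_sum_le) (auto intro!: order.trans[OF degree_smult_le] simp: degree_jacobi_poly)

lemma jacobi_integral_representer:
  assumes add: "\<And>p q. \<phi> (p + q) = \<phi> p + \<phi> q" and smult: "\<And>c p. \<phi> (smult c p) = c * \<phi> p"
    and q: "degree q \<le> m"
  shows "jacobi_integral \<alpha> \<beta> (q * representer m \<phi>) = \<phi> q"
proof -
  have s: "\<phi> (\<Sum>i\<in>A. p i) = (\<Sum>i\<in>A. \<phi> (p i))" for p and A :: "nat set"
    using smult[of 0 0] by (induction A rule: infinite_finite_induct) (simp_all add: add)
  have "coeff (jacobi_poly j) j \<noteq> 0" for j using coeff_jacobi_poly_pos[of j] by simp
  from poly_graded_basis[of jacobi_poly, OF degree_jacobi_poly this q]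
  obtain c where c: "q = (\<Sum>j\<le>m. smult (c j) (jacobi_poly j))" by blast
  have "jacobi_integral \<alpha> \<beta> (jacobi_poly j * representer m \<phi>) = \<phi> (jacobi_poly j)" if "j \<le> m" for j
  proof -
    have "jacobi_integral \<alpha> \<beta> (jacobi_poly j * representer m \<phi>) =
        (\<Sum>i\<le>m. \<phi> (jacobi_poly i) / jacobi_norm2 i \<alpha> \<beta> * jacobi_integral \<alpha> \<beta> (jacobi_poly j *
          jacobi_poly i))"
      by (simp add: representer_def sum_distrib_left jacobi_integral_sum jacobi_integral_smult)
    also have "\<dots> = (\<Sum>i\<in>{j}. \<phi> (jacobi_poly i) / jacobi_norm2 i \<alpha> \<beta> *
        jacobi_integral \<alpha> \<beta> (jacobi_poly j * jacobi_poly i))"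
      using that by (intro sum.mono_neutral_right) (auto simp: jacobi_integral_orthogonal)
    also have "\<dots> = \<phi> (jacobi_poly j)"
      using jacobi_norm2_pos[of j] by (simp add: jacobi_integral_self)
    finally show ?thesis .
  qed
  then have "jacobi_integral \<alpha> \<beta> ((\<Sum>j\<le>m. smult (c j) (jacobi_poly j)) * representer m \<phi>) =
      (\<Sum>j\<le>m. c j * \<phi> (jacobi_poly j))"
    by (simp add: sum_distrib_right jacobi_integral_sum jacobi_integral_smult)
  also have "\<dots> = \<phi> q" unfolding arg_cong[OF c, of \<phi>] s smult ..
  finally show ?thesis unfolding c[symmetric] .
qed

text \<open>Look for the kernel as r_t - c r_b, with r_t and r_b the representers of evaluation and
  of \<open>boundary k\<close>. Reproduction requires c to be M times the boundary value of the
  kernel itself, that is c = M (N - c b), where N and b are the boundary values of r_t and r_b.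
  Solving gives c = M N / (1 + M b).\<close>

definition perturbed_kernel :: "nat \<Rightarrow> nat \<Rightarrow> real \<Rightarrow> real \<Rightarrow> real poly" where
  "perturbed_kernel m k M t = representer m (\<lambda>p. poly p t) -
    smult (M / (1 + M * boundary k (representer m (boundary k))) *
        boundary k (representer m (\<lambda>p. poly p t)))
      (representer m (boundary k))"

lemma boundary_representer: "boundary k (representer m \<phi>) =
    (\<Sum>i\<le>m. \<phi> (jacobi_poly i) * boundary k (jacobi_poly i) / jacobi_norm2 i \<alpha> \<beta>)"
  by (simp add: representer_def boundary_sum boundary_smult)

lemma poly_representer: "poly (representer m \<phi>) t =
    (\<Sum>i\<le>m. \<phi> (jacobi_poly i) * poly (jacobi_poly i) t / jacobi_norm2 i \<alpha> \<beta>)"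
  by (simp add: representer_def poly_sum)

text \<open>A sum of squares over positive norms; it keeps the denominator of the rank one formula
  positive for nonnegative mass.\<close>

lemma boundary_representer_nonneg: "boundary k (representer m (boundary k)) \<ge> 0"
  unfolding boundary_representer
  by (intro sum_nonneg divide_nonneg_pos jacobi_norm2_pos) auto

lemma degree_perturbed_kernel: "degree (perturbed_kernel m k M t) \<le> m"
  unfolding perturbed_kernel_def
  by (intro degree_diff_le degree_representer order.trans[OF degree_smult_le degree_representer])

lemma perturbed_kernel_reproducing:
  assumes "M \<ge> 0" "degree q \<le> m"
  shows "jacobi_integral \<alpha> \<beta> (q * perturbed_kernel m k M t) +
    M * boundary k q * boundary k (perturbed_kernel m k M t) = poly q t"
proof -
  define b where "b = boundary k (representer m (boundary k))"
  define N where "N = boundary k (representer m (\<lambda>p. poly p t))"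
  have "jacobi_integral \<alpha> \<beta> (q * representer m (\<lambda>p. poly p t)) = poly q t"
    by (rule jacobi_integral_representer) (use assms in auto)
  moreover have "jacobi_integral \<alpha> \<beta> (q * representer m (boundary k)) = boundary k q"
    by (rule jacobi_integral_representer) (use assms in \<open>auto simp: boundary_add boundary_smult\<close>)
  moreover have "jacobi_integral \<alpha> \<beta> (p - r) = jacobi_integral \<alpha> \<beta> p - jacobi_integral \<alpha> \<beta> r"
      for p r
    using jacobi_integral_add[of "p - r" r] by simp
  moreover define e where "e = 1 / (1 + M * b)"
  ultimately have I: "jacobi_integral \<alpha> \<beta> (q * perturbed_kernel m k M t) =
      poly q t - M * e * N * boundary k q"
    unfolding perturbed_kernel_def
        by (simp add: right_diff_distrib jacobi_integral_smult b_def N_def)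
  have B: "boundary k (perturbed_kernel m k M t) = N - M * e * N * b"
    unfolding perturbed_kernel_def by (simp add: boundary_diff boundary_smult b_def N_def e_def)
  have "b \<ge> 0" unfolding b_def by (rule boundary_representer_nonneg)
  then have "1 + M * b > 0" using assms by (simp add: add_pos_nonneg)
  then have "e * (1 + M * b) = 1" by (simp add: e_def)
  \<comment> \<open>After testing against both representers, this product is exactly the difference
    between the two sides of the claim.\<close>
  then have "M * boundary k q * N * (1 - e * (1 + M * b)) = 0" by simp
  then show ?thesis unfolding I B by (simp add: algebra_simps)
qed

text \<open>Sherman-Morrison for the rank one matrix \<open>M w w\<^sup>t\<close> with \<open>w = (k, 4)\<close>.\<close>

lemma poly_perturbed_kernel:
  assumes "A \<ge> 0"
  shows "poly (perturbed_kernel m k (2 ^ k * A) t) u = jacobi_kernel m \<alpha> \<beta> t u -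
    kernel_vec m \<alpha> \<beta> t \<bullet> (Lambda_mat m \<alpha> \<beta> (mass_mat A k) *v kernel_vec m \<alpha> \<beta> u)"
proof -
  define M where "M = 2 ^ k * A"
  define h where "h = (\<lambda>i. jacobi_norm2 i \<alpha> \<beta>)"
  define b where "b = boundary k (representer m (boundary k))"
  define N where "N = (\<lambda>t. boundary k (representer m (\<lambda>p. poly p t)))"
  have M: "M \<ge> 0" using assms by (simp add: M_def)
  have b: "b \<ge> 0" unfolding b_def by (rule boundary_representer_nonneg)
  have pos: "1 + M * b > 0" using M b by (simp add: add_pos_nonneg)
  have K: "jacobi_kernel m \<alpha> \<beta> t u = poly (representer m (\<lambda>p. poly p t)) u" for t u
    by (simp add: jacobi_kernel_def poly_representer poly_jacobi_poly)
  have d: "deriv (poly p) x = poly (pderiv p) x" for p :: "real poly" and x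
    by (rule DERIV_imp_deriv) simp
  have K01: "jacobi_kernel_deriv 0 1 m \<alpha> \<beta> t u = poly (pderiv (representer m (\<lambda>p. poly p t))) u"
      for t u
    unfolding jacobi_kernel_deriv_def K by (simp add: d)
  \<comment> \<open>Differentiating the kernel in its second variable gives the representer of
    "derivative at \<open>u\<close>", which also makes the mixed second derivative
    accessible.\<close>
  have K01': "poly (pderiv (representer m (\<lambda>p. poly p t))) u =
      poly (representer m (\<lambda>p. poly (pderiv p) u)) t" for t u
    by (simp add: representer_def pderiv_sum poly_sum pderiv_smult mult.commute)
  have K10: "jacobi_kernel_deriv 1 0 m \<alpha> \<beta> 1 1 = jacobi_kernel_deriv 0 1 m \<alpha> \<beta> 1 1"
  proof -
    have "jacobi_kernel m \<alpha> \<beta> t u = jacobi_kernel m \<alpha> \<beta> u t" for t u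
      by (simp add: jacobi_kernel_def mult.commute)
    then have "(\<lambda>t. jacobi_kernel m \<alpha> \<beta> t 1) = jacobi_kernel m \<alpha> \<beta> 1" by (rule ext)
    then show ?thesis by (simp add: jacobi_kernel_deriv_def)
  qed
  have K11: "jacobi_kernel_deriv 1 1 m \<alpha> \<beta> 1 1 =
      poly (pderiv (representer m (\<lambda>p. poly (pderiv p) 1))) 1"
  proof -
    have "(\<lambda>t. deriv (\<lambda>u. jacobi_kernel m \<alpha> \<beta> t u) 1) =
        poly (representer m (\<lambda>p. poly (pderiv p) 1))"
      unfolding K by (simp add: d K01' fun_eq_iff)
    then show ?thesis unfolding jacobi_kernel_deriv_def by (simp add: d)
  qed
  have vec: "kernel_vec m \<alpha> \<beta> t $ 1 = poly (representer m (\<lambda>p. poly p t)) 1"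
    "kernel_vec m \<alpha> \<beta> t $ 2 = poly (pderiv (representer m (\<lambda>p. poly p t))) 1" for t
    using K01 by (simp_all add: kernel_vec_def K)
  have N: "real k * kernel_vec m \<alpha> \<beta> t $ 1 + 4 * kernel_vec m \<alpha> \<beta> t $ 2 = N t" for t
    unfolding vec N_def boundary_def ..
  define P where "P = kernel_mat m \<alpha> \<beta>"
  have P: "P $ 2 $ 1 = P $ 1 $ 2" using K10 by (simp add: P_def kernel_mat_def)
  \<comment> \<open>This is w^t P w = b for w = (k, 4): the boundary functional is k times
    evaluation plus 4 times the derivative at 1.\<close>
  have bP: "(real k)\<^sup>2 * P $ 1 $ 1 + 8 * real k * P $ 1 $ 2 + 16 * P $ 2 $ 2 = b"
  proof -
    have lin: "representer m (boundary k) = smult (real k) (representer m (\<lambda>p. poly p 1)) +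
        smult 4 (representer m (\<lambda>p. poly (pderiv p) 1))"
      by (rule poly_eqI)
        (simp add: representer_def boundary_def coeff_sum sum_distrib_left add_divide_distrib
          distrib_right mult.assoc flip: sum.distrib)
    have "P $ 1 $ 1 = poly (representer m (\<lambda>p. poly p 1)) 1" "P $ 2 $ 2 =
        poly (pderiv (representer m (\<lambda>p. poly (pderiv p) 1))) 1"
      "P $ 1 $ 2 = poly (pderiv (representer m (\<lambda>p. poly p 1))) 1"
      "P $ 1 $ 2 = poly (representer m (\<lambda>p. poly (pderiv p) 1)) 1"
      using K10 K11 K01[of 1 1] K01'[of 1 1] by (simp_all add: P_def kernel_mat_def K)
    then show ?thesis
      unfolding b_def lin boundary_add boundary_smult
      by (simp add: boundary_def power2_eq_square algebra_simps)
  qed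
  define W :: "real ^ 2 ^ 2" where "W = mass_mat A k"
  have W: "W $ 1 $ 1 = M * (real k)\<^sup>2" "W $ 1 $ 2 = M * (4 * real k)" "W $ 2 $ 1 =
      M * (4 * real k)" "W $ 2 $ 2 = M * 16"
    by (simp_all add: W_def mass_mat_def M_def)
  define c where "c = 1 / (1 + M * b)"
  have c: "c * (1 + M * b) = 1" using pos by (simp add: c_def)
  define Q where "Q = mat 1 + W ** P"
  have Q: "Q $ i $ j = (if i = j then 1 else 0) + (W $ i $ 1 * P $ 1 $ j + W $ i $ 2 * P $ 2 $ j)"
      for i j
    by (simp add: Q_def matrix_matrix_mult_def mat_def sum_2)
  \<comment> \<open>The determinant of a rank one update of the identity: det (I + M w w^t P) = 1 +
    M w^t P w.\<close>
  have "det Q = 1 + M * b"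
    unfolding det_2 Q W bP[symmetric] by (simp add: P power2_eq_square algebra_simps)
  then have inv: "invertible Q" using pos by (simp add: invertible_det_nz)
  \<comment> \<open>From W = M w w^t follows W P W = M b W, so multiplication by \<open>Q\<close>
    acts on \<open>W\<close> as the scalar 1 + M b.\<close>
  have "Q ** (c *\<^sub>R W) = W"
  proof -
    have "Q ** W = (1 + M * b) *\<^sub>R W"
      unfolding bP[symmetric]
      by (simp add: vec_eq_iff forall_2 matrix_matrix_mult_def sum_2 Q W P power2_eq_square
          algebra_simps)
    moreover have "Q ** (c *\<^sub>R W) = c *\<^sub>R (Q ** W)"
      by (simp add: vec_eq_iff matrix_matrix_mult_def sum_2 algebra_simps)
    ultimately show ?thesis using c by simp
  qed
  then have "matrix_inv Q ** W = matrix_inv Q ** (Q ** (c *\<^sub>R W))" by simp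
  also have "\<dots> = c *\<^sub>R W"
    unfolding matrix_mul_assoc using someI_ex[OF inv[unfolded invertible_def]]
        unfolding matrix_inv_def by simp
  finally have L: "Lambda_mat m \<alpha> \<beta> (mass_mat A k) = c *\<^sub>R W"
    unfolding Lambda_mat_def Q_def P_def W_def .
  have "kernel_vec m \<alpha> \<beta> t \<bullet> (Lambda_mat m \<alpha> \<beta> (mass_mat A k) *v kernel_vec m \<alpha> \<beta> u) =
      c * M * N t * N u"
    unfolding L N[symmetric]
    by (simp add: inner_vec_def sum_2 matrix_vector_mult_def W power2_eq_square algebra_simps)
  moreover have "poly (representer m (boundary k)) u = N u"
    by (simp add: N_def boundary_representer poly_representer mult.commute)
  moreover have "boundary k (representer m (\<lambda>p. poly p t)) = N t" by (simp add: N_def)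
  ultimately show ?thesis
    unfolding perturbed_kernel_def K M_def[symmetric] b_def[symmetric] by (simp add: c_def)
qed

lemma poly_perturbed_kernel_0: "poly (perturbed_kernel m k 0 t) u = jacobi_kernel m \<alpha> \<beta> t u"
proof -
  have "mass_mat 0 k = 0" by (simp add: mass_mat_def)
  then have "Lambda_mat m \<alpha> \<beta> (mass_mat 0 k) = 0"
    by (simp add: Lambda_mat_def matrix_matrix_mult_def vec_eq_iff)
  then show ?thesis using poly_perturbed_kernel[of 0 m k t u] by simp
qed

end

section \<open>Zonal harmonics\<close>

definition zonal_coeff :: "real \<Rightarrow> nat \<Rightarrow> nat \<Rightarrow> real" where
  "zonal_coeff \<delta> k j = (-1) ^ j * pochhammer \<delta> (k - j) / (fact j * fact (k - 2 * j)) *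
      2 ^ (k - 2 * j)"

text \<open>Up to normalization, the reproducing kernel of the solid harmonics of degree \<open>k\<close>; clearing
  the norms in the Gegenbauer polynomial makes it a polynomial in both arguments.\<close>

definition zonal :: "real \<Rightarrow> nat \<Rightarrow> 'a::real_inner \<Rightarrow> 'a \<Rightarrow> real" where
  "zonal \<delta> k x y = (real k + \<delta>) / \<delta> *
    (\<Sum>j\<le>k div 2. zonal_coeff \<delta> k j * (x \<bullet> x) ^ j * ((x \<bullet> y) ^ (k - 2 * j) * (y \<bullet> y) ^ j))"

lemma zonal_gegenbauer:
  assumes "norm \<xi> = 1" "norm \<rho> = 1"
  shows "zonal \<delta> k (r *\<^sub>R \<xi>) (s *\<^sub>R \<rho>) =
    (r * s) ^ k * ((real k + \<delta>) / \<delta>) * gegenbauer k \<delta> (\<xi> \<bullet> \<rho>)"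
proof -
  have n: "\<xi> \<bullet> \<xi> = 1" "\<rho> \<bullet> \<rho> = 1" using assms by (simp_all add: norm_eq_1)
  have "zonal_coeff \<delta> k j * ((r *\<^sub>R \<xi>) \<bullet> (r *\<^sub>R \<xi>)) ^ j * (((r *\<^sub>R \<xi>) \<bullet> (s *\<^sub>R \<rho>)) ^ (k - 2 * j) *
      ((s *\<^sub>R \<rho>) \<bullet> (s *\<^sub>R \<rho>)) ^ j) =
      (r * s) ^ k * ((-1) ^ j * pochhammer \<delta> (k - j) / (fact j * fact (k - 2 * j)) *
        (2 * (\<xi> \<bullet> \<rho>)) ^ (k - 2 * j))"
    if "j \<le> k div 2" for j
  proof -
    have "(r * s) ^ k = (r * s) ^ (k - 2 * j) * (r * s) ^ (j + j)"
      using that by (simp flip: power_add)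
    then have "(r * s) ^ k = (r * s) ^ (k - 2 * j) * ((r * r) ^ j * (s * s) ^ j)"
      by (simp add: power_add power_mult_distrib mult_ac)
    then show ?thesis by (simp add: n zonal_coeff_def power_mult_distrib mult_ac)
  qed
  then show ?thesis by (simp add: zonal_def gegenbauer_def sum_distrib_left mult_ac)
qed

lemma zonal_scaleR: "zonal \<delta> k x (c *\<^sub>R y) = c ^ k * zonal \<delta> k x y"
proof -
  have "(x \<bullet> (c *\<^sub>R y)) ^ (k - 2 * j) * ((c *\<^sub>R y) \<bullet> (c *\<^sub>R y)) ^ j =
      c ^ k * ((x \<bullet> y) ^ (k - 2 * j) * (y \<bullet> y) ^ j)"
    if "j \<le> k div 2" for j
  proof -
    have "c ^ k = c ^ (k - 2 * j) * c ^ (j + j)" using that by (simp flip: power_add)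
    then have "c ^ k = c ^ (k - 2 * j) * (c * c) ^ j" by (simp add: power_add power_mult_distrib)
    then show ?thesis by (simp add: power_mult_distrib mult_ac)
  qed
  then show ?thesis by (simp add: zonal_def sum_distrib_left mult_ac)
qed

lemma real_polynomial_function_inner_powers:
  "real_polynomial_function (\<lambda>y :: real ^ 'n. (x \<bullet> y) ^ p * (y \<bullet> y) ^ j)"
  by (intro real_polynomial_function.intros(4) real_polynomial_function_power
      real_polynomial_function_inner real_polynomial_function_norm2)

lemma real_polynomial_function_zonal: "real_polynomial_function (zonal \<delta> k (x :: real ^ 'n))"
  unfolding zonal_def[abs_def]
  by (intro real_polynomial_function_cmult real_polynomial_function_sum
      real_polynomial_function_inner_powers) auto

lemma polys_upto_zonal: "zonal \<delta> k (x :: real ^ 'n) \<in> polys_upto k"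
  unfolding zonal_def[abs_def]
proof (intro polys_upto_cmult polys_upto_sum)
  fix j assume "j \<in> {..k div 2}"
  then have "(k - 2 * j) * 1 + j * 2 \<le> k" by auto
  then show "(\<lambda>y. (x \<bullet> y) ^ (k - 2 * j) * (y \<bullet> y) ^ j) \<in> polys_upto k"
    by (rule polys_upto_mono[OF polys_upto_mult[OF polys_upto_power[OF polys_upto_inner]
        polys_upto_power[OF polys_upto_norm2]]])
qed

lemma laplacian_inner_power:
  "laplacian (\<lambda>y. (x \<bullet> y) ^ p) y = real p * real (p - 1) * (x \<bullet> x) * (x \<bullet> y) ^ (p - 2)"
  for x y :: "real ^ 'n"
proof -
  note ri = real_polynomial_function_inner
  have "pd v (pd v (\<lambda>y. (x \<bullet> y) ^ p)) y = real p * real (p - 1) * (x \<bullet> y) ^ (p - 2) * (x \<bullet> v)\<^sup>2"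
      for v
  proof -
    have eq: "pd v (\<lambda>y. (x \<bullet> y) ^ p) = (\<lambda>y. (real p * (x \<bullet> v)) * (x \<bullet> y) ^ (p - 1))"
      unfolding pd_power[OF ri] pd_inner by (simp add: mult_ac)
    show ?thesis
      unfolding eq pd_cmult[OF real_polynomial_function_power[OF ri]]
      unfolding pd_power[OF ri] pd_inner by (simp add: power2_eq_square numeral_2_eq_2 mult_ac)
  qed
  moreover have "(\<Sum>i\<in>UNIV. (x \<bullet> axis i 1)\<^sup>2) = x \<bullet> x"
    unfolding inner_axis by (simp add: inner_vec_def power2_eq_square)
  ultimately show ?thesis
    unfolding laplacian_def by (simp flip: sum_distrib_left)
qed

lemma pd_inner_self_power:
  "pd v (\<lambda>y. (y \<bullet> y) ^ j) = (\<lambda>y. (2 * real j) * ((v \<bullet> y) * (y \<bullet> y) ^ (j - 1)))" for v :: "real ^ 'n"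
  unfolding pd_power[OF real_polynomial_function_norm2] pd_inner_self
      by (simp add: inner_commute mult_ac)

lemma laplacian_inner_self_power:
  "laplacian (\<lambda>y. (y \<bullet> y) ^ j) y = 2 * real j * (2 * real j - 2 + real CARD('n)) *
      (y \<bullet> y) ^ (j - 1)"
  for y :: "real ^ 'n"
proof -
  note rn = real_polynomial_function_norm2 and ri = real_polynomial_function_inner
  have "pd v (pd v (\<lambda>y. (y \<bullet> y) ^ j)) y =
      2 * real j * (2 * real (j - 1) * ((y \<bullet> y) ^ (j - 2) * (v \<bullet> y)\<^sup>2) + (v \<bullet> v) *
          (y \<bullet> y) ^ (j - 1))" for v
    unfolding pd_inner_self_power
      pd_cmult[OF real_polynomial_function.intros(4)[OF ri real_polynomial_function_power[OF rn]]]
      pd_mult[OF ri real_polynomial_function_power[OF rn]] pd_inner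
    by (simp add: power2_eq_square numeral_2_eq_2 algebra_simps)
  moreover have "(\<Sum>i\<in>UNIV. (axis i 1 \<bullet> y)\<^sup>2) = y \<bullet> y"
    unfolding inner_axis' by (simp add: inner_vec_def power2_eq_square)
  moreover have "real (j - 1) * ((y \<bullet> y) ^ (j - 2) * (y \<bullet> y)) = real (j - 1) * (y \<bullet> y) ^ (j - 1)"
  proof (cases "j \<ge> 2")
    case True
    then have "j - 1 = Suc (j - 2)" by simp
    then show ?thesis by (metis power_Suc2)
  qed auto
  ultimately have "laplacian (\<lambda>y. (y \<bullet> y) ^ j) y =
      2 * real j * (2 * (real (j - 1) * (y \<bullet> y) ^ (j - 1)) + real CARD('n) * (y \<bullet> y) ^ (j - 1))"
    unfolding laplacian_def
        by (simp add: sum.distrib inner_axis_axis mult.assoc flip: sum_distrib_left)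
  then show ?thesis by (cases j) (simp_all add: algebra_simps)
qed

text \<open>The summand \<open>2 * real p\<close> comes from the cross term: the gradients of the
  two factors point along x and y, and their inner product x . y restores the lost power. Truncated
  exponents occur only with a zero coefficient.\<close>

lemma laplacian_inner_powers:
  fixes x y :: "real ^ 'n"
  shows "laplacian (\<lambda>y. (x \<bullet> y) ^ p * (y \<bullet> y) ^ j) y =
    real p * real (p - 1) * (x \<bullet> x) * ((x \<bullet> y) ^ (p - 2) * (y \<bullet> y) ^ j) +
    2 * real j * (2 * real j - 2 + real CARD('n) + 2 * real p) * ((x \<bullet> y) ^ p * (y \<bullet> y) ^ (j - 1))"
proof -
  note ri = real_polynomial_function_inner and rp = real_polynomial_function_power
  have "pd v (\<lambda>y. (x \<bullet> y) ^ p) y * pd v (\<lambda>y. (y \<bullet> y) ^ j) y =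
      2 * real p * real j * ((x \<bullet> y) ^ (p - 1) * (y \<bullet> y) ^ (j - 1)) * ((x \<bullet> v) * (v \<bullet> y))" for v
    unfolding pd_inner_self_power pd_power[OF ri] pd_inner by (simp add: mult_ac)
  moreover have "(\<Sum>i\<in>UNIV. (x \<bullet> axis i 1) * (axis i 1 \<bullet> y)) = x \<bullet> y"
    unfolding inner_axis inner_axis' by (simp add: inner_vec_def)
  ultimately have "(\<Sum>i\<in>UNIV. pd (axis i 1) (\<lambda>y. (x \<bullet> y) ^ p) y * pd (axis i 1) (\<lambda>y. (y \<bullet> y) ^ j)
      y) =
      2 * real p * real j * ((x \<bullet> y) ^ (p - 1) * (y \<bullet> y) ^ (j - 1)) * (x \<bullet> y)"
    by (simp flip: sum_distrib_left)
  also have "\<dots> = 2 * real p * real j * ((x \<bullet> y) ^ p * (y \<bullet> y) ^ (j - 1))"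
    by (cases p) simp_all
  finally show ?thesis
    unfolding laplacian_mult[OF rp[OF ri] rp[OF real_polynomial_function_norm2]]
        laplacian_inner_power laplacian_inner_self_power
    by (simp add: algebra_simps)
qed

text \<open>The left factor arises when the Laplacian lowers the power of y . y in term
  \<open>j + 1\<close>, the right one when it lowers the power of x . y in term \<open>j\<close>.
  The recurrence makes these contributions cancel.\<close>

lemma zonal_coeff_Suc:
  assumes "2 * Suc j \<le> k"
  shows "zonal_coeff \<delta> k (Suc j) * (4 * real (Suc j) * (real k - real (Suc j) + \<delta>)) =
    - zonal_coeff \<delta> k j * (real (k - 2 * j) * real (k - 2 * j - 1))"
proof -
  define l where "l = k - 2 * Suc j"
  have k: "k = l + 2 * Suc j" using assms by (simp add: l_def)
  have e: "k - 2 * Suc j = l" "k - 2 * j = Suc (Suc l)" "k - j = Suc (k - Suc j)" "k - Suc j =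
      l + Suc j"
    using k by simp_all
  have p: "pochhammer \<delta> (k - j) = pochhammer \<delta> (k - Suc j) * (real k - real (Suc j) + \<delta>)"
    unfolding e(3) pochhammer_Suc by (simp add: k algebra_simps)
  have F: "real (Suc j) / fact (Suc j) = 1 / fact j" "real (Suc (Suc l)) *
      real (Suc l) / fact (Suc (Suc l)) = 1 / fact l"
    by (simp_all add: divide_simps)
  define C where "C = - ((-1) ^ j * pochhammer \<delta> (k - Suc j) * (real k - real (Suc j) + \<delta>) *
      (4 * 2 ^ l))"
  have "zonal_coeff \<delta> k (Suc j) * (4 * real (Suc j) * (real k - real (Suc j) + \<delta>)) =
      C * (real (Suc j) / fact (Suc j)) * (1 / fact l)"
    unfolding zonal_coeff_def e(1) C_def by (simp del: fact_Suc of_nat_Suc)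
  moreover have "- zonal_coeff \<delta> k j * (real (k - 2 * j) * real (k - 2 * j - 1)) =
      C * (1 / fact j) * (real (Suc (Suc l)) * real (Suc l) / fact (Suc (Suc l)))"
    unfolding zonal_coeff_def e(2) p C_def by (simp del: fact_Suc of_nat_Suc)
  ultimately show ?thesis unfolding F by simp
qed

lemma solid_harmonic_zonal:
  fixes x :: "real ^ 'n"
  assumes "\<delta> = (real CARD('n) - 2) / 2"
  shows "solid_harmonic k (zonal \<delta> k x)"
  unfolding solid_harmonic_def
proof (intro conjI allI real_polynomial_function_zonal)
  fix y :: "real ^ 'n"
  define K where "K = k div 2"
  define T where "T = (\<lambda>j (y :: real ^ 'n). (x \<bullet> y) ^ (k - 2 * j) * (y \<bullet> y) ^ j)"
  define a where "a = (\<lambda>j. zonal_coeff \<delta> k j * (x \<bullet> x) ^ j)"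
  have Z: "zonal \<delta> k x = (\<lambda>y. (real k + \<delta>) / \<delta> * (\<Sum>j\<le>K. a j * T j y))"
    by (simp add: zonal_def[abs_def] a_def T_def K_def)
  have rT: "real_polynomial_function (T j)" for j
    unfolding T_def by (rule real_polynomial_function_inner_powers)
  have raT: "real_polynomial_function (\<lambda>y. a j * T j y)" for j
    by (intro real_polynomial_function_cmult rT)
  have rS: "real_polynomial_function (\<lambda>y. \<Sum>j\<le>K. a j * T j y)"
    by (intro real_polynomial_function_sum raT) auto
  define f where "f = (\<lambda>j. a j * (real (k - 2 * j) * real (k - 2 * j - 1) * (x \<bullet> x) *
      ((x \<bullet> y) ^ (k - 2 * j - 2) * (y \<bullet> y) ^ j)))"
  define g where "g = (\<lambda>j. a j * (4 * real j * (real k - real j + \<delta>) * ((x \<bullet> y) ^ (k - 2 * j) *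
      (y \<bullet> y) ^ (j - 1))))"
  have "laplacian (\<lambda>y. a j * T j y) y = f j + g j" if "j \<le> K" for j
  proof -
    \<comment> \<open>Here the parameter of the Gegenbauer polynomial is tied to the dimension by
      \<open>\<delta>\<close> = (d - 2) / 2.\<close>
    have E: "2 * real j - 2 + real CARD('n) + 2 * real (k - 2 * j) = 2 * (real k - real j + \<delta>)"
      using that assms by (simp add: of_nat_diff K_def)
    show ?thesis
      unfolding laplacian_cmult[OF rT] unfolding T_def laplacian_inner_powers E f_def g_def
      by (simp add: distrib_left mult.assoc)
  qed
  then have "laplacian (zonal \<delta> k x) y = (real k + \<delta>) / \<delta> * ((\<Sum>j\<le>K. f j) + (\<Sum>j\<le>K. g j))"
    unfolding Z laplacian_cmult[OF rS] by (simp add: laplacian_sum raT sum.distrib)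
  also have "(\<Sum>j\<le>K. f j) + (\<Sum>j\<le>K. g j) = 0"
  proof -
    \<comment> \<open>\<open>f j\<close> cancels \<open>g (Suc j)\<close>. The unpaired ends vanish:
      at \<open>j = K\<close> the exponent of x . y is 0 or 1, and at 0 there is no power of y . y
      to lower.\<close>
    have "f K = 0"
    proof -
      have "k - 2 * K = 0 \<or> k - 2 * K = 1" unfolding K_def by presburger
      then show ?thesis by (auto simp: f_def)
    qed
    then have "(\<Sum>j\<le>K. f j) = (\<Sum>j<K. f j)" by (simp add: lessThan_Suc_atMost[symmetric])
    moreover have "g 0 = 0" by (simp add: g_def)
    then have "(\<Sum>j\<le>K. g j) = (\<Sum>j<K. g (Suc j))"
      by (simp add: sum.atMost_shift)
    moreover have "g (Suc j) = - f j" if "j < K" for j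
    proof -
      have l: "2 * Suc j \<le> k" using that by (simp add: K_def)
      have e: "k - 2 * Suc j = k - 2 * j - 2" by simp
      have "g (Suc j) = (zonal_coeff \<delta> k (Suc j) * (4 * real (Suc j) * (real k - real (Suc j) +
          \<delta>))) *
          ((x \<bullet> x) ^ Suc j * ((x \<bullet> y) ^ (k - 2 * j - 2) * (y \<bullet> y) ^ j))"
        unfolding g_def a_def e by (simp add: mult_ac)
      then show ?thesis
        unfolding zonal_coeff_Suc[OF l] by (simp add: f_def a_def mult_ac)
    qed
    ultimately show ?thesis by (simp add: sum_negf)
  qed
  finally show "laplacian (zonal \<delta> k x) y = 0" by simp
  have "pd y (T j) y = real k * T j y" if "j \<le> K" for j
  proof -
    have "pd y (T j) y = (x \<bullet> y) ^ (k - 2 * j) * (2 * real j * ((y \<bullet> y) * (y \<bullet> y) ^ (j - 1)))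
        + real (k - 2 * j) * ((x \<bullet> y) ^ (k - 2 * j - 1) * (x \<bullet> y)) * (y \<bullet> y) ^ j"
      unfolding T_def
        pd_mult[OF real_polynomial_function_power[OF real_polynomial_function_inner]
            real_polynomial_function_power[OF real_polynomial_function_norm2]]
        pd_inner_self_power pd_power[OF real_polynomial_function_inner] pd_inner
      by (simp add: mult_ac)
    also have "2 * real j * ((y \<bullet> y) * (y \<bullet> y) ^ (j - 1)) = 2 * real j * (y \<bullet> y) ^ j"
      by (cases j) simp_all
    also have "real (k - 2 * j) * ((x \<bullet> y) ^ (k - 2 * j - 1) * (x \<bullet> y)) =
        real (k - 2 * j) * (x \<bullet> y) ^ (k - 2 * j)"
      by (cases "k - 2 * j") simp_all
    finally show ?thesis
      using that by (simp add: T_def of_nat_diff K_def algebra_simps)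
  qed
  then show "pd y (zonal \<delta> k x) y = real k * zonal \<delta> k x y"
    unfolding Z pd_cmult[OF rS]
    by (simp add: pd_sum raT pd_cmult rT sum_distrib_left mult_ac)
qed

section \<open>Integrals of polynomials over the unit sphere\<close>

lemma continuous_on_real_polynomial_function:
  "real_polynomial_function f \<Longrightarrow> continuous_on S f"
  by (intro continuous_at_imp_continuous_on ballI differentiable_imp_continuous_within
      real_polynomial_function_differentiable)

lemma borel_measurable_real_polynomial_function:
  fixes f :: "real ^ 'n \<Rightarrow> real"
  shows "real_polynomial_function f \<Longrightarrow> f \<in> borel_measurable borel"
  by (intro borel_measurable_continuous_onI continuous_on_real_polynomial_function)

lemma integrable_sphere_measure_poly:
  fixes f :: "real ^ 'n \<Rightarrow> real"
  shows "real_polynomial_function f \<Longrightarrow> integrable sphere_measure f"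
  by (intro integrable_sphere_measure_continuous continuous_on_real_polynomial_function)

text \<open>The radial part of a Gaussian integral in the variable s = r^2, reduced to the Gamma
  integral by s = 2 u.\<close>

lemma has_bochner_integral_Gamma_half:
  fixes a :: real
  assumes "a > 0"
  shows "has_bochner_integral lborel (\<lambda>s. indicator {0..} s * (exp (- s / 2) * s powr (a - 1)))
      (2 powr a * Gamma a)"
proof -
  define f where "f = (\<lambda>s :: real. indicator {0..} s * (exp (- s / 2) * s powr (a - 1)))"
  have "has_bochner_integral lborel (\<lambda>u. indicator {0..} u * (u powr (a - 1) / exp u)) (Gamma a)"
  proof (rule has_bochner_integral_nn_integral)
    show "(\<integral>\<^sup>+u. ennreal (indicator {0..} u * (u powr (a - 1) / exp u)) \<partial>lborel) =
        ennreal (Gamma a)"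
      using nn_integral_has_integral_lebesgue[OF _ Gamma_integral_real[OF assms]] by simp
    show "0 \<le> Gamma a" using Gamma_real_pos[OF assms] by simp
  qed auto
  then have "has_bochner_integral lborel (\<lambda>u. 2 powr (a - 1) * (indicator {0..} u *
      (u powr (a - 1) / exp u))) (2 powr (a - 1) * Gamma a)"
    by (rule has_bochner_integral_mult_right)
  also have "(\<lambda>u. 2 powr (a - 1) * (indicator {0..} u * (u powr (a - 1) / exp u))) =
      (\<lambda>u. f (0 + 2 * u))"
    by (rule ext) (auto simp: f_def indicator_def powr_mult exp_minus field_simps)
  also have "2 powr (a - 1) * Gamma a = (2 powr a * Gamma a) /\<^sub>R \<bar>2\<bar>"
    by (simp add: powr_diff)
  finally show ?thesis
    unfolding f_def[symmetric] by (subst lborel_has_bochner_integral_real_affine_iff[where c = 2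
        and t = 0]) simp_all
qed

lemma gaussian_eq: "gaussian x = (1 / sqrt (2 * pi)) ^ CARD('n) * exp (- (norm x)\<^sup>2 / 2)"
    for x :: "real ^ 'n"
proof -
  have "(norm x)\<^sup>2 = (\<Sum>i\<in>UNIV. (x $ i)\<^sup>2)"
    unfolding power2_norm_eq_inner by (simp add: inner_vec_def power2_eq_square)
  then show ?thesis
    by (simp add: gaussian_def std_normal_density_def prod.distrib prod_dividef exp_sum[symmetric]
        sum_negf sum_divide_distrib[symmetric] power_one_over)
qed

text \<open>A homogeneous integrand contributes r^m, so the Gaussian integral is a Gamma integral
  times the integral over the sphere. Sphere integrals can thus be read off from Gaussian
  ones.\<close>

lemma gauss_expect_homogeneous:
  fixes H :: "real ^ 'n \<Rightarrow> real"
  assumes H: "real_polynomial_function H" and hom: "\<And>c y. H (c *\<^sub>R y) = c ^ m * H y"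
  shows "gauss_expect H = (1 / sqrt (2 * pi)) ^ CARD('n) / 2 *
    (2 powr ((real m + real CARD('n)) / 2) * Gamma ((real m + real CARD('n)) / 2)) *
      (LINT \<omega>|sphere_measure. H \<omega>)"
proof -
  define C where "C = (1 / sqrt (2 * pi)) ^ CARD('n)"
  define a where "a = (real m + real CARD('n)) / 2"
  have a: "a > 0" unfolding a_def by (simp add: add_nonneg_pos)
  define \<phi> where "\<phi> = (\<lambda>s. C * (exp (- s / 2) * s powr (real m / 2)))"
  have Hi: "integrable sphere_measure H" by (rule integrable_sphere_measure_poly[OF H])
  have "(\<lambda>s. indicator {0..} s * (\<phi> s * s powr (real DIM(real ^ 'n) / 2 - 1))) =
      (\<lambda>s. C * (indicator {0..} s * (exp (- s / 2) * s powr (a - 1))))"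
    by (rule ext) (simp add: \<phi>_def a_def add_divide_distrib powr_add[symmetric] mult_ac flip:
        add_diff_eq)
  then have R: "has_bochner_integral lborel (\<lambda>s. indicator {0..} s *
      (\<phi> s * s powr (real DIM(real ^ 'n) / 2 - 1))) (C * (2 powr a * Gamma a))"
    using has_bochner_integral_mult_right[OF has_bochner_integral_Gamma_half[OF a], of C] by simp
  have [measurable]: "\<phi> \<in> borel_measurable borel" unfolding \<phi>_def by measurable
  have "gauss_expect H = (LINT y|lborel. \<phi> ((norm y)\<^sup>2) * H (y /\<^sub>R norm y))"
    unfolding gauss_expect_def
  proof (rule Bochner_Integration.integral_cong_AE)
    show "(\<lambda>y. H y * gaussian y) \<in> borel_measurable lborel"
      using integrable_poly_gaussian[OF H] by auto
    have [measurable]: "H \<in> borel_measurable borel"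
      by (rule borel_measurable_real_polynomial_function[OF H])
    show "(\<lambda>y. \<phi> ((norm y)\<^sup>2) * H (y /\<^sub>R norm y)) \<in> borel_measurable lborel" by measurable
    have "AE y :: real ^ 'n in lborel. y \<noteq> 0" by (rule AE_lborel_singleton)
    then show "AE y in lborel. H y * gaussian y = \<phi> ((norm y)\<^sup>2) * H (y /\<^sub>R norm y)"
    proof eventually_elim
      case (elim y)
      have "H y = norm y ^ m * H (y /\<^sub>R norm y)" using hom[of "norm y" "y /\<^sub>R norm y"] elim by simp
      moreover have "((norm y)\<^sup>2) powr (real m / 2) = norm y ^ m"
        using elim by (simp add: powr_realpow powr_powr flip: powr_numeral)
      ultimately show ?case by (simp add: gaussian_eq \<phi>_def C_def mult_ac)
    qed
  qed
  also have "\<dots> = C * (2 powr a * Gamma a) / 2 * (LINT \<omega>|sphere_measure. H \<omega>)"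
    using polar_integral(2)[OF _ _ Hi, of \<phi>] R by (simp add: has_bochner_integral_iff)
  finally show ?thesis by (simp add: C_def a_def)
qed

lemma LINT_sphere:
  fixes f :: "'a::euclidean_space \<Rightarrow> real"
  assumes [measurable]: "f \<in> borel_measurable borel"
  shows "(LINT x:sphere 0 1|sphere_measure. f x) = (LINT x|sphere_measure. f x)"
  unfolding set_lebesgue_integral_def
  by (rule Bochner_Integration.integral_cong_AE) (measurable, use AE_sphere_measure in \<open>auto elim!:
      AE_mp\<close>)

lemma sphere_area_LINT: "sphere_area TYPE('n::finite) =
    (LINT x|(sphere_measure :: (real ^ 'n) measure). 1)"
proof -
  have "measure sphere_measure (sphere (0 :: real ^ 'n) 1) =
      measure (sphere_measure :: (real ^ 'n) measure) UNIV"
    by (rule measure_eq_AE) (use AE_sphere_measure in \<open>auto elim!: AE_mp\<close>)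
  then show ?thesis by (simp add: sphere_area_def)
qed

text \<open>The Gaussian value is known, and the ratio of the Gamma factors in degrees 2 k and 0 is
  2^k (d/2)_k. Homogeneity is assumed explicitly because the polar decomposition uses it in that
  form, while \<open>solid_harmonic\<close> records Euler's identity.\<close>

lemma sphere_integral_solid_harmonic:
  fixes f :: "real ^ 'n \<Rightarrow> real"
  assumes f: "solid_harmonic k f" and hom: "\<And>c y. f (c *\<^sub>R y) = c ^ k * f y" and "m \<le> k"
  shows "(LINT \<omega>|sphere_measure. f \<omega> * (b \<bullet> \<omega>) ^ m) =
    (if m = k then sphere_area TYPE('n) * fact k * f b / (2 ^ k * pochhammer (real CARD('n) / 2) k)
      else 0)"
proof -
  define C where "C = (1 / sqrt (2 * pi)) ^ CARD('n) / 2"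
  have C: "C > 0" by (simp add: C_def)
  define d where "d = real CARD('n) / 2"
  have d: "d > 0" by (simp add: d_def)
  define g where "g = (\<lambda>m. 2 powr (real m / 2 + d) * Gamma (real m / 2 + d))"
  have g: "g m > 0" for m unfolding g_def using d
      by (intro mult_pos_pos Gamma_real_pos) (auto intro: add_nonneg_pos)
  have hom_int: "gauss_expect H = C * g m * (LINT \<omega>|sphere_measure. H \<omega>)"
    if "real_polynomial_function H" "\<And>c y. H (c *\<^sub>R y) = c ^ m * H y" for H :: "real ^ 'n \<Rightarrow> real"
        and m
    using gauss_expect_homogeneous[OF that] by (simp add: C_def g_def d_def add_divide_distrib)
  \<comment> \<open>The constant function calibrates the Gaussian normalization against the area of
    the sphere.\<close>
  have A: "1 = C * g 0 * sphere_area TYPE('n)"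
    unfolding sphere_area_LINT using hom_int[of "\<lambda>_. 1" 0]
        by (simp add: gauss_expect_one real_polynomial_function.intros(2))
  have "gauss_expect (\<lambda>y. f y * (b \<bullet> y) ^ m) = C * g (k + m) * (LINT \<omega>|sphere_measure. f \<omega> *
      (b \<bullet> \<omega>) ^ m)"
    using f by (intro hom_int real_polynomial_function.intros(4) real_polynomial_function_power
        real_polynomial_function_inner)
      (auto simp: solid_harmonic_def hom power_add power_mult_distrib)
  then have E: "C * g (k + m) * (LINT \<omega>|sphere_measure. f \<omega> * (b \<bullet> \<omega>) ^ m) =
      (if m = k then fact k * f b else 0)"
    unfolding gauss_expect_solid_harmonic[OF f \<open>m \<le> k\<close>] by simp
  show ?thesis
  proof (cases "m = k")
    case True
    have "d \<notin> \<int>\<^sub>\<le>\<^sub>0" using d nonpos_Ints_nonpos by fastforce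
    then have "Gamma (d + real k) = pochhammer d k * Gamma d"
      using pochhammer_Gamma[of d k] Gamma_real_pos[OF d] by simp
    then have G: "g (k + k) = 2 ^ k * pochhammer d k * g 0"
      by (simp add: g_def powr_add powr_realpow add.commute)
    have p: "pochhammer d k > 0" using d by (rule pochhammer_pos)
    define I where "I = (LINT \<omega>|sphere_measure. f \<omega> * (b \<bullet> \<omega>) ^ m)"
    have "C * (2 ^ k * pochhammer d k * g 0) * I = fact k * f b"
      using E True unfolding I_def[symmetric] G[symmetric] by simp
    then have "(C * g 0) * (sphere_area TYPE('n) * fact k * f b) =
        (C * g 0) * ((2 ^ k * pochhammer d k * I) * (C * g 0 * sphere_area TYPE('n)))"
      by (simp add: mult_ac)
    then have "sphere_area TYPE('n) * fact k * f b = 2 ^ k * pochhammer d k * I"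
      using C g[of 0] unfolding A[symmetric] by simp
    then show ?thesis using True p by (simp add: I_def d_def)
  next
    case False
    then show ?thesis using E C g[of "k + m"] by simp
  qed
qed

text \<open>On the sphere \<open>zonal \<delta> l b\<close> is a polynomial in b . \<omega> with
  exponents l - 2 j. Against a solid harmonic of degree k >= l only the exponent k contributes,
  which forces l = k and j = 0. The other order of degrees follows by symmetry.\<close>

lemma sphere_integral_zonal:
  fixes a b :: "real ^ 'n"
  assumes \<delta>: "\<delta> = (real CARD('n) - 2) / 2" and d: "CARD('n) \<ge> 3"
  shows "(LINT \<omega>|sphere_measure. zonal \<delta> k a \<omega> * zonal \<delta> l b \<omega>) =
    (if k = l then sphere_area TYPE('n) * zonal \<delta> k a b else 0)"
proof -
  have \<delta>0: "\<delta> > 0" using \<delta> d by simp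
  have main: "(LINT \<omega>|sphere_measure. zonal \<delta> k a \<omega> * zonal \<delta> l b \<omega>) =
      (if k = l then sphere_area TYPE('n) * zonal \<delta> k a b else 0)" if lk: "l \<le> k" for k l
        and a b :: "real ^ 'n"
  proof -
    define I where "I = (\<lambda>m. LINT \<omega>|sphere_measure. zonal \<delta> k a \<omega> * (b \<bullet> \<omega>) ^ m)"
    define c where "c = (\<lambda>j. (real l + \<delta>) / \<delta> * (zonal_coeff \<delta> l j * (b \<bullet> b) ^ j))"
    have I: "I m = (if m = k then sphere_area TYPE('n) * fact k * zonal \<delta> k a b / (2 ^ k *
        pochhammer (real CARD('n) / 2) k) else 0)"
      if "m \<le> k" for m
      unfolding I_def using that
          by (intro sphere_integral_solid_harmonic solid_harmonic_zonal \<delta> zonal_scaleR)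
    have rp: "real_polynomial_function (\<lambda>\<omega>. c j * (zonal \<delta> k a \<omega> * (b \<bullet> \<omega>) ^ (l - 2 * j)))" for j
      by (intro real_polynomial_function_cmult real_polynomial_function.intros(4)
          real_polynomial_function_zonal real_polynomial_function_power
          real_polynomial_function_inner)
    have "(LINT \<omega>|sphere_measure. zonal \<delta> k a \<omega> * zonal \<delta> l b \<omega>) =
        (LINT \<omega>|sphere_measure. (\<Sum>j\<le>l div 2. c j * (zonal \<delta> k a \<omega> * (b \<bullet> \<omega>) ^ (l - 2 * j))))"
    proof (rule Bochner_Integration.integral_cong_AE)
      show "(\<lambda>\<omega>. zonal \<delta> k a \<omega> * zonal \<delta> l b \<omega>) \<in> borel_measurable sphere_measure"
        using borel_measurable_integrable[OF integrable_sphere_measure_poly[OF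
            real_polynomial_function.intros(4)[OF real_polynomial_function_zonal
            real_polynomial_function_zonal]]] .
      show "(\<lambda>\<omega>. \<Sum>j\<le>l div 2. c j * (zonal \<delta> k a \<omega> * (b \<bullet> \<omega>) ^ (l - 2 * j))) \<in> borel_measurable
          sphere_measure"
        by (intro borel_measurable_integrable integrable_sphere_measure_poly
            real_polynomial_function_sum rp) auto
      show "AE \<omega> in sphere_measure. zonal \<delta> k a \<omega> * zonal \<delta> l b \<omega> =
          (\<Sum>j\<le>l div 2. c j * (zonal \<delta> k a \<omega> * (b \<bullet> \<omega>) ^ (l - 2 * j)))"
        using AE_sphere_measure
      proof eventually_elim
        case (elim \<omega>)
        then have "\<omega> \<bullet> \<omega> = 1" by (simp add: norm_eq_1)
        then have "zonal \<delta> l b \<omega> = (\<Sum>j\<le>l div 2. c j * (b \<bullet> \<omega>) ^ (l - 2 * j))"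
          by (simp add: zonal_def c_def sum_distrib_left mult_ac)
        then show ?case by (simp add: sum_distrib_left mult_ac)
      qed
    qed
    also have "\<dots> = (\<Sum>j\<le>l div 2. c j * I (l - 2 * j))"
      unfolding I_def by (subst Bochner_Integration.integral_sum)
          (rule integrable_sphere_measure_poly[OF rp], simp)
    also have "\<dots> = (if k = l then sphere_area TYPE('n) * zonal \<delta> k a b else 0)"
    proof (cases "k = l")
      case True
      have "(\<Sum>j\<le>l div 2. c j * I (l - 2 * j)) = (\<Sum>j\<in>{0}. c j * I (l - 2 * j))"
        by (rule sum.mono_neutral_right) (auto simp: I True)
      also have "\<dots> = sphere_area TYPE('n) * zonal \<delta> k a b"
      proof -
        have d2: "real CARD('n) / 2 = \<delta> + 1" using \<delta> by (simp add: field_simps)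
        have p: "pochhammer (\<delta> + 1) k > 0" using \<delta>0 by (intro pochhammer_pos) simp
        \<comment> \<open>This identity is the reason for the factor (k + \<delta>) / \<delta> in
          \<open>zonal\<close>: it turns the leading coefficient into one that cancels (d/2)_k, as
          d/2 = \<delta> + 1.\<close>
        have "(real k + \<delta>) * pochhammer \<delta> k = \<delta> * pochhammer (\<delta> + 1) k"
          using pochhammer_rec[of \<delta> k] pochhammer_rec'[of \<delta> k] by (simp add: add.commute)
        then have "(real k + \<delta>) / \<delta> * pochhammer \<delta> k = pochhammer (\<delta> + 1) k"
          using \<delta>0 by (simp add: field_simps)
        moreover have "c 0 = ((real k + \<delta>) / \<delta> * pochhammer \<delta> k) * 2 ^ k / fact k"
          by (simp add: c_def zonal_coeff_def True)
        ultimately have "c 0 = pochhammer (\<delta> + 1) k * 2 ^ k / fact k" by simp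
        then show ?thesis using p by (simp add: I True[symmetric] d2)
      qed
      finally show ?thesis using True by simp
    next
      case False
      then show ?thesis using lk by (auto simp: I intro!: sum.neutral)
    qed
    finally show ?thesis .
  qed
  show ?thesis
  proof (cases "l \<le> k")
    case False
    then show ?thesis using main[of k l b a] by (simp add: mult.commute)
  qed (rule main)
qed

section \<open>The inner products on products of radial and zonal functions\<close>

definition radial :: "real poly \<Rightarrow> 'a::real_inner \<Rightarrow> real" where
  "radial q y = poly q (2 * (y \<bullet> y) - 1)"

lemma polys_upto_radial: "(radial q :: real ^ 'n \<Rightarrow> real) \<in> polys_upto (2 * degree q)"
proof -
  have "(\<lambda>y :: real ^ 'n. coeff q i * (2 * (y \<bullet> y) + - 1) ^ i) \<in> polys_upto (2 * degree q)"
      if "i \<in> {..degree q}" for i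
  proof -
    have "(\<lambda>y :: real ^ 'n. (2 * (y \<bullet> y) + - 1) ^ i) \<in> polys_upto (i * 2)"
      by (intro polys_upto_power polys_upto_add polys_upto_cmult polys_upto_norm2 polys_upto_const)
    then show ?thesis using that by (auto intro!: polys_upto_cmult elim: polys_upto_mono)
  qed
  then have "(\<lambda>y :: real ^ 'n. \<Sum>i\<le>degree q. coeff q i * (2 * (y \<bullet> y) + - 1) ^ i) \<in> polys_upto (2 *
      degree q)"
    by (rule polys_upto_sum)
  then show ?thesis by (simp add: radial_def[abs_def] poly_altdef)
qed

lemma real_polynomial_function_radial: "real_polynomial_function (radial q :: real ^ 'n \<Rightarrow> real)"
  using polys_upto_radial by (rule polys_upto_imp_real_polynomial_function)

lemma pd_radial: "pd v (radial q) y = 4 * (y \<bullet> v) * radial (pderiv q) y" for y :: "real ^ 'n"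
proof -
  have "((\<lambda>y. 2 * (y \<bullet> y) - 1) has_derivative (\<lambda>h. 4 * (y \<bullet> h))) (at y)"
    by (auto intro!: derivative_eq_intros simp: inner_commute)
  moreover have "(poly q has_derivative (\<lambda>h. h * poly (pderiv q) (2 * (y \<bullet> y) - 1))) (at (2 *
      (y \<bullet> y) - 1))"
    using poly_DERIV[of q] by (simp add: has_field_derivative_def mult_commute_abs)
  ultimately have "((\<lambda>y. poly q (2 * (y \<bullet> y) - 1)) has_derivative (\<lambda>h. 4 * (y \<bullet> h) *
      poly (pderiv q) (2 * (y \<bullet> y) - 1))) (at y)"
    by (rule has_derivative_compose)
  from pd_eqI[OF this] show ?thesis by (simp add: radial_def[abs_def])
qed

lemma normal_deriv_radial_mult:
  fixes Y :: "real ^ 'n \<Rightarrow> real"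
  assumes Y: "solid_harmonic k Y" and y: "y \<in> sphere 0 1"
  shows "normal_deriv (\<lambda>y. radial q y * Y y) y = boundary k q * Y y"
proof -
  have rY: "real_polynomial_function Y" using Y by (simp add: solid_harmonic_def)
  have y1: "y \<bullet> y = 1" using y by (simp add: norm_eq_1)
  have "normal_deriv (\<lambda>y. radial q y * Y y) y = radial q y * pd y Y y + pd y (radial q) y * Y y"
    using normal_deriv_eq_pd[OF real_polynomial_function.intros(4)[OF
        real_polynomial_function_radial rY]]
    by (simp add: pd_mult real_polynomial_function_radial rY)
  moreover have "pd y Y y = real k * Y y" using Y by (simp add: solid_harmonic_def)
  ultimately show ?thesis by (simp add: pd_radial y1 radial_def boundary_def algebra_simps)
qed

text \<open>The substitution \<open>t = 2 * s - 1\<close> on \<open>0 \<le> s = |y|\<^sup>2 \<le> 1\<close>.\<close>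

lemma has_bochner_integral_radial:
  assumes "\<mu> > -1" "\<beta> > -1"
  shows "has_bochner_integral lborel
    (\<lambda>s. indicator {0..} s * (indicator {..1} s * (poly p (2 * s - 1) * (1 - s) powr \<mu>) * s powr \<beta>))
    (jacobi_integral \<mu> \<beta> p / 2 powr (\<mu> + \<beta> + 1))"
proof -
  define f where "f = (\<lambda>s :: real. indicator {0..} s * (indicator {..1} s * (poly p (2 * s - 1) *
      (1 - s) powr \<mu>) * s powr \<beta>))"
  have "has_bochner_integral lborel (\<lambda>t. poly p t * jacobi_weight \<mu> \<beta> t) (jacobi_integral \<mu> \<beta> p)"
    using integrable_jacobi_weight[OF assms]
        by (simp add: has_bochner_integral_iff jacobi_integral_def)
  then have "has_bochner_integral lborel (\<lambda>s. poly p (-1 + 2 * s) * jacobi_weight \<mu> \<beta> (-1 + 2 * s))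
      (jacobi_integral \<mu> \<beta> p /\<^sub>R \<bar>2\<bar>)"
    by (subst (asm) lborel_has_bochner_integral_real_affine_iff[where c = 2 and t = "-1"]) simp_all
  then have "has_bochner_integral lborel (\<lambda>s. (1 / 2 powr (\<mu> + \<beta>)) * (poly p (-1 + 2 * s) *
      jacobi_weight \<mu> \<beta> (-1 + 2 * s)))
      ((1 / 2 powr (\<mu> + \<beta>)) * (jacobi_integral \<mu> \<beta> p /\<^sub>R \<bar>2\<bar>))"
    by (rule has_bochner_integral_mult_right)
  also have "(\<lambda>s. (1 / 2 powr (\<mu> + \<beta>)) * (poly p (-1 + 2 * s) * jacobi_weight \<mu> \<beta> (-1 + 2 * s))) =
      f"
  proof
    fix s :: real
    show "(1 / 2 powr (\<mu> + \<beta>)) * (poly p (-1 + 2 * s) * jacobi_weight \<mu> \<beta> (-1 + 2 * s)) = f s"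
    proof (cases "s \<in> {0..1}")
      case True
      have "(1 - (-1 + 2 * s)) powr \<mu> = 2 powr \<mu> * (1 - s) powr \<mu>"
        using powr_mult[of 2 "1 - s" \<mu>] True by (simp add: algebra_simps)
      moreover have "(1 + (-1 + 2 * s)) powr \<beta> = 2 powr \<beta> * s powr \<beta>"
        using powr_mult[of 2 s \<beta>] True by simp
      moreover have "-1 + 2 * s = 2 * s - 1" by simp
      ultimately show ?thesis using True by (simp add: f_def jacobi_weight_def powr_add)
    qed (auto simp: f_def jacobi_weight_def)
  qed
  also have "(1 / 2 powr (\<mu> + \<beta>)) * (jacobi_integral \<mu> \<beta> p /\<^sub>R \<bar>2\<bar>) =
      jacobi_integral \<mu> \<beta> p / 2 powr (\<mu> + \<beta> + 1)"
    by (simp add: powr_add)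
  finally show ?thesis unfolding f_def .
qed

text \<open>In s = r^2 the degree of \<open>H\<close> shifts the exponent d/2 - 1 to
  \<open>\<beta>\<close>. The power of 2 collects \<open>\<mu> + \<beta> + 1\<close> from t = 2 s -
  1 and one more factor from the half in the radial measure.\<close>

lemma ball_integral_radial_homogeneous:
  fixes H :: "real ^ 'n \<Rightarrow> real"
  assumes \<mu>: "\<mu> > -1" and H: "real_polynomial_function H" and hom: "\<And>c y. H (c *\<^sub>R y) = c ^ m * H y"
    and \<beta>: "\<beta> = (real m + real CARD('n)) / 2 - 1"
  shows "set_integrable lborel (cball 0 1) (\<lambda>y. radial p y * H y * ball_weight \<mu> y)"
    and "(LINT y:cball 0 1|lborel. radial p y * H y * ball_weight \<mu> y) =
      jacobi_integral \<mu> \<beta> p / 2 powr (\<mu> + \<beta> + 2) * (LINT \<omega>|sphere_measure. H \<omega>)"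
proof -
  have \<beta>1: "\<beta> > -1" unfolding \<beta> by (simp add: add_nonneg_pos)
  define \<phi> where "\<phi> = (\<lambda>s. indicator {..1} s * (poly p (2 * s - 1) * (1 - s) powr \<mu>) *
      s powr (real m / 2))"
  have "\<phi> s * s powr (real DIM(real ^ 'n) / 2 - 1) = indicator {..1} s * (poly p (2 * s - 1) *
      (1 - s) powr \<mu>) * s powr \<beta>" for s
    unfolding \<phi>_def \<beta> by (simp add: add_divide_distrib powr_add[symmetric] flip: add_diff_eq)
  then have R: "has_bochner_integral lborel (\<lambda>s. indicator {0..} s *
      (\<phi> s * s powr (real DIM(real ^ 'n) / 2 - 1)))
      (jacobi_integral \<mu> \<beta> p / 2 powr (\<mu> + \<beta> + 1))"
    using has_bochner_integral_radial[OF \<mu> \<beta>1, of p] by simp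
  have [measurable]: "poly p \<in> borel_measurable borel"
    by (intro borel_measurable_continuous_onI continuous_intros)
  have [measurable]: "\<phi> \<in> borel_measurable borel" unfolding \<phi>_def by measurable
  have [measurable]: "H \<in> borel_measurable borel"
      by (rule borel_measurable_real_polynomial_function[OF H])
  have I: "integrable lborel (\<lambda>s. indicator {0..} s * (\<phi> s * s powr (real DIM(real ^ 'n) / 2 - 1)))"
    and V: "(LINT s|lborel. indicator {0..} s * (\<phi> s * s powr (real DIM(real ^ 'n) / 2 - 1))) =
        jacobi_integral \<mu> \<beta> p / 2 powr (\<mu> + \<beta> + 1)"
    using R by (simp_all add: has_bochner_integral_iff)
  have \<phi>m: "\<phi> \<in> borel_measurable borel" by measurable
  note P = polar_integral[OF I \<phi>m integrable_sphere_measure_poly[OF H]]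
  have mf: "(\<lambda>y. indicator (cball 0 1) y *\<^sub>R (radial p y * H y *
      ball_weight \<mu> y)) \<in> borel_measurable lborel"
  proof -
    have "(\<lambda>y. radial p y * H y * ball_weight \<mu> y) \<in> borel_measurable borel"
      unfolding radial_def ball_weight_def by measurable
    then show ?thesis by (intro borel_measurable_scaleR borel_measurable_indicator) simp_all
  qed
  have mg: "(\<lambda>y. \<phi> ((norm y)\<^sup>2) * H (y /\<^sub>R norm y)) \<in> borel_measurable lborel" by measurable
  have "AE y :: real ^ 'n in lborel. y \<noteq> 0" by (rule AE_lborel_singleton)
  then have ae: "AE y in lborel. indicator (cball 0 1) y *\<^sub>R (radial p y * H y * ball_weight \<mu> y) =
      \<phi> ((norm y)\<^sup>2) * H (y /\<^sub>R norm y)"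
  proof eventually_elim
    case (elim y)
    have "H y = norm y ^ m * H (y /\<^sub>R norm y)" using hom[of "norm y" "y /\<^sub>R norm y"] elim by simp
    moreover have "((norm y)\<^sup>2) powr (real m / 2) = norm y ^ m"
      using elim by (simp add: powr_realpow powr_powr flip: powr_numeral)
    moreover have "norm y \<le> 1 \<longleftrightarrow> (norm y)\<^sup>2 \<le> 1" by (simp add: abs_square_le_1)
    ultimately show ?case
      by (simp add: radial_def ball_weight_def \<phi>_def power2_norm_eq_inner[symmetric] indicator_def)
  qed
  show "set_integrable lborel (cball 0 1) (\<lambda>y. radial p y * H y * ball_weight \<mu> y)"
    unfolding set_integrable_def using integrable_cong_AE[OF mf mg ae] P(1) by simp
  show "(LINT y:cball 0 1|lborel. radial p y * H y * ball_weight \<mu> y) =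
      jacobi_integral \<mu> \<beta> p / 2 powr (\<mu> + \<beta> + 2) * (LINT \<omega>|sphere_measure. H \<omega>)"
    unfolding set_lebesgue_integral_def using integral_cong_AE[OF mf mg ae] P(2) V
        by (simp add: powr_add)
qed

text \<open>Additivity of the ball integral rests on this, as the weight blows up at the sphere for
  \<open>\<mu> < 0\<close>. A polynomial is bounded on the ball, and the weight itself is the case
  of constant factors above.\<close>

lemma set_integrable_ball_weight_poly:
  fixes f :: "real ^ 'n \<Rightarrow> real"
  assumes \<mu>: "\<mu> > -1" and f: "real_polynomial_function f"
  shows "set_integrable lborel (cball 0 1) (\<lambda>y. f y * ball_weight \<mu> y)"
proof -
  have w: "set_integrable lborel (cball 0 1) (\<lambda>y :: real ^ 'n. ball_weight \<mu> y)"
    using ball_integral_radial_homogeneous(1)[OF \<mu>, of "\<lambda>_. 1" 0 _ 1]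
        by (simp add: radial_def real_polynomial_function.intros(2))
  have "compact (f ` cball 0 1)"
    by (intro compact_continuous_image continuous_on_real_polynomial_function f) auto
  then obtain K where K: "\<And>y. y \<in> cball 0 1 \<Longrightarrow> norm (f y) \<le> K"
    by (meson bounded_iff compact_imp_bounded imageI)
  have [measurable]: "f \<in> borel_measurable borel"
      by (rule borel_measurable_real_polynomial_function[OF f])
  show ?thesis
    unfolding set_integrable_def
  proof (rule Bochner_Integration.integrable_bound)
    show "integrable lborel (\<lambda>y :: real ^ 'n. K * (indicator (cball 0 1) y *\<^sub>R ball_weight \<mu> y))"
      using w unfolding set_integrable_def by simp
    show "(\<lambda>y. indicator (cball 0 1) y *\<^sub>R (f y * ball_weight \<mu> y)) \<in> borel_measurable lborel"
    proof -
      have "(\<lambda>y. f y * ball_weight \<mu> y) \<in> borel_measurable borel"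
        unfolding ball_weight_def by measurable
      then show ?thesis by (intro borel_measurable_scaleR borel_measurable_indicator) simp_all
    qed
    show "AE y in lborel. norm (indicator (cball 0 1) y *\<^sub>R (f y * ball_weight \<mu> y)) \<le>
        norm (K * (indicator (cball 0 1) y *\<^sub>R ball_weight \<mu> y))"
    proof (rule AE_I2)
      fix y :: "real ^ 'n"
      show "norm (indicator (cball 0 1) y *\<^sub>R (f y * ball_weight \<mu> y)) \<le>
          norm (K * (indicator (cball 0 1) y *\<^sub>R ball_weight \<mu> y))"
      proof (cases "y \<in> cball 0 1")
        case True
        then have "\<bar>f y\<bar> \<le> \<bar>K\<bar>" using K[OF True] by simp
        then show ?thesis using True by (simp add: abs_mult mult_right_mono)
      qed auto
    qed
  qed
qed

section \<open>Bilinearity of the Sobolev product on polynomials\<close>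

lemma ball_sobolev_inner_commute: "ball_sobolev_inner \<mu> lam f g = ball_sobolev_inner \<mu> lam g f"
  by (simp add: ball_sobolev_inner_def ball_inner_def mult.commute)

lemma ball_sobolev_inner_poly:
  fixes f g :: "real ^ 'n \<Rightarrow> real"
  assumes "real_polynomial_function f" "real_polynomial_function g"
  shows "ball_sobolev_inner \<mu> lam f g =
    (LINT x:cball 0 1|lborel. (f x * g x) * ball_weight \<mu> x) / ball_mass TYPE('n) \<mu> +
    lam / sphere_area TYPE('n) * (LINT x|sphere_measure. normal_deriv f x * normal_deriv g x)"
    and "integrable sphere_measure (\<lambda>x. normal_deriv f x * normal_deriv g x)"
proof -
  have "normal_deriv f = (\<lambda>x. \<Sum>i\<in>UNIV. x $ i * pd (axis i 1) f x)" if "real_polynomial_function f"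
      for f :: "real ^ 'n \<Rightarrow> real"
    unfolding normal_deriv_def[abs_def] partial_deriv_eq_pd[OF that] ..
  moreover have "real_polynomial_function (\<lambda>x. \<Sum>i\<in>UNIV. x $ i * pd (axis i 1) f x)"
      if "real_polynomial_function f" for f :: "real ^ 'n \<Rightarrow> real"
    by (rule real_polynomial_function_sum)
      (simp, rule real_polynomial_function.intros(4)[OF real_polynomial_function_component
        real_polynomial_function_pd[OF that]])
  ultimately have r: "real_polynomial_function (normal_deriv f)" if "real_polynomial_function f"
      for f :: "real ^ 'n \<Rightarrow> real"
    using that by simp
  have rr: "real_polynomial_function (\<lambda>x. normal_deriv f x * normal_deriv g x)"
    by (intro real_polynomial_function.intros(4) r assms)
  show "integrable sphere_measure (\<lambda>x. normal_deriv f x * normal_deriv g x)"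
    by (rule integrable_sphere_measure_poly[OF rr])
  show "ball_sobolev_inner \<mu> lam f g =
    (LINT x:cball 0 1|lborel. (f x * g x) * ball_weight \<mu> x) / ball_mass TYPE('n) \<mu> +
    lam / sphere_area TYPE('n) * (LINT x|sphere_measure. normal_deriv f x * normal_deriv g x)"
    unfolding ball_sobolev_inner_def ball_inner_def
        LINT_sphere[OF borel_measurable_real_polynomial_function[OF rr]] ..
qed

lemma ball_sobolev_inner_add_left:
  fixes f g h :: "real ^ 'n \<Rightarrow> real"
  assumes \<mu>: "\<mu> > -1" and f: "real_polynomial_function f" and g: "real_polynomial_function g"
      and h: "real_polynomial_function h"
  shows "ball_sobolev_inner \<mu> lam (\<lambda>x. f x + g x) h = ball_sobolev_inner \<mu> lam f h +
      ball_sobolev_inner \<mu> lam g h"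
proof -
  have fg: "real_polynomial_function (\<lambda>x. f x + g x)"
      by (rule real_polynomial_function.intros(3)[OF f g])
  have "normal_deriv (\<lambda>x. f x + g x) = (\<lambda>x. normal_deriv f x + normal_deriv g x)"
    by (rule ext) (simp add: normal_deriv_eq_pd fg f g pd_add)
  then have "(LINT x|sphere_measure. normal_deriv (\<lambda>x. f x + g x) x * normal_deriv h x) =
      (LINT x|sphere_measure. normal_deriv f x * normal_deriv h x) +
        (LINT x|sphere_measure. normal_deriv g x * normal_deriv h x)"
    using ball_sobolev_inner_poly(2)[OF f h] ball_sobolev_inner_poly(2)[OF g h]
        by (simp add: distrib_right)
  moreover have "(LINT x:cball 0 1|lborel. ((f x + g x) * h x) * ball_weight \<mu> x) =
      (LINT x:cball 0 1|lborel. (f x * h x) * ball_weight \<mu> x) + (LINT x:cball 0 1|lborel. (g x *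
        h x) * ball_weight \<mu> x)"
    unfolding distrib_right
    by (intro set_integral_add(2) set_integrable_ball_weight_poly \<mu>
        real_polynomial_function.intros(4) f g h)
  ultimately show ?thesis
    unfolding ball_sobolev_inner_poly(1)[OF fg h] ball_sobolev_inner_poly(1)[OF f h]
        ball_sobolev_inner_poly(1)[OF g h]
    by (simp add: add_divide_distrib distrib_left)
qed

lemma ball_sobolev_inner_cmult_left:
  fixes f h :: "real ^ 'n \<Rightarrow> real"
  assumes f: "real_polynomial_function f" and h: "real_polynomial_function h"
  shows "ball_sobolev_inner \<mu> lam (\<lambda>x. c * f x) h = c * ball_sobolev_inner \<mu> lam f h"
proof -
  have cf: "real_polynomial_function (\<lambda>x. c * f x)" by (rule real_polynomial_function_cmult[OF f])
  have "normal_deriv (\<lambda>x. c * f x) = (\<lambda>x. c * normal_deriv f x)"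
    by (rule ext) (simp add: normal_deriv_eq_pd cf f pd_cmult)
  then show ?thesis
    unfolding ball_sobolev_inner_poly(1)[OF cf h] ball_sobolev_inner_poly(1)[OF f h]
    by (simp add: mult.assoc distrib_left)
qed

lemma ball_sobolev_inner_sum_left:
  fixes f :: "'i \<Rightarrow> real ^ 'n \<Rightarrow> real"
  assumes \<mu>: "\<mu> > -1" and f: "\<And>i. i \<in> A \<Longrightarrow> real_polynomial_function (f i)"
      and h: "real_polynomial_function h" and A: "finite A"
  shows "ball_sobolev_inner \<mu> lam (\<lambda>x. \<Sum>i\<in>A. f i x) h = (\<Sum>i\<in>A. ball_sobolev_inner \<mu> lam (f i) h)"
  using A f
proof (induction A rule: finite_induct)
  case empty
  show ?case using ball_sobolev_inner_cmult_left[OF h h, of _ _ 0] by simp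
next
  case (insert a A)
  have "real_polynomial_function (\<lambda>x. \<Sum>i\<in>A. f i x)"
    using insert by (intro real_polynomial_function_sum) auto
  then show ?case using insert h by (simp add: ball_sobolev_inner_add_left[OF \<mu>])
qed

section \<open>Reproducing kernels\<close>

text \<open>Expanding the candidate in \<open>B\<close> and reproducing a basis element gives p x =
  c x p * ip p p. Nonvanishing of \<open>ip p p\<close> is a consequence: otherwise \<open>p\<close>
  would be identically zero, against independence.\<close>

lemma basis_kernel_eqI:
  assumes B: "orthogonal_poly_basis ip n B"
    and G: "\<And>x. G x \<in> polys_upto n"
    and reproducing: "\<And>f x. f \<in> polys_upto n \<Longrightarrow> ip f (G x) = f x"
    and linear: "\<And>f c. f \<in> B \<Longrightarrow> ip f (\<lambda>x. \<Sum>q\<in>B. c q * q x) = (\<Sum>q\<in>B. c q * ip f q)"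
  shows "basis_kernel ip B x y = G x y"
proof -
  have fin: "finite B" and sub: "B \<subseteq> polys_upto n"
    and span: "\<And>f. f \<in> polys_upto n \<Longrightarrow> \<exists>c. \<forall>x. f x = (\<Sum>p\<in>B. c p * p x)"
    and indep: "\<And>c. (\<forall>x. (\<Sum>p\<in>B. c p * p x) = 0) \<Longrightarrow> \<forall>p\<in>B. c p = 0"
    and orth: "\<And>p q. p \<in> B \<Longrightarrow> q \<in> B \<Longrightarrow> p \<noteq> q \<Longrightarrow> ip p q = 0"
    using B by (auto simp: orthogonal_poly_basis_def)
  have "\<exists>c. \<forall>x y. G x y = (\<Sum>p\<in>B. c x p * p y)"
    using span[OF G] by metis
  then obtain c where c: "\<And>x y. G x y = (\<Sum>p\<in>B. c x p * p y)" by blast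
  have val: "p x = c x p * ip p p" if p: "p \<in> B" for p x
  proof -
    have "G x = (\<lambda>y. \<Sum>p\<in>B. c x p * p y)" using c by auto
    then have "p x = (\<Sum>q\<in>B. c x q * ip p q)"
      using reproducing[of p x] linear[OF p] sub p by auto
    also have "\<dots> = (\<Sum>q\<in>{p}. c x q * ip p q)"
      using p fin orth by (intro sum.mono_neutral_right) auto
    finally show ?thesis by simp
  qed
  have nz: "ip p p \<noteq> 0" if p: "p \<in> B" for p
  proof
    assume "ip p p = 0"
    then have z: "p x = 0" for x using val[OF p, of x] by simp
    have "(\<Sum>q\<in>B. (if q = p then 1 else 0) * q x) = (\<Sum>q\<in>{p}. q x)" for x
      using p fin by (intro sum.mono_neutral_cong_right) auto
    then have "\<forall>q\<in>B. (if q = p then 1 else 0 :: real) = 0"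
      using z by (intro indep) simp
    then show False using p by auto
  qed
  have "c x p = p x / ip p p" if "p \<in> B" for p
    using val[OF that, of x] nz[OF that] by (simp add: field_simps)
  then show ?thesis unfolding basis_kernel_def c by (intro sum.cong) auto
qed

text \<open>Polarization: the coefficient of \<open>t\<close> in \<open>((a + t v) \<bullet> x) ^ (k + 1)\<close> splits off a linear factor
    \<open>v \<bullet> x\<close>.\<close>

lemma linear_functional_prod_list_zero:
  fixes \<Phi> :: "(real ^ 'n \<Rightarrow> real) \<Rightarrow> real"
  assumes add: "\<And>f g. \<lbrakk>real_polynomial_function f; real_polynomial_function g\<rbrakk> \<Longrightarrow> \<Phi> (\<lambda>x. f x + g x) =
      \<Phi> f + \<Phi> g"
    and cmult: "\<And>f c. real_polynomial_function f \<Longrightarrow> \<Phi> (\<lambda>x. c * f x) = c * \<Phi> f"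
    and pow: "\<And>a k. k \<le> n \<Longrightarrow> \<Phi> (\<lambda>x. (a \<bullet> x) ^ k) = 0"
    and "k + length vs \<le> n"
  shows "\<Phi> (\<lambda>x. (a \<bullet> x) ^ k * (\<Prod>v\<leftarrow>vs. v \<bullet> x)) = 0"
  using assms(4)
proof (induction vs arbitrary: a k)
  case Nil
  then show ?case using pow by simp
next
  case (Cons v vs)
  have rp: "real_polynomial_function (\<lambda>x :: real ^ 'n. \<Prod>v\<leftarrow>vs. v \<bullet> x)" for vs
    by (induction vs) (auto intro: real_polynomial_function.intros real_polynomial_function_inner)
  define T where "T = (\<lambda>i (x :: real ^ 'n). ((v \<bullet> x) ^ i * (a \<bullet> x) ^ (Suc k - i)) * (\<Prod>v\<leftarrow>vs. v \<bullet> x))"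
  have rT: "real_polynomial_function (T i)" for i
    unfolding T_def by (intro real_polynomial_function.intros(4) real_polynomial_function_power
        real_polynomial_function_inner rp)
  have z: "\<Phi> (\<lambda>x. 0) = 0" using cmult[of "\<lambda>x. 0" 0]
      by (simp add: real_polynomial_function.intros(2))
  have sum: "\<Phi> (\<lambda>x. \<Sum>i\<in>I. c i * T i x) = (\<Sum>i\<in>I. c i * \<Phi> (T i))" if "finite I" for I c
    using that
  proof (induction I rule: finite_induct)
    case (insert i I)
    have "real_polynomial_function (\<lambda>x. \<Sum>i\<in>I. c i * T i x)"
      using insert by (intro real_polynomial_function_sum real_polynomial_function_cmult rT)
    then show ?case using insert by (simp add: add cmult rT real_polynomial_function_cmult)
  qed (simp add: z)
  \<comment> \<open>For each \<open>t\<close> this is the functional on a product with one linear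
    factor fewer and one more power, zero by induction. As a polynomial in \<open>t\<close> it has
    zero coefficients, and the one of t^1 is k + 1 times the wanted value.\<close>
  have "(\<Sum>i\<le>Suc k. (real (Suc k choose i) * \<Phi> (T i)) * t ^ i) = 0" for t
  proof -
    have "((a + t *\<^sub>R v) \<bullet> x) ^ Suc k * (\<Prod>v\<leftarrow>vs. v \<bullet> x) =
        (\<Sum>i\<le>Suc k. (real (Suc k choose i) * t ^ i) * T i x)" for x
    proof -
      have "((a + t *\<^sub>R v) \<bullet> x) ^ Suc k = (t * (v \<bullet> x) + a \<bullet> x) ^ Suc k"
        by (simp add: inner_add_left add.commute)
      also have "\<dots> = (\<Sum>i\<le>Suc k. real (Suc k choose i) * (t * (v \<bullet> x)) ^ i * (a \<bullet> x) ^ (Suc k - i))"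
        by (rule binomial_ring)
      finally have E: "((a + t *\<^sub>R v) \<bullet> x) ^ Suc k =
        (\<Sum>i\<le>Suc k. real (Suc k choose i) * (t * (v \<bullet> x)) ^ i * (a \<bullet> x) ^ (Suc k - i))" .
      show ?thesis
        unfolding E T_def sum_distrib_right
            by (rule sum.cong) (simp_all only: power_mult_distrib mult_ac)
    qed
    then have "0 = \<Phi> (\<lambda>x. \<Sum>i\<le>Suc k. (real (Suc k choose i) * t ^ i) * T i x)"
      using Cons.IH[of "Suc k" "a + t *\<^sub>R v"] Cons.prems by simp
    also have "\<dots> = (\<Sum>i\<le>Suc k. (real (Suc k choose i) * t ^ i) * \<Phi> (T i))"
      by (rule sum) simp
    finally show ?thesis by (simp only: mult_ac)
  qed
  then have "\<forall>i\<le>Suc k. real (Suc k choose i) * \<Phi> (T i) = 0"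
    using polyfun_eq_0[of "\<lambda>i. real (Suc k choose i) * \<Phi> (T i)" "Suc k"] by blast
  then have "real (Suc k choose 1) * \<Phi> (T 1) = 0" by (rule allE[of _ 1]) simp
  then have "\<Phi> (T 1) = 0" by simp
  then show ?case by (simp add: T_def mult_ac)
qed

text \<open>A monomial is a product of coordinate forms, listed with multiplicity in
  \<open>vs\<close>, to which polarization applies with an empty power in front.\<close>

lemma linear_functional_polys_upto_zero:
  fixes \<Phi> :: "(real ^ 'n \<Rightarrow> real) \<Rightarrow> real"
  assumes add: "\<And>f g. \<lbrakk>real_polynomial_function f; real_polynomial_function g\<rbrakk> \<Longrightarrow> \<Phi> (\<lambda>x. f x + g x) =
      \<Phi> f + \<Phi> g"
    and cmult: "\<And>f c. real_polynomial_function f \<Longrightarrow> \<Phi> (\<lambda>x. c * f x) = c * \<Phi> f"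
    and pow: "\<And>a k. k \<le> n \<Longrightarrow> \<Phi> (\<lambda>x. (a \<bullet> x) ^ k) = 0"
    and f: "f \<in> polys_upto n"
  shows "\<Phi> f = 0"
  using f
proof (induction rule: polys_upto_induct)
  case zero
  show ?case using cmult[of "\<lambda>x. 0" 0] by (simp add: real_polynomial_function.intros(2))
next
  case (add f g)
  then show ?case using assms(1) by (simp add: polys_upto_imp_real_polynomial_function)
next
  case (monomial c \<alpha>)
  obtain xs where xs: "distinct xs" "set xs = (UNIV :: 'n set)"
      using finite_distinct_list[of "UNIV :: 'n set"] by auto
  define vs :: "(real ^ 'n) list" where "vs = concat (map (\<lambda>i. replicate (\<alpha> i) (axis i 1)) xs)"
  have len: "length vs = (\<Sum>i\<in>UNIV. \<alpha> i)"
    unfolding vs_def by (simp add: length_concat comp_def xs(2)[symmetric]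
        sum.distinct_set_conv_list[OF xs(1)])
  have prod: "(\<Prod>v\<leftarrow>vs. v \<bullet> x) = monomial \<alpha> x" for x
  proof -
    have "(\<Prod>v\<leftarrow>concat (map (\<lambda>i. replicate (\<alpha> i) (axis i 1)) ys). v \<bullet> x) = (\<Prod>i\<leftarrow>ys. (x $ i) ^ \<alpha> i)"
        for ys
      by (induction ys) (simp_all add: inner_axis' prod_list_replicate)
    then show ?thesis
      unfolding vs_def monomial_def xs(2)[symmetric] prod.distinct_set_conv_list[OF xs(1)] by simp
  qed
  have "0 + length vs \<le> n" using monomial len by simp
  from linear_functional_prod_list_zero[of \<Phi> n 0 vs 0, OF assms(1) cmult pow this]
  have "\<Phi> (monomial \<alpha>) = 0" unfolding prod power_0 mult_1_left .
  then show ?case by (simp add: cmult real_polynomial_function_monomial)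
qed

section \<open>Normalizing constants and orthogonality of the zonal terms\<close>

lemma sphere_area_pos: "sphere_area TYPE('n::finite) > 0"
  unfolding sphere_area_eq by (intro divide_pos_pos mult_pos_pos Gamma_real_pos) auto

lemma ball_mass_pos:
  assumes \<mu>: "\<mu> > -1"
  shows "ball_mass TYPE('n::finite) \<mu> > 0"
proof -
  define \<beta> where "\<beta> = (real 0 + real CARD('n)) / 2 - 1"
  have \<beta>: "\<beta> > -1" by (simp add: \<beta>_def)
  have "ball_mass TYPE('n) \<mu> = jacobi_integral \<mu> \<beta> 1 / 2 powr (\<mu> + \<beta> + 2) * sphere_area TYPE('n)"
    using ball_integral_radial_homogeneous(2)[OF \<mu>, of "\<lambda>_ :: real ^ 'n. 1" 0 \<beta> 1] \<beta>_def
    by (simp add: radial_def real_polynomial_function.intros(2) ball_mass_def sphere_area_LINT)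
  moreover have "jacobi_integral \<mu> \<beta> 1 > 0"
    using jacobi_integral_powers[OF \<mu> \<beta>, of 0 0] \<mu> \<beta> by (simp add: Gamma_real_pos)
  ultimately show ?thesis using sphere_area_pos[where 'n = 'n] by simp
qed

text \<open>Ball and boundary part contain the same sphere integral, so different degrees are
  orthogonal. For equal degrees the ball part keeps the factor \<sigma>_d / (2^(\<mu>+k+\<delta>+2)
  \<omega>_\<mu>) = 1 / (2^k C), which dictates \<open>C\<close>; in the boundary part the area
  cancels.\<close>

lemma ball_sobolev_inner_zonal:
  fixes a b :: "real ^ 'n"
  assumes \<mu>: "\<mu> > -1" and \<delta>: "\<delta> = (real CARD('n) - 2) / 2" and d: "CARD('n) \<ge> 3"
    and C: "C = 2 powr (\<delta> + \<mu> + 2) * ball_mass TYPE('n) \<mu> / sphere_area TYPE('n)"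
  shows "ball_sobolev_inner \<mu> lam (\<lambda>y. radial q y * zonal \<delta> k a y) (\<lambda>y. radial p y *
      zonal \<delta> l b y) =
    (if k = l then (jacobi_integral \<mu> (real k + \<delta>) (q * p) / (2 ^ k * C) + lam * boundary k q *
      boundary k p) * zonal \<delta> k a b else 0)"
proof -
  note rz = real_polynomial_function_zonal and rr = real_polynomial_function_radial
      and rm = real_polynomial_function.intros(4)
  define H where "H = (\<lambda>y. zonal \<delta> k a y * zonal \<delta> l b y)"
  have rH: "real_polynomial_function H" unfolding H_def by (rule rm[OF rz rz])
  have S: "(LINT \<omega>|sphere_measure. H \<omega>) =
      (if k = l then sphere_area TYPE('n) * zonal \<delta> k a b else 0)"
    unfolding H_def by (rule sphere_integral_zonal[OF \<delta> d])
  have area: "sphere_area TYPE('n) > 0" by (rule sphere_area_pos)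
  \<comment> \<open>Taken from the total degree \<open>k + l\<close>, so that the ball integral is
    available for unequal degrees too; for \<open>k = l\<close> it is
    \<open>k + \<delta>\<close>.\<close>
  define \<beta> where "\<beta> = (real (k + l) + real CARD('n)) / 2 - 1"
  have hom: "H (c *\<^sub>R y) = c ^ (k + l) * H y" for c y
    by (simp add: H_def zonal_scaleR power_add)
  have "(LINT y:cball 0 1|lborel. ((radial q y * zonal \<delta> k a y) * (radial p y * zonal \<delta> l b y)) *
      ball_weight \<mu> y) =
      (LINT y:cball 0 1|lborel. radial (q * p) y * H y * ball_weight \<mu> y)"
    by (simp add: radial_def H_def mult_ac)
  also have "\<dots> = jacobi_integral \<mu> \<beta> (q * p) / 2 powr (\<mu> + \<beta> + 2) * (LINT \<omega>|sphere_measure. H \<omega>)"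
    by (rule ball_integral_radial_homogeneous(2)[OF \<mu> rH hom \<beta>_def])
  finally have ball: "(LINT y:cball 0 1|lborel. ((radial q y * zonal \<delta> k a y) *
      (radial p y * zonal \<delta> l b y)) * ball_weight \<mu> y) =
      jacobi_integral \<mu> \<beta> (q * p) / 2 powr (\<mu> + \<beta> + 2) * (LINT \<omega>|sphere_measure. H \<omega>)" .
  have "(LINT y|sphere_measure. normal_deriv (\<lambda>y. radial q y * zonal \<delta> k a y) y *
      normal_deriv (\<lambda>y. radial p y * zonal \<delta> l b y) y) =
      (LINT y|sphere_measure. (boundary k q * boundary l p) * H y)"
  proof (rule Bochner_Integration.integral_cong_AE)
    show "(\<lambda>y. normal_deriv (\<lambda>y. radial q y * zonal \<delta> k a y) y * normal_deriv (\<lambda>y. radial p y *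
        zonal \<delta> l b y) y) \<in> borel_measurable sphere_measure"
      by (intro borel_measurable_integrable ball_sobolev_inner_poly(2) rm rr rz)
    show "(\<lambda>y. (boundary k q * boundary l p) * H y) \<in> borel_measurable sphere_measure"
      by (intro borel_measurable_integrable integrable_sphere_measure_poly
          real_polynomial_function_cmult rH)
    show "AE y in sphere_measure. normal_deriv (\<lambda>y. radial q y * zonal \<delta> k a y) y *
        normal_deriv (\<lambda>y. radial p y * zonal \<delta> l b y) y =
        (boundary k q * boundary l p) * H y"
      using AE_sphere_measure
    proof eventually_elim
      case (elim y)
      show ?case
        unfolding normal_deriv_radial_mult[OF solid_harmonic_zonal[OF \<delta>] elim] H_def by simp
    qed
  qed
  also have "\<dots> = boundary k q * boundary l p * (LINT \<omega>|sphere_measure. H \<omega>)" by simp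
  finally have sphere: "(LINT y|sphere_measure. normal_deriv (\<lambda>y. radial q y * zonal \<delta> k a y) y *
      normal_deriv (\<lambda>y. radial p y * zonal \<delta> l b y) y) =
      boundary k q * boundary l p * (LINT \<omega>|sphere_measure. H \<omega>)" .
  show ?thesis
  proof (cases "k = l")
    case True
    then have \<beta>: "\<beta> = real k + \<delta>" by (simp add: \<beta>_def \<delta> field_simps)
    have "2 powr (\<mu> + \<beta> + 2) = 2 ^ k * 2 powr (\<delta> + \<mu> + 2)"
      unfolding \<beta> by (simp add: powr_add powr_realpow mult_ac)
    then show ?thesis
      unfolding ball_sobolev_inner_poly(1)[OF rm[OF rr rz] rm[OF rr rz]] ball sphere S
      using True area unfolding \<beta> C by (simp add: field_simps)
  next
    case False
    then show ?thesis
      unfolding ball_sobolev_inner_poly(1)[OF rm[OF rr rz] rm[OF rr rz]] ball sphere S by simp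
  qed
qed

text \<open>The factor \<open>2 ^ k * C\<close> undoes the normalization of the ball part and turns
  \<lambda> into the mass 2^k A with A = \<lambda> C. A radial factor of degree m has degree 2 m in
  y, so \<open>(n - k) div 2\<close> is the largest degree that fits beside a zonal factor of degree
  \<open>k\<close>.\<close>

definition sobolev_kernel ::
  "real \<Rightarrow> real \<Rightarrow> real \<Rightarrow> real \<Rightarrow> nat \<Rightarrow> 'a::real_inner \<Rightarrow> 'a \<Rightarrow> real" where
  "sobolev_kernel \<mu> \<delta> C A n x y = (\<Sum>k\<le>n. (2 ^ k * C) *
    (radial (perturbed_kernel \<mu> (real k + \<delta>) ((n - k) div 2) k (2 ^ k * A) (2 * (x \<bullet> x) - 1)) y *
      zonal \<delta> k x y))"

context
  fixes \<mu> lam \<delta> C :: real and n :: nat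
  assumes \<mu>: "\<mu> > -1" and lam: "lam \<ge> 0" and \<delta>: "\<delta> = (real CARD('n) - 2) / 2" and d: "CARD('n) \<ge> 3"
    and C: "C = 2 powr (\<delta> + \<mu> + 2) * ball_mass TYPE('n::finite) \<mu> / sphere_area TYPE('n)"
begin

lemma \<delta>_pos: "\<delta> > 0"
  using \<delta> d by simp

lemma C_pos: "C > 0"
  unfolding C using sphere_area_pos[where 'n = 'n] ball_mass_pos[OF \<mu>, where 'n = 'n] by simp

lemma sobolev_kernel_polys_upto: "sobolev_kernel \<mu> \<delta> C A n (x :: real ^ 'n) \<in> polys_upto n"
  unfolding sobolev_kernel_def[abs_def]
proof (intro polys_upto_sum polys_upto_cmult)
  fix k assume "k \<in> {..n}"
  define P where "P = perturbed_kernel \<mu> (real k + \<delta>) ((n - k) div 2) k (2 ^ k * A) (2 *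
      (x \<bullet> x) - 1)"
  have "degree P \<le> (n - k) div 2"
    unfolding P_def using \<mu> \<delta>_pos by (intro degree_perturbed_kernel) auto
  then have "2 * degree P + k \<le> n" using \<open>k \<in> {..n}\<close> by auto
  then show "(\<lambda>y. radial P y * zonal \<delta> k x y) \<in> polys_upto n"
    by (rule polys_upto_mono[OF polys_upto_mult[OF polys_upto_radial polys_upto_zonal]])
qed

text \<open>Orthogonality leaves the summand of degree \<open>k\<close>, where the factors reproduce
  separately: the zonal one by the sphere integral, the radial one by
  \<open>perturbed_kernel_reproducing\<close>.\<close>

lemma sobolev_kernel_reproducing_zonal:
  fixes x a :: "real ^ 'n"
  assumes k: "2 * degree q + k \<le> n"
  shows "ball_sobolev_inner \<mu> lam (\<lambda>y. radial q y * zonal \<delta> k a y) (sobolev_kernel \<mu> \<delta> C (lam *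
      C) n x) =
    radial q x * zonal \<delta> k a x"
proof -
  define P where "P = (\<lambda>k. perturbed_kernel \<mu> (real k + \<delta>) ((n - k) div 2) k (2 ^ k * (lam * C))
      (2 * (x \<bullet> x) - 1))"
  define f where "f = (\<lambda>y. radial q y * zonal \<delta> k a y)"
  have r: "real_polynomial_function (\<lambda>y :: real ^ 'n. radial p y * zonal \<delta> l b y)" for p l b
    by (rule real_polynomial_function.intros(4)[OF real_polynomial_function_radial
        real_polynomial_function_zonal])
  have rf: "real_polynomial_function f" unfolding f_def by (rule r)
  have "ball_sobolev_inner \<mu> lam f (sobolev_kernel \<mu> \<delta> C (lam * C) n x) =
      ball_sobolev_inner \<mu> lam (\<lambda>y. \<Sum>l\<le>n. (2 ^ l * C) * (radial (P l) y * zonal \<delta> l x y)) f"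
    by (subst ball_sobolev_inner_commute) (simp add: sobolev_kernel_def[abs_def] P_def)
  also have "\<dots> = (\<Sum>l\<le>n. (2 ^ l * C) * ball_sobolev_inner \<mu> lam f (\<lambda>y. radial (P l) y *
      zonal \<delta> l x y))"
    by (subst ball_sobolev_inner_sum_left[OF \<mu> real_polynomial_function_cmult[OF r] rf])
      (simp_all only: ball_sobolev_inner_cmult_left[OF r rf] ball_sobolev_inner_commute[of \<mu> lam f]
        finite_atMost)
  also have "\<dots> = (\<Sum>l\<in>{k}. (2 ^ l * C) * ball_sobolev_inner \<mu> lam f (\<lambda>y. radial (P l) y *
      zonal \<delta> l x y))"
    using k by (intro sum.mono_neutral_right) (auto simp: f_def ball_sobolev_inner_zonal[OF \<mu> \<delta> d
        C])
  also have "\<dots> = (2 ^ k * C) * ((jacobi_integral \<mu> (real k + \<delta>) (q * P k) / (2 ^ k * C) + lam *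
      boundary k q * boundary k (P k)) * zonal \<delta> k a x)"
    by (simp add: f_def ball_sobolev_inner_zonal[OF \<mu> \<delta> d C])
  also have "\<dots> = (jacobi_integral \<mu> (real k + \<delta>) (q * P k) + 2 ^ k * (lam * C) * boundary k q *
      boundary k (P k)) * zonal \<delta> k a x"
    using C_pos by (simp add: field_simps)
  also have "jacobi_integral \<mu> (real k + \<delta>) (q * P k) + 2 ^ k * (lam * C) * boundary k q *
      boundary k (P k) = radial q x"
    unfolding P_def radial_def using \<mu> \<delta>_pos lam C_pos k
    by (intro perturbed_kernel_reproducing) auto
  finally show ?thesis by (simp add: f_def)
qed

lemma sobolev_kernel_reproducing:
  fixes x :: "real ^ 'n"
  assumes f: "f \<in> polys_upto n"
  shows "ball_sobolev_inner \<mu> lam f (sobolev_kernel \<mu> \<delta> C (lam * C) n x) = f x"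
proof -
  define G where "G = sobolev_kernel \<mu> \<delta> C (lam * C) n x"
  have rG: "real_polynomial_function G"
    unfolding G_def by (rule polys_upto_imp_real_polynomial_function[OF sobolev_kernel_polys_upto])
  define \<Phi> where "\<Phi> = (\<lambda>f. ball_sobolev_inner \<mu> lam f G - f x)"
  have add: "\<Phi> (\<lambda>x. f x + g x) = \<Phi> f + \<Phi> g"
      if "real_polynomial_function f" "real_polynomial_function g" for f g
    using that by (simp add: \<Phi>_def ball_sobolev_inner_add_left[OF \<mu>] rG)
  have cmult: "\<Phi> (\<lambda>x. c * f x) = c * \<Phi> f" if "real_polynomial_function f" for f c
    using that by (simp add: \<Phi>_def ball_sobolev_inner_cmult_left rG right_diff_distrib)
  have sum: "\<Phi> (\<lambda>x. \<Sum>i\<in>I. f i x) = (\<Sum>i\<in>I. \<Phi> (f i))"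
      if "finite I" "\<And>i. real_polynomial_function (f i)" for I :: "nat set" and f
    using that by (simp add: \<Phi>_def ball_sobolev_inner_sum_left[OF \<mu> _ rG] sum_subtractf)
  \<comment> \<open>\<open>zonal\<close> is a multiple of (a . y)^k plus terms with lower powers of
    a . y and compensating powers of y . y. Carrying the factor (y . y)^j through the induction lets
    this triangular relation be inverted within total degree \<open>n\<close>.\<close>
  have pow: "\<Phi> (\<lambda>y. (a \<bullet> y) ^ k * (y \<bullet> y) ^ j) = 0" if "k + 2 * j \<le> n" for a k j
    using that
  proof (induction k arbitrary: j rule: less_induct)
    case (less k)
    define c where "c = (\<lambda>i. (real k + \<delta>) / \<delta> * (zonal_coeff \<delta> k i * (a \<bullet> a) ^ i))"
    define S where "S = (\<lambda>i y. (a \<bullet> y) ^ (k - 2 * i) * (y \<bullet> y) ^ (j + i))"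
    have rS: "real_polynomial_function (S i)" for i
      unfolding S_def by (rule real_polynomial_function_inner_powers)
    \<comment> \<open>The polynomial (1 + t) / 2 at t = 2 |y|^2 - 1 is |y|^2, so its
      \<open>j\<close>-th power produces (y . y)^j.\<close>
    have "2 * degree ([:1/2, 1/2 :: real:] ^ j) + k \<le> n"
      using less.prems by (simp add: degree_power_eq)
    from sobolev_kernel_reproducing_zonal[OF this, of a x]
    have "\<Phi> (\<lambda>y. radial ([:1/2, 1/2:] ^ j) y * zonal \<delta> k a y) = 0"
      by (simp add: \<Phi>_def G_def)
    moreover have "radial ([:1/2, 1/2:] ^ j) y * zonal \<delta> k a y = (\<Sum>i\<le>k div 2. c i * S i y)" for y
    proof -
      have "radial ([:1/2, 1/2:] ^ j) y = (y \<bullet> y) ^ j"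
          by (simp add: radial_def poly_power field_simps)
      then show ?thesis
        by (simp add: zonal_def c_def S_def sum_distrib_left power_add mult_ac)
    qed
    ultimately have "0 = \<Phi> (\<lambda>y. \<Sum>i\<le>k div 2. c i * S i y)" by simp
    also have "\<dots> = (\<Sum>i\<le>k div 2. c i * \<Phi> (S i))"
      by (subst sum) (auto simp: cmult rS intro: real_polynomial_function_cmult)
    also have "\<dots> = (\<Sum>i\<in>{0}. c i * \<Phi> (S i))"
    proof (rule sum.mono_neutral_right)
      show "\<forall>i\<in>{..k div 2} - {0}. c i * \<Phi> (S i) = 0"
      proof
        fix i assume "i \<in> {..k div 2} - {0}"
        then have "k - 2 * i < k" "k - 2 * i + 2 * (j + i) \<le> n" using less.prems by auto
        then show "c i * \<Phi> (S i) = 0" using less.IH[of "k - 2 * i" "j + i"] by (simp add: S_def)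
      qed
    qed auto
    finally have "c 0 * \<Phi> (S 0) = 0" by simp
    \<comment> \<open>Positivity of \<open>\<delta>\<close> makes the leading zonal coefficient
      nonzero, so the pure power can be solved for.\<close>
    moreover have "c 0 > 0"
      using \<delta>_pos pochhammer_pos[OF \<delta>_pos, of k] by (simp add: c_def zonal_coeff_def)
    ultimately show ?case by (simp add: S_def)
  qed
  have "\<Phi> (\<lambda>y. (a \<bullet> y) ^ k) = 0" if "k \<le> n" for a k
    using pow[of k 0 a] that by simp
  from linear_functional_polys_upto_zero[of \<Phi>, OF add cmult this f]
  have "\<Phi> f = 0" .
  then show ?thesis unfolding \<Phi>_def G_def by (rule right_minus_eq[THEN iffD1])
qed

lemma basis_kernel_sobolev:
  fixes B :: "(real ^ 'n \<Rightarrow> real) set"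
  assumes B: "orthogonal_poly_basis (ball_sobolev_inner \<mu> lam) n B"
  shows "basis_kernel (ball_sobolev_inner \<mu> lam) B x y = sobolev_kernel \<mu> \<delta> C (lam * C) n x y"
proof (rule basis_kernel_eqI[OF B sobolev_kernel_polys_upto sobolev_kernel_reproducing])
  fix f c assume f: "f \<in> B"
  have r: "real_polynomial_function p" if "p \<in> B" for p
    using B that by (auto simp: orthogonal_poly_basis_def
        intro: polys_upto_imp_real_polynomial_function)
  have fin: "finite B" using B by (simp add: orthogonal_poly_basis_def)
  have "ball_sobolev_inner \<mu> lam f (\<lambda>x. \<Sum>q\<in>B. c q * q x) = ball_sobolev_inner \<mu> lam (\<lambda>x. \<Sum>q\<in>B. c q *
      q x) f"
    by (rule ball_sobolev_inner_commute)
  also have "\<dots> = (\<Sum>q\<in>B. ball_sobolev_inner \<mu> lam (\<lambda>x. c q * q x) f)"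
    by (rule ball_sobolev_inner_sum_left[OF \<mu> real_polynomial_function_cmult[OF r] r[OF f] fin])
  also have "\<dots> = (\<Sum>q\<in>B. c q * ball_sobolev_inner \<mu> lam f q)"
    by (rule sum.cong) (simp_all add: ball_sobolev_inner_cmult_left r f
        ball_sobolev_inner_commute[of \<mu> lam f])
  finally show "ball_sobolev_inner \<mu> lam f (\<lambda>x. \<Sum>q\<in>B. c q * q x) =
      (\<Sum>q\<in>B. c q * ball_sobolev_inner \<mu> lam f q)" .
qed

end

theorem proposition5p4:
  fixes \<mu> lam \<delta> A0 r s :: real
    and n :: nat
    and B BS :: "(real ^ 'n \<Rightarrow> real) set"
    and x y \<xi> \<rho> :: "real ^ 'n"
  assumes "CARD('n) \<ge> 3"
    and "\<mu> > -1"
    and "lam > 0"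
    and "\<delta> = (real CARD('n) - 2) / 2"
    and "A0 = A0_const TYPE('n) \<mu> lam"
    and "orthogonal_poly_basis (ball_inner \<mu>) n B"
    and "orthogonal_poly_basis (ball_sobolev_inner \<mu> lam) n BS"
    and "r = norm x" and "norm \<xi> = 1" and "x = r *\<^sub>R \<xi>"
    and "s = norm y" and "norm \<rho> = 1" and "y = s *\<^sub>R \<rho>"
  shows "basis_kernel (ball_sobolev_inner \<mu> lam) BS x y =
    basis_kernel (ball_inner \<mu>) B x y -
      A0 / lam *
        (\<Sum>k=0..n.
          (kernel_vec ((n - k) div 2) \<mu> (real k + \<delta>) (2 * r\<^sup>2 - 1) \<bullet>
            (Lambda_mat ((n - k) div 2) \<mu> (real k + \<delta>) (mass_mat A0 k) *v
              kernel_vec ((n - k) div 2) \<mu> (real k + \<delta>) (2 * s\<^sup>2 - 1))) *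
          2 ^ k * (r * s) ^ k * ((real k + \<delta>) / \<delta>) * gegenbauer k \<delta> (\<xi> \<bullet> \<rho>))"
proof -
  define C where "C = 2 powr (\<delta> + \<mu> + 2) * ball_mass TYPE('n) \<mu> / sphere_area TYPE('n)"
  have A0: "A0 = lam * C" unfolding assms(5) A0_const_def C_def assms(4) by simp
  have \<delta>: "\<delta> > 0" using assms(1,4) by simp
  have C: "C > 0" unfolding C_def
    using sphere_area_pos[where 'n = 'n] ball_mass_pos[OF assms(2), where 'n = 'n] by simp
  have S0: "ball_inner \<mu> = (ball_sobolev_inner \<mu> 0 :: (real ^ 'n \<Rightarrow> real) \<Rightarrow> _)"
    by (simp add: fun_eq_iff ball_sobolev_inner_def)
  have xx: "x \<bullet> x = r\<^sup>2" "y \<bullet> y = s\<^sup>2" by (simp_all only: assms(8,11) power2_norm_eq_inner)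
  \<comment> \<open>At the origin the unit vector is undetermined; as \<open>zonal\<close> is
    polynomial in both arguments, the identity holds for every choice of it.\<close>
  have z: "zonal \<delta> k x y = (r * s) ^ k * ((real k + \<delta>) / \<delta>) * gegenbauer k \<delta> (\<xi> \<bullet> \<rho>)" for k
    using zonal_gegenbauer[OF assms(9) assms(12), of \<delta> k r s]
        unfolding assms(10)[symmetric] assms(13)[symmetric] .
  define K where "K = (\<lambda>k. jacobi_kernel ((n - k) div 2) \<mu> (real k + \<delta>) (2 * r\<^sup>2 - 1) (2 *
      s\<^sup>2 - 1))"
  define L where "L = (\<lambda>k. kernel_vec ((n - k) div 2) \<mu> (real k + \<delta>) (2 * r\<^sup>2 - 1) \<bullet>
            (Lambda_mat ((n - k) div 2) \<mu> (real k + \<delta>) (mass_mat A0 k) *v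
              kernel_vec ((n - k) div 2) \<mu> (real k + \<delta>) (2 * s\<^sup>2 - 1)))"
  have ab: "real k + \<delta> > -1" for k using \<delta> by simp
  have "A0 \<ge> 0" using A0 assms(3) C by simp
  then have "basis_kernel (ball_sobolev_inner \<mu> lam) BS x y =
      (\<Sum>k\<le>n. (2 ^ k * C) * ((K k - L k) * zonal \<delta> k x y))"
    unfolding basis_kernel_sobolev[OF assms(2) less_imp_le[OF assms(3)] assms(4,1) C_def assms(7)]
      sobolev_kernel_def radial_def A0[symmetric] xx poly_perturbed_kernel[OF assms(2) ab \<open>A0 \<ge> 0\<close>]
    by (simp add: K_def L_def)
  moreover have "basis_kernel (ball_inner \<mu>) B x y = (\<Sum>k\<le>n. (2 ^ k * C) * (K k * zonal \<delta> k x y))"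
    using assms(6) unfolding S0
    by (subst basis_kernel_sobolev[OF assms(2) order_refl assms(4,1) C_def])
      (simp_all add: sobolev_kernel_def radial_def xx poly_perturbed_kernel_0[OF assms(2) ab] K_def)
  moreover have "(\<Sum>k\<le>n. (2 ^ k * C) * ((K k - L k) * zonal \<delta> k x y)) =
      (\<Sum>k\<le>n. (2 ^ k * C) * (K k * zonal \<delta> k x y)) - C * (\<Sum>k\<le>n. L k * 2 ^ k * zonal \<delta> k x y)"
    unfolding sum_distrib_left sum_subtractf[symmetric]
        by (rule sum.cong) (simp_all add: algebra_simps)
  moreover have "A0 / lam = C" using A0 assms(3) by simp
  ultimately show ?thesis
    unfolding L_def[symmetric] atMost_atLeast0 z by (simp add: L_def mult.assoc)
qed

end
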